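(* Let $n\ge1$, let $p\ge 0$ be an integer, and let $L,L',h_0\in\mathbb R$ satisfy $$0<L+\tfrac32 h_0\sqrt n<L',\qquad 0<h_0\le 1.$$ Let $s_0\in C^\infty(B_{L'}\setminus\{\mathbf 0\})$ be of the form $s_0(\mathbf x)=|\mathbf x|^\gamma\,\ell_0\!\left(\frac{\mathbf x}{|\mathbf x|}\right)$ with $\ell_0\in C^\infty(\mathbb S^{n-1})$ and $\gamma>-n$ real, and let $\boldsymbol\alpha\in\mathbb R^n$ with $|\boldsymbol\alpha|_\infty\le 1/2$. Then there exist constants $\mu_\nu$ and $M_\nu$ (for multi-indices $\nu\in\mathbb N_0^n$, $|\nu|\le p$), independent of $h$ and $v$ but depending on $\boldsymbol\alpha,\gamma,p$ and $\ell_0$, such that for every $v\in C^\infty_c(B_L)$ and $0<h<h_0$, with $$f_0(\mathbf x):=s_0(\mathbf x-h\boldsymbol\alpha)\,v(\mathbf x),$$ one has the two expansions $$(\mathcal I-T_h^0)[f_0]=h^{\gamma+n}\sum_{|\nu|\le p}h^{|\nu|}\,v^{(\nu)}(\mathbf 0)\,\mu_\nu+\mathcal O(h^{\gamma+n+p+1}),$$ $$(\mathcal I-T_h^0)[f_0]=h^{\gamma+n}\sum_{|\nu|\le p}h^{|\nu|}\,v^{(\nu)}(h\boldsymbol\alpha)\,M_\nu+\mathcal O(h^{\gamma+n+p+1}).$$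
   Context: $|\cdot|$ is the Euclidean norm on $\mathbb R^n$, $|\mathbf x|_\infty=\max_i|x_i|$, $B_r=\{\mathbf x\in\mathbb R^n:|\mathbf x|<r\}$, and $\mathbb S^{n-1}$ is the unit sphere of $\mathbb R^n$. $\mathcal I[f]:=\int_{\mathbb R^n}f(\mathbf x)\,d\mathbf x$, and the punctured trapezoidal rule is $T_h^0[f]:=h^n\sum_{\mathbf y\in h\mathbb Z^n\setminus\{\mathbf 0\}}f(\mathbf y)$; $(\mathcal I-T_h^0)[f]=\mathcal I[f]-T_h^0[f]$. $v^{(\nu)}$ is the partial derivative of $v$ for the multi-index $\nu$. $v$ and $f_0$ are extended by zero outside $B_L$. $\mathcal O(\cdot)$ refers to $h\to0^+$ with all data other than $h$ (in particular $\boldsymbol\alpha,\gamma,\ell_0,v,p$) fixed. *)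

theory Defs
  imports "HOL-Analysis.Analysis" "HOL-Library.Landau_Symbols"
begin

definition partial_deriv :: "'n::finite \<Rightarrow> (real ^ 'n \<Rightarrow> real) \<Rightarrow> real ^ 'n \<Rightarrow> real" where
  "partial_deriv i f x = deriv (\<lambda>t. f (x + t *\<^sub>R axis i 1)) 0"

text \<open>
  On an open set \<open>U\<close> this is the usual class of \<open>k\<close> times continuously differentiable
  functions; it only depends on the values of \<open>f\<close> on \<open>U\<close>.
\<close>
primrec Ck_on :: "nat \<Rightarrow> (real ^ 'n::finite) set \<Rightarrow> (real ^ 'n \<Rightarrow> real) \<Rightarrow> bool" where
  "Ck_on 0 U f \<longleftrightarrow> continuous_on U f"
| "Ck_on (Suc k) U f \<longleftrightarrow> f differentiable_on U \<and> (\<forall>i. Ck_on k U (partial_deriv i f))"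

definition smooth_on :: "(real ^ 'n::finite) set \<Rightarrow> (real ^ 'n \<Rightarrow> real) \<Rightarrow> bool" where
  "smooth_on U f \<longleftrightarrow> open U \<and> (\<forall>k. Ck_on k U f)"

text \<open>
  Smoothness on the unit sphere as an embedded submanifold: locally the restriction of a smooth
  function on an open subset of the ambient space. The values of \<open>l\<close> off the sphere are
  irrelevant.
\<close>
definition smooth_on_sphere :: "(real ^ 'n::finite \<Rightarrow> real) \<Rightarrow> bool" where
  "smooth_on_sphere l \<longleftrightarrow>
     (\<forall>x\<in>sphere 0 1. \<exists>W F. x \<in> W \<and> smooth_on W F \<and> (\<forall>y\<in>W \<inter> sphere 0 1. F y = l y))"

text \<open>Smooth functions with compact support in \<open>U\<close>, extended by zero to the whole space.\<close>
definition test_functions :: "(real ^ 'n::finite) set \<Rightarrow> (real ^ 'n \<Rightarrow> real) set" where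
  "test_functions U =
     {v. smooth_on U v \<and> compact (closure {x. v x \<noteq> 0}) \<and> closure {x. v x \<noteq> 0} \<subseteq> U}"

definition mi_order :: "('n::finite \<Rightarrow> nat) \<Rightarrow> nat" where
  "mi_order \<nu> = (\<Sum>i\<in>UNIV. \<nu> i)"

text \<open>
  The partial derivative for the multi-index \<open>\<nu>\<close>: one differentiates along a list containing
  each index \<open>i\<close> exactly \<open>\<nu> i\<close> times. The index type carries no order, so the
  list is chosen arbitrarily; for smooth functions the choice does not matter.
\<close>
definition multi_deriv :: "('n::finite \<Rightarrow> nat) \<Rightarrow> (real ^ 'n \<Rightarrow> real) \<Rightarrow> real ^ 'n \<Rightarrow> real" where
  "multi_deriv \<nu> f = foldr partial_deriv (SOME is. \<forall>i. count_list is i = \<nu> i) f"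

definition grid :: "real \<Rightarrow> (real ^ 'n::finite) set" where
  "grid h = range (\<lambda>k :: int ^ 'n. \<chi> i. h * of_int (k $ i))"

text \<open>The sum has only finitely many nonzero terms when \<open>h > 0\<close> and \<open>f\<close> has bounded support.\<close>
definition punctured_trapezoidal :: "real \<Rightarrow> (real ^ 'n::finite \<Rightarrow> real) \<Rightarrow> real" where
  "punctured_trapezoidal h f = h ^ CARD('n) * (\<Sum>\<^sub>\<infinity>y\<in>grid h - {0}. f y)"

definition quadrature_error :: "real \<Rightarrow> (real ^ 'n::finite \<Rightarrow> real) \<Rightarrow> real" where
  "quadrature_error h f = integral\<^sup>L lborel f - punctured_trapezoidal h f"

end

theory Submission
  imports Defs
begin

text \<open>
  Put \<open>s(x) = |x|^\<gamma> l0(x / |x|)\<close>, a function homogeneous of degree \<open>\<gamma>\<close>. The change of variables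
  \<open>x = h y\<close> turns the quadrature error into \<open>h^(\<gamma> + n)\<close> times the defect
    \<open>E[u] = (integral of s(y - \<alpha>) u(y)) - (sum of s(k - \<alpha>) u(k) over nonzero integer points k)\<close>
  of \<open>u(y) = v(h y)\<close>. Everything rests on one estimate (\<open>lattice_defect_bound\<close>): if the pure partial
  derivatives satisfy \<open>|\<partial>\<^sub>i^j u(y)| \<le> A (1 + |y|)^(q - j)\<close> for \<open>j \<le> N\<close>, with \<open>N\<close> large in terms of \<open>q\<close>,
  \<open>\<gamma>\<close> and \<open>n\<close>, then \<open>|E[u]| \<le> K A\<close>. Near the origin this holds because \<open>|x|^\<gamma>\<close> is locally integrable. Away from
  the singularity the integrand \<open>F\<close> is smooth and \<open>\<partial>\<^sub>i^N F\<close> decays fast, so that the lattice sum differs from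
  the integral by a controlled amount (\<open>lattice_quadrature_bound\<close>).

  The reason for the latter is as follows. The sum \<open>P(x)\<close> of all \<open>F(k + x)\<close> is
  periodic and its mean over a unit cell is the integral of \<open>F\<close>. Along a coordinate direction every derivative
  of \<open>P\<close> is the derivative of a periodic function, hence vanishes somewhere; so the supremum of each
  derivative is at most that of the next one, and the oscillation of \<open>P\<close> is bounded by its \<open>N\<close>-th pure
  derivatives (\<open>periodic_derivative_bound\<close>).

  Let \<open>m\<^sub>\<nu>(x)\<close> be the normalised monomial \<open>x^\<nu> / \<nu>!\<close> and \<open>\<phi>\<close> a cutoff function equal to 1 near the origin. Since the
  truncations \<open>m\<^sub>\<nu>(y - \<beta>) \<phi>(\<delta> y)\<close> for two values of \<open>\<delta>\<close> agree on a ball of radius of order \<open>1 / \<delta>\<close>, the estimate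
  shows that \<open>E[m\<^sub>\<nu>(y - \<beta>) \<phi>(\<delta> y)]\<close> converges as \<open>\<delta>\<close> tends to 0, to a constant \<open>\<mu>\<^sub>\<nu>\<close> and with error
  \<open>O(\<delta>^(p + 1 - |\<nu>|))\<close>. Taylor's formula at \<open>h \<beta>\<close> writes \<open>v(h y)\<close> as the sum over \<open>|\<nu>| \<le> p\<close> of
  \<open>h^|\<nu>| v^(\<nu>)(h \<beta>) m\<^sub>\<nu>(y - \<beta>) \<phi>(h y)\<close> plus a remainder to which the estimate applies with \<open>q = p + 1\<close> and
  \<open>A = O(h^(p + 1))\<close>. This gives the expansion around the point \<open>h \<beta>\<close> for any fixed \<open>\<beta>\<close>
  (\<open>lattice_defect_expansion\<close>); the two assertions are the cases \<open>\<beta> = 0\<close> and \<open>\<beta> = \<alpha>\<close>.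
\<close>

section \<open>Partial derivatives\<close>

text \<open>
  Existence and value of the derivative together; \<open>partial_deriv\<close> alone does not assert existence.
\<close>
definition has_partial :: "'n::finite \<Rightarrow> (real ^ 'n \<Rightarrow> real) \<Rightarrow> real \<Rightarrow> real ^ 'n \<Rightarrow> bool" where
  "has_partial i f d y \<longleftrightarrow> ((\<lambda>t. f (y + t *\<^sub>R axis i 1)) has_real_derivative d) (at 0)"

lemma partial_deriv_eqI: "has_partial i f d y \<Longrightarrow> partial_deriv i f y = d"
  unfolding has_partial_def partial_deriv_def by (rule DERIV_imp_deriv)

lemma has_partial_along_line:
  assumes "has_partial i f d (y + t *\<^sub>R axis i 1)"
  shows "((\<lambda>t. f (y + t *\<^sub>R axis i 1)) has_real_derivative d) (at t)"
proof -
  have "((\<lambda>s. f (y + (s + t) *\<^sub>R axis i 1)) has_real_derivative d) (at 0)"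
    using assms unfolding has_partial_def by (simp add: algebra_simps)
  then show ?thesis
    using DERIV_shift[of "\<lambda>t. f (y + t *\<^sub>R axis i 1)" d 0 t] by simp
qed

lemma eventually_line_in_open:
  fixes U :: "(real ^ 'n::finite) set"
  assumes "open U" "y \<in> U"
  shows "eventually (\<lambda>t. y + t *\<^sub>R axis i 1 \<in> U) (nhds (0::real))"
proof -
  have "isCont (\<lambda>t::real. y + t *\<^sub>R axis i 1) 0"
    by (intro continuous_intros)
  then have "((\<lambda>t::real. y + t *\<^sub>R axis i 1) \<longlongrightarrow> y + 0 *\<^sub>R axis i 1) (nhds 0)"
    unfolding isCont_def by (subst (asm) tendsto_at_iff_tendsto_nhds)
  then show ?thesis
    using assms topological_tendstoD[of _ "y + 0 *\<^sub>R axis i 1"] by simp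
qed

lemma has_partial_cong:
  assumes "open U" "y \<in> U" "\<And>z. z \<in> U \<Longrightarrow> f z = g z"
  shows "has_partial i f d y \<longleftrightarrow> has_partial i g d y"
  unfolding has_partial_def
  by (rule DERIV_cong_ev)
     (auto intro!: eventually_mono[OF eventually_line_in_open[OF assms(1,2)]] assms(3))

lemma partial_deriv_cong:
  assumes "open U" "y \<in> U" "\<And>z. z \<in> U \<Longrightarrow> f z = g z"
  shows "partial_deriv i f y = partial_deriv i g y"
  unfolding partial_deriv_def
  by (rule deriv_cong_ev)
     (auto intro!: eventually_mono[OF eventually_line_in_open[OF assms(1,2)]] assms(3))

lemma has_partial_const [intro]: "has_partial i (\<lambda>_. c) 0 y"
  unfolding has_partial_def by simp

lemma has_partial_add:
  "has_partial i f a y \<Longrightarrow> has_partial i g b y \<Longrightarrow> has_partial i (\<lambda>x. f x + g x) (a + b) y"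
  unfolding has_partial_def by (rule DERIV_add)

lemma has_partial_diff:
  "has_partial i f a y \<Longrightarrow> has_partial i g b y \<Longrightarrow> has_partial i (\<lambda>x. f x - g x) (a - b) y"
  unfolding has_partial_def by (rule DERIV_diff)

lemma has_partial_mult:
  "has_partial i f a y \<Longrightarrow> has_partial i g b y \<Longrightarrow>
    has_partial i (\<lambda>x. f x * g x) (a * g y + f y * b) y"
  unfolding has_partial_def
  by (drule (1) DERIV_mult) (simp add: mult.commute)

lemma has_partial_cmult:
  "has_partial i f a y \<Longrightarrow> has_partial i (\<lambda>x. c * f x) (c * a) y"
  unfolding has_partial_def by (rule DERIV_cmult)

lemma has_partial_sum:
  "(\<And>k. k \<in> K \<Longrightarrow> has_partial i (f k) (a k) y) \<Longrightarrow>
    has_partial i (\<lambda>x. \<Sum>k\<in>K. f k x) (\<Sum>k\<in>K. a k) y"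
  unfolding has_partial_def by (rule DERIV_sum)

lemma has_partial_affine:
  assumes "has_partial i f d (h *\<^sub>R y + c)"
  shows "has_partial i (\<lambda>x. f (h *\<^sub>R x + c)) (h * d) y"
proof -
  have "((\<lambda>t. f ((h *\<^sub>R y + c) + t *\<^sub>R axis i 1)) has_real_derivative d) (at (h * 0))"
    using assms unfolding has_partial_def by simp
  from DERIV_chain2[OF this DERIV_cmult_Id[of h 0 UNIV]]
  have "((\<lambda>t. f ((h *\<^sub>R y + c) + (h * t) *\<^sub>R axis i 1)) has_real_derivative d * h) (at 0)"
    by simp
  moreover have "(\<lambda>t. f ((h *\<^sub>R y + c) + (h * t) *\<^sub>R axis i 1)) =
      (\<lambda>t. f (h *\<^sub>R (y + t *\<^sub>R axis i 1) + c))"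
    by (intro ext arg_cong[where f = f]) (simp add: algebra_simps)
  ultimately show ?thesis
    unfolding has_partial_def by (simp only: mult.commute)
qed

lemma has_partial_of_has_derivative:
  assumes "(f has_derivative D) (at y)"
  shows "has_partial i f (D (axis i 1)) y"
proof -
  have 1: "((\<lambda>t::real. y + t *\<^sub>R axis i 1) has_derivative (\<lambda>t. t *\<^sub>R axis i 1)) (at 0)"
    by (auto intro!: derivative_eq_intros)
  have "((\<lambda>t. f (y + t *\<^sub>R axis i 1)) has_derivative (\<lambda>t. D (t *\<^sub>R axis i 1))) (at 0)"
    using has_derivative_compose[OF 1, of f D] assms by simp
  moreover have "linear D" using assms has_derivative_linear by blast
  then have "(\<lambda>t. D (t *\<^sub>R axis i 1)) = (*) (D (axis i 1))"
    by (auto simp: fun_eq_iff linear_cmul)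
  ultimately show ?thesis
    unfolding has_partial_def has_field_derivative_def by simp
qed

lemma has_derivative_partials:
  fixes f :: "real ^ 'n::finite \<Rightarrow> real"
  assumes "f differentiable (at x)"
  shows "(f has_derivative (\<lambda>d. \<Sum>i\<in>UNIV. d $ i * partial_deriv i f x)) (at x)"
proof -
  obtain D where D: "(f has_derivative D) (at x)"
    using assms unfolding differentiable_def by blast
  then have lin: "linear D" using has_derivative_linear by blast
  have p: "partial_deriv i f x = D (axis i 1)" for i
    using has_partial_of_has_derivative[OF D] by (rule partial_deriv_eqI)
  have "D d = (\<Sum>i\<in>UNIV. d $ i * partial_deriv i f x)" for d
  proof -
    have "D d = D (\<Sum>i\<in>UNIV. (d $ i) *\<^sub>R axis i 1)"
      using basis_expansion[of d] by (simp only: scalar_mult_eq_scaleR)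
    also have "\<dots> = (\<Sum>i\<in>UNIV. D ((d $ i) *\<^sub>R axis i 1))"
      by (rule linear_sum[OF lin])
    finally show ?thesis by (simp add: p linear_cmul[OF lin])
  qed
  then show ?thesis using D by (metis (no_types, lifting) ext)
qed

lemma has_partial_of_differentiable:
  "f differentiable (at y) \<Longrightarrow> has_partial i f (partial_deriv i f y) y"
  by (metis differentiable_def has_partial_of_has_derivative partial_deriv_eqI)

lemma partial_deriv_iter_vanish:
  assumes "open V" "\<And>y. y \<in> V \<Longrightarrow> f y = 0" "y \<in> V"
  shows "(partial_deriv i ^^ j) f y = 0"
  using assms(3)
proof (induction j arbitrary: y)
  case (Suc j)
  have "partial_deriv i ((partial_deriv i ^^ j) f) y = partial_deriv i (\<lambda>_. 0) y"
    by (rule partial_deriv_cong[OF assms(1) Suc.prems]) (rule Suc.IH)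
  also have "\<dots> = 0" by (rule partial_deriv_eqI) (rule has_partial_const)
  finally show ?case by simp
qed (use assms in auto)

lemma partial_deriv_iter_family:
  assumes "\<And>j y. j < N \<Longrightarrow> has_partial i (G j) (G (Suc j) y) y"
  shows "j \<le> N \<Longrightarrow> (partial_deriv i ^^ j) (G 0) = G j"
proof (induction j)
  case (Suc j)
  then have "(partial_deriv i ^^ Suc j) (G 0) = partial_deriv i (G j)" by simp
  also have "\<dots> = G (Suc j)"
    using partial_deriv_eqI[OF assms] Suc.prems by (intro ext) auto
  finally show ?case .
qed simp

lemma Ck_on_partial_deriv_iter: "Ck_on (j + k) U f \<Longrightarrow> Ck_on k U ((partial_deriv i ^^ j) f)"
  by (induction j arbitrary: f) (auto simp: funpow_Suc_right simp del: funpow.simps)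

lemma Ck_on_differentiable: "open U \<Longrightarrow> Ck_on (Suc k) U f \<Longrightarrow> x \<in> U \<Longrightarrow> f differentiable (at x)"
  by (metis Ck_on.simps(2) at_within_open differentiable_on_def)

section \<open>Bounds on pure partial derivatives\<close>

text \<open>
  On \<open>U\<close> the first \<open>N\<close> pure derivatives in direction \<open>i\<close> exist and the \<open>j\<close>-th one is bounded by
  \<open>b y / (1 + |y|)^j\<close>, as for symbols of pseudodifferential operators: each derivative gains one power of
  decay. The weight \<open>b\<close> is an arbitrary function, so that a bound can be improved on part of the space
  without changing the class.
\<close>
primrec symbol_bound ::
  "'n::finite \<Rightarrow> nat \<Rightarrow> (real ^ 'n) set \<Rightarrow> (real ^ 'n \<Rightarrow> real) \<Rightarrow> (real ^ 'n \<Rightarrow> real) \<Rightarrow> bool" where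
  "symbol_bound i 0 U b f \<longleftrightarrow> (\<forall>y\<in>U. \<bar>f y\<bar> \<le> b y)"
| "symbol_bound i (Suc N) U b f \<longleftrightarrow>
     (\<forall>y\<in>U. \<bar>f y\<bar> \<le> b y \<and> has_partial i f (partial_deriv i f y) y) \<and>
     symbol_bound i N U (\<lambda>y. b y / (1 + norm y)) (partial_deriv i f)"

lemma symbol_bound_abs_le: "symbol_bound i N U b f \<Longrightarrow> y \<in> U \<Longrightarrow> \<bar>f y\<bar> \<le> b y"
  by (cases N) auto

lemma symbol_bound_mono:
  "symbol_bound i N U b f \<Longrightarrow> (\<And>y. y \<in> V \<Longrightarrow> b y \<le> c y) \<Longrightarrow> V \<subseteq> U \<Longrightarrow> symbol_bound i N V c f"
proof (induction N arbitrary: b c f)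
  case 0 then show ?case by (auto intro: order_trans)
next
  case (Suc N)
  have "symbol_bound i N V (\<lambda>y. c y / (1 + norm y)) (partial_deriv i f)"
    using Suc.prems by (intro Suc.IH[where b = "\<lambda>y. b y / (1 + norm y)"]) (auto intro!: divide_right_mono)
  then show ?case using Suc.prems by (auto intro: order_trans)
qed

lemma symbol_bound_Suc_D: "symbol_bound i (Suc N) U b f \<Longrightarrow> symbol_bound i N U b f"
proof (induction N arbitrary: b f)
  case (Suc N)
  show ?case using Suc.prems Suc.IH[of "\<lambda>y. b y / (1 + norm y)" "partial_deriv i f"] by simp
qed simp

lemma symbol_bound_cong:
  assumes "open U"
  shows "(\<And>y. y \<in> U \<Longrightarrow> f y = g y) \<Longrightarrow> symbol_bound i N U b f \<longleftrightarrow> symbol_bound i N U b g"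
proof (induction N arbitrary: b f g)
  case (Suc N)
  have p: "\<And>y. y \<in> U \<Longrightarrow> partial_deriv i f y = partial_deriv i g y"
    by (rule partial_deriv_cong[OF assms]) (auto simp: Suc.prems)
  show ?case
    using Suc.IH[OF p] Suc.prems p has_partial_cong[OF assms _ Suc.prems] by simp
qed simp

lemma symbol_bound_Un:
  "symbol_bound i N U b f \<Longrightarrow> symbol_bound i N V b f \<Longrightarrow> symbol_bound i N (U \<union> V) b f"
  by (induction N arbitrary: b f) auto

text \<open>
  To verify the recursion it suffices to know the derivative on \<open>U\<close>: as \<open>U\<close> is open, replacing
  \<open>partial_deriv i f\<close> by a function equal to it on \<open>U\<close> does not change the further derivatives there.
\<close>
lemma symbol_bound_step:
  assumes "open U" "\<And>y. y \<in> U \<Longrightarrow> \<bar>f y\<bar> \<le> b y" "\<And>y. y \<in> U \<Longrightarrow> has_partial i f (g y) y"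
    and "symbol_bound i N U (\<lambda>y. b y / (1 + norm y)) g"
  shows "symbol_bound i (Suc N) U b f"
proof -
  have "\<And>y. y \<in> U \<Longrightarrow> partial_deriv i f y = g y"
    using assms(3) partial_deriv_eqI by blast
  then show ?thesis
    using assms symbol_bound_cong[OF assms(1), of "partial_deriv i f" g] by simp
qed

lemma symbol_bound_family:
  assumes "open U"
    and "\<And>j y. j \<le> N \<Longrightarrow> y \<in> U \<Longrightarrow> \<bar>G j y\<bar> \<le> b y / (1 + norm y) ^ j"
    and "\<And>j y. j < N \<Longrightarrow> y \<in> U \<Longrightarrow> has_partial i (G j) (G (Suc j) y) y"
  shows "symbol_bound i N U b (G 0)"
  using assms(2,3)
proof (induction N arbitrary: b G)
  case 0 then show ?case by force
next
  case (Suc N)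
  show ?case
  proof (rule symbol_bound_step[OF assms(1)])
    show "symbol_bound i N U (\<lambda>y. b y / (1 + norm y)) (G (Suc 0))"
      using Suc.prems(1)[of "Suc _"] Suc.prems(2)[of "Suc _"]
      by (intro Suc.IH[where G = "\<lambda>j. G (Suc j)"]) (auto simp: field_simps)
  qed (use Suc.prems(1)[of 0] Suc.prems(2)[of 0] in auto)
qed

lemma symbol_bound_derivs:
  assumes "symbol_bound i N U b f"
  shows "j \<le> N \<Longrightarrow> y \<in> U \<Longrightarrow> \<bar>(partial_deriv i ^^ j) f y\<bar> \<le> b y / (1 + norm y) ^ j"
    and "j < N \<Longrightarrow> y \<in> U \<Longrightarrow>
      has_partial i ((partial_deriv i ^^ j) f) ((partial_deriv i ^^ Suc j) f y) y"
proof -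
  have "(j \<le> N \<longrightarrow> (\<forall>y\<in>U. \<bar>(partial_deriv i ^^ j) f y\<bar> \<le> b y / (1 + norm y) ^ j)) \<and>
     (j < N \<longrightarrow> (\<forall>y\<in>U. has_partial i ((partial_deriv i ^^ j) f) ((partial_deriv i ^^ Suc j) f y) y))"
    using assms
  proof (induction N arbitrary: b f j)
    case 0 then show ?case by auto
  next
    case (Suc N)
    show ?case
    proof (cases j)
      case 0 then show ?thesis using Suc.prems by auto
    next
      case j: (Suc k)
      have "symbol_bound i N U (\<lambda>y. b y / (1 + norm y)) (partial_deriv i f)"
        using Suc.prems by simp
      from Suc.IH[OF this, of k] show ?thesis
        by (auto simp: j funpow_swap1 field_simps)
    qed
  qed
  then show "j \<le> N \<Longrightarrow> y \<in> U \<Longrightarrow> \<bar>(partial_deriv i ^^ j) f y\<bar> \<le> b y / (1 + norm y) ^ j"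
    and "j < N \<Longrightarrow> y \<in> U \<Longrightarrow>
      has_partial i ((partial_deriv i ^^ j) f) ((partial_deriv i ^^ Suc j) f y) y" by auto
qed

lemma symbol_bound_0: "open U \<Longrightarrow> (\<And>y. y \<in> U \<Longrightarrow> 0 \<le> b y) \<Longrightarrow> symbol_bound i N U b (\<lambda>_. 0)"
proof (induction N arbitrary: b)
  case (Suc N)
  show ?case
    by (rule symbol_bound_step[where g = "\<lambda>_. 0"]) (use Suc in auto)
qed simp

lemma symbol_bound_const: "open U \<Longrightarrow> symbol_bound i N U (\<lambda>_. \<bar>c\<bar>) (\<lambda>_. c)"
  by (cases N) (auto intro!: symbol_bound_step[where g = "\<lambda>_. 0"] symbol_bound_0 simp del: symbol_bound.simps(2))

lemma symbol_bound_add: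
  assumes "open U"
  shows "symbol_bound i N U b f \<Longrightarrow> symbol_bound i N U c g \<Longrightarrow>
    symbol_bound i N U (\<lambda>y. b y + c y) (\<lambda>y. f y + g y)"
proof (induction N arbitrary: b c f g)
  case 0 then show ?case by (fastforce intro: order_trans[OF abs_triangle_ineq] add_mono)
next
  case (Suc N)
  show ?case
  proof (rule symbol_bound_step[OF assms, where g = "\<lambda>y. partial_deriv i f y + partial_deriv i g y"])
    show "symbol_bound i N U (\<lambda>y. (b y + c y) / (1 + norm y)) (\<lambda>y. partial_deriv i f y + partial_deriv i g y)"
      using Suc.IH[of "\<lambda>y. b y / (1 + norm y)" "partial_deriv i f" "\<lambda>y. c y / (1 + norm y)" "partial_deriv i g"] Suc.prems
      by (simp add: add_divide_distrib)
  qed (use Suc.prems in \<open>force intro: order_trans[OF abs_triangle_ineq] add_mono has_partial_add\<close>)+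
qed

lemma symbol_bound_cmult:
  assumes "open U"
  shows "symbol_bound i N U b f \<Longrightarrow> symbol_bound i N U (\<lambda>y. \<bar>a\<bar> * b y) (\<lambda>y. a * f y)"
proof (induction N arbitrary: b f)
  case 0 then show ?case by (auto simp: abs_mult intro: mult_left_mono)
next
  case (Suc N)
  show ?case
  proof (rule symbol_bound_step[OF assms, where g = "\<lambda>y. a * partial_deriv i f y"])
    show "symbol_bound i N U (\<lambda>y. \<bar>a\<bar> * b y / (1 + norm y)) (\<lambda>y. a * partial_deriv i f y)"
      using Suc.IH[of "\<lambda>y. b y / (1 + norm y)" "partial_deriv i f"] Suc.prems by simp
  qed (use Suc.prems in \<open>auto simp: abs_mult intro!: has_partial_cmult mult_left_mono\<close>)
qed

lemma symbol_bound_diff: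
  assumes "open U" "symbol_bound i N U b f" "symbol_bound i N U c g"
  shows "symbol_bound i N U (\<lambda>y. b y + c y) (\<lambda>y. f y - g y)"
  using symbol_bound_add[OF assms(1,2) symbol_bound_cmult[OF assms(1,3), of "-1"]] by simp

text \<open>
  Leibniz' rule: in each of the \<open>N\<close> induction steps the number of products doubles, whence the factor \<open>2 ^ N\<close>.
\<close>
lemma symbol_bound_mult:
  assumes "open U"
  shows "symbol_bound i N U b f \<Longrightarrow> symbol_bound i N U c g \<Longrightarrow>
    symbol_bound i N U (\<lambda>y. 2 ^ N * (b y * c y)) (\<lambda>y. f y * g y)"
proof (induction N arbitrary: b c f g)
  case 0 then show ?case
    by (auto simp: abs_mult intro!: mult_mono intro: order_trans[OF abs_ge_zero])
next
  case (Suc N)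
  let ?f' = "partial_deriv i f" and ?g' = "partial_deriv i g"
  have nn: "0 \<le> b y * c y" if "y \<in> U" for y
    using Suc.prems that by (intro mult_nonneg_nonneg) (auto intro: order_trans[OF abs_ge_zero])
  show ?case
  proof (rule symbol_bound_step[OF assms, where g = "\<lambda>y. ?f' y * g y + f y * ?g' y"])
    fix y assume y: "y \<in> U"
    have "\<bar>f y * g y\<bar> \<le> b y * c y"
      using Suc.prems y by (auto simp: abs_mult intro!: mult_mono intro: order_trans[OF abs_ge_zero])
    also have "\<dots> \<le> 2 ^ Suc N * (b y * c y)"
      using mult_right_mono[OF one_le_power[of "2::real" "Suc N"] nn[OF y]] by simp
    finally show "\<bar>f y * g y\<bar> \<le> 2 ^ Suc N * (b y * c y)" .
  next
    have "symbol_bound i N U (\<lambda>y. 2 ^ N * (b y / (1 + norm y) * c y) + 2 ^ N * (b y * (c y / (1 + norm y))))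
        (\<lambda>y. ?f' y * g y + f y * ?g' y)"
      using Suc.prems symbol_bound_Suc_D[OF Suc.prems(1)] symbol_bound_Suc_D[OF Suc.prems(2)]
      by (intro symbol_bound_add[OF assms] Suc.IH) auto
    then show "symbol_bound i N U (\<lambda>y. 2 ^ Suc N * (b y * c y) / (1 + norm y))
        (\<lambda>y. ?f' y * g y + f y * ?g' y)"
      by (rule symbol_bound_mono) (auto simp: field_simps)
  qed (use Suc.prems in \<open>auto intro!: has_partial_mult\<close>)
qed

text \<open>
  Where a function vanishes identically only the sign of the bound matters. This is how truncations that
  agree on a large ball get a bound of higher order in the size of that ball.
\<close>
lemma symbol_bound_vanishing:
  assumes "symbol_bound i N UNIV b f" "open V" "\<And>y. y \<in> V \<Longrightarrow> f y = 0"
    and "\<And>y. y \<notin> V \<Longrightarrow> b y \<le> c y" "\<And>y. 0 \<le> c y"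
  shows "symbol_bound i N UNIV c f"
proof -
  have "symbol_bound i N (- V) c f"
    using assms by (auto intro: symbol_bound_mono)
  moreover have "symbol_bound i N V c f"
    using symbol_bound_0[OF \<open>open V\<close>, of c i N] assms(5)
      symbol_bound_cong[OF \<open>open V\<close>, of f "\<lambda>_. 0"] assms(3) by simp
  ultimately have "symbol_bound i N (- V \<union> V) c f"
    by (rule symbol_bound_Un)
  then show ?thesis by simp
qed

section \<open>Lattice sums of smooth functions\<close>

text \<open>
  By Rolle's theorem each \<open>f (Suc j)\<close> has a zero in the unit interval, because \<open>f j\<close> takes equal values at the ends.
  Hence the mean value theorem bounds \<open>f (Suc j)\<close> by the supremum of \<open>f (Suc (Suc j))\<close>, and a bound on the
  highest derivative propagates down without any loss.
\<close>
lemma periodic_derivative_bound: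
  fixes f :: "nat \<Rightarrow> real \<Rightarrow> real"
  assumes "0 < N"
    and deriv: "\<And>j t. j < N \<Longrightarrow> (f j has_real_derivative f (Suc j) t) (at t)"
    and per: "\<And>j. j < N \<Longrightarrow> f j 1 = f j 0"
    and bound: "\<And>t. t \<in> {0..1} \<Longrightarrow> \<bar>f N t\<bar> \<le> B"
  shows "t \<in> {0..1} \<Longrightarrow> \<bar>f 0 t - f 0 0\<bar> \<le> B"
proof -
  have mvt: "\<bar>f j t - f j s\<bar> \<le> B"
    if j: "j < N" and B: "\<And>t. t \<in> {0..1} \<Longrightarrow> \<bar>f (Suc j) t\<bar> \<le> B"
      and t: "t \<in> {0..1}" and s: "s \<in> {0..1}" for j t s
  proof -
    have "norm (f j t - f j s) \<le> B * norm (t - s)"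
      by (rule field_differentiable_bound[of "{0..1}" "f j" "f (Suc j)"])
         (use B t s deriv[OF j] in \<open>auto intro: has_field_derivative_at_within\<close>)
    also have "\<dots> \<le> B * 1"
      using t s order_trans[OF abs_ge_zero B[OF t]] by (intro mult_left_mono) auto
    finally show ?thesis by simp
  qed
  have "t \<in> {0..1} \<Longrightarrow> \<bar>f (Suc j) t\<bar> \<le> B" if "j < N" for j t
    using that
  proof (induction "N - j" arbitrary: j t)
    case 0 then show ?case by simp
  next
    case (Suc d)
    show ?case
    proof (cases "Suc j = N")
      case True then show ?thesis using bound Suc.prems by simp
    next
      case False
      then have j: "Suc j < N" using Suc.prems by simp
      have cont: "continuous_on {0..1} (f j)"
        by (rule DERIV_continuous_on[where D = "f (Suc j)"])
           (use deriv[OF \<open>j < N\<close>] in \<open>auto intro: has_field_derivative_at_within\<close>)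
      have "\<exists>z. 0 < z \<and> z < 1 \<and> (*) (f (Suc j) z) = (\<lambda>v. 0)"
      proof (rule Rolle_deriv[where f = "f j"])
        show "(f j has_derivative (*) (f (Suc j) x)) (at x)" for x
          using deriv[OF \<open>j < N\<close>, of x] unfolding has_field_derivative_def by simp
      qed (use per[OF \<open>j < N\<close>] cont in auto)
      then obtain z where z: "0 < z" "z < 1" "f (Suc j) z = 0"
        by (metis mult.right_neutral)
      have "\<bar>f (Suc j) t - f (Suc j) z\<bar> \<le> B"
        using z Suc.prems Suc.hyps(1)[of "Suc j"] Suc.hyps(2) j by (intro mvt) auto
      then show ?thesis using z by simp
    qed
  qed
  then show "t \<in> {0..1} \<Longrightarrow> \<bar>f 0 t - f 0 0\<bar> \<le> B"
    using \<open>0 < N\<close> by (intro mvt) auto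
qed

definition lattice_point :: "int ^ 'n \<Rightarrow> real ^ 'n::finite" where
  "lattice_point k = (\<chi> i. of_int (k $ i))"

lemma lattice_point_nth [simp]: "lattice_point k $ i = of_int (k $ i)"
  by (simp add: lattice_point_def)

lemma inj_lattice_point: "inj lattice_point"
  by (auto simp: inj_def vec_eq_iff)

lemma finite_lattice_points_bounded: "finite {k :: int ^ 'n::finite. norm (lattice_point k) \<le> r}"
proof -
  let ?J = "{- \<lceil>r\<rceil>..\<lceil>r\<rceil>}"
  have "{k :: int ^ 'n. norm (lattice_point k) \<le> r} \<subseteq> vec_lambda ` (PiE UNIV (\<lambda>_. ?J))"
  proof
    fix k :: "int ^ 'n" assume "k \<in> {k. norm (lattice_point k) \<le> r}"
    then have "\<bar>real_of_int (k $ i)\<bar> \<le> r" for i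
      using component_le_norm_cart[of "lattice_point k" i] by simp
    then have "k $ i \<in> ?J" for i
      by (smt (verit, ccfv_SIG) atLeastAtMost_iff le_of_int_ceiling of_int_le_iff of_int_minus)
    then show "k \<in> vec_lambda ` (PiE UNIV (\<lambda>_. ?J))"
      by (intro image_eqI[of _ _ "vec_nth k"]) auto
  qed
  moreover have "finite (PiE (UNIV :: 'n set) (\<lambda>_. ?J))"
    by (intro finite_PiE) auto
  ultimately show ?thesis using finite_surj by blast
qed

text \<open>
  The bound has to be uniform in the shift \<open>s\<close>; shifting the summation by the integer part of \<open>s\<close> reduces
  it to the convergence of the sum of \<open>1 / m\<^sup>2\<close>.
\<close>
lemma sum_inverse_square_int:
  obtains C :: real where "0 \<le> C"
    "\<And>K s. finite K \<Longrightarrow> (\<Sum>k\<in>K. inverse ((1 + \<bar>real_of_int k + s\<bar>)\<^sup>2)) \<le> C"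
proof -
  define g :: "nat \<Rightarrow> real" where "g n = inverse (real (max 1 n) ^ 2)" for n
  have sg: "summable g"
  proof (rule summable_comparison_test_ev)
    show "summable (\<lambda>n. inverse (real n ^ 2))"
      by (rule inverse_power_summable) auto
    show "\<forall>\<^sub>F n in sequentially. norm (g n) \<le> inverse (real n ^ 2)"
      using eventually_ge_at_top[of 1] by eventually_elim (simp add: g_def max_def)
  qed
  have g0: "0 \<le> g n" for n by (simp add: g_def)
  have half: "(\<Sum>k\<in>K. g (nat (h k))) \<le> suminf g"
    if "finite K" "inj_on h K" "\<And>k. k \<in> K \<Longrightarrow> 0 \<le> h k" for K :: "int set" and h :: "int \<Rightarrow> int"
  proof -
    have "inj_on (\<lambda>k. nat (h k)) K"
      using that by (metis (no_types, lifting) eq_nat_nat_iff inj_on_def)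
    then have "(\<Sum>k\<in>K. g (nat (h k))) = sum g ((\<lambda>k. nat (h k)) ` K)"
      by (simp add: sum.reindex)
    also have "\<dots> \<le> suminf g"
      using that g0 by (intro sum_le_suminf sg) auto
    finally show ?thesis .
  qed
  have "(\<Sum>k\<in>K. inverse ((1 + \<bar>real_of_int k + s\<bar>)\<^sup>2)) \<le> suminf g + suminf g"
    if K: "finite K" for K and s :: real
  proof -
    define m where "m = \<lfloor>s\<rfloor>"
    have 1: "inverse ((1 + \<bar>real_of_int k + s\<bar>)\<^sup>2) \<le> g (nat \<bar>k + m\<bar>)" for k
    proof -
      have "real_of_int m \<le> s" "s < real_of_int m + 1" by (auto simp: m_def)
      then have "real (max 1 (nat \<bar>k + m\<bar>)) \<le> 1 + \<bar>real_of_int k + s\<bar>"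
        by (auto simp: max_def nat_le_eq_zle)
      then have "real (max 1 (nat \<bar>k + m\<bar>)) ^ 2 \<le> (1 + \<bar>real_of_int k + s\<bar>)\<^sup>2"
        by (intro power_mono) auto
      then show ?thesis unfolding g_def
        by (intro le_imp_inverse_le) (auto simp: max_def)
    qed
    have "(\<Sum>k\<in>K. inverse ((1 + \<bar>real_of_int k + s\<bar>)\<^sup>2)) \<le> (\<Sum>k\<in>K. g (nat \<bar>k + m\<bar>))"
      by (intro sum_mono 1)
    also have "\<dots> = (\<Sum>k\<in>K \<inter> {k. 0 \<le> k + m}. g (nat \<bar>k + m\<bar>)) + (\<Sum>k\<in>K - {k. 0 \<le> k + m}. g (nat \<bar>k + m\<bar>))"
      by (rule sum.Int_Diff[OF K])
    also have "\<dots> \<le> suminf g + suminf g"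
      using K by (intro add_mono half) (auto simp: inj_on_def)
    finally show ?thesis .
  qed
  then show thesis
    using that[of "suminf g + suminf g"] suminf_nonneg[OF sg g0] by auto
qed

text \<open>
  A finite set of lattice points lies in a box, over which the sum of products is a product of
  one-dimensional sums.
\<close>
lemma sum_prod_inverse_square_lattice:
  obtains C :: real where "0 \<le> C"
    "\<And>K s. finite K \<Longrightarrow>
      (\<Sum>k\<in>K. \<Prod>i\<in>UNIV. inverse ((1 + \<bar>(lattice_point k + s :: real ^ 'n::finite) $ i\<bar>)\<^sup>2)) \<le> C"
proof -
  obtain C :: real where C: "0 \<le> C"
    "\<And>K s. finite K \<Longrightarrow> (\<Sum>k\<in>K. inverse ((1 + \<bar>real_of_int k + s\<bar>)\<^sup>2)) \<le> C"
    by (rule sum_inverse_square_int) blast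
  have "(\<Sum>k\<in>K. \<Prod>i\<in>UNIV. inverse ((1 + \<bar>(lattice_point k + s :: real ^ 'n::finite) $ i\<bar>)\<^sup>2)) \<le> C ^ CARD('n)"
    if K: "finite K" for K :: "(int ^ 'n) set" and s
  proof -
    define J where "J = (\<Union>k\<in>K. range (vec_nth k))"
    have J: "finite J" using K by (auto simp: J_def)
    let ?g = "\<lambda>i j. inverse ((1 + \<bar>real_of_int j + s $ i\<bar>)\<^sup>2)"
    have "(\<Sum>k\<in>K. \<Prod>i\<in>UNIV. ?g i (k $ i)) = (\<Sum>f\<in>vec_nth ` K. \<Prod>i\<in>UNIV. ?g i (f i))"
      by (subst sum.reindex) (auto simp: inj_on_def vec_nth_inject)
    also have "\<dots> \<le> (\<Sum>f\<in>PiE UNIV (\<lambda>_. J). \<Prod>i\<in>UNIV. ?g i (f i))"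
      by (rule sum_mono2) (auto simp: J_def intro!: finite_PiE prod_nonneg J[unfolded J_def])
    also have "\<dots> = (\<Prod>i\<in>UNIV. \<Sum>j\<in>J. ?g i j)"
      by (rule prod_sum_PiE[symmetric]) (auto simp: J)
    also have "\<dots> \<le> (\<Prod>i\<in>(UNIV::'n set). C)"
      by (rule prod_mono) (auto intro!: sum_nonneg C(2) J)
    finally show ?thesis by simp
  qed
  then show thesis using that[of "C ^ CARD('n)"] C(1) by simp
qed

lemma integrable_continuous_bounded_support:
  fixes F :: "'a::euclidean_space \<Rightarrow> real"
  assumes "continuous_on UNIV F" "\<And>y. norm y > R \<Longrightarrow> F y = 0"
  shows "integrable lborel F"
proof -
  have "integrable lborel (\<lambda>x. indicator (cball 0 R) x *\<^sub>R F x)"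
    by (rule borel_integrable_compact) (auto intro: continuous_on_subset[OF assms(1)])
  moreover have "(\<lambda>x. indicator (cball 0 R) x *\<^sub>R F x) = F"
    using assms(2) by (force simp: fun_eq_iff indicator_def not_le)
  ultimately show ?thesis by simp
qed

lemma lborel_integrable_translate:
  fixes f :: "'a::euclidean_space \<Rightarrow> real"
  assumes "integrable lborel f"
  shows "integrable lborel (\<lambda>x. f (c + x))"
  using assms integrable_distr[of "(+) c" lborel borel f] lborel_distr_plus[of c] by simp

lemma lborel_integral_translate:
  fixes f :: "'a::euclidean_space \<Rightarrow> real"
  assumes "f \<in> borel_measurable borel"
  shows "(\<integral>x. f x \<partial>lborel) = (\<integral>x. f (c + x) \<partial>lborel)"
  using integral_distr[of "(+) c" lborel borel f] lborel_distr_plus[of c] assms by simp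

definition unit_cell :: "(real ^ 'n::finite) set" where
  "unit_cell = {x. \<forall>i. 0 \<le> x $ i \<and> x $ i < 1}"

lemma unit_cell_measurable [measurable]: "unit_cell \<in> sets borel"
  unfolding unit_cell_def by measurable

lemma measure_unit_cell: "unit_cell \<in> fmeasurable (lborel :: (real ^ 'n::finite) measure)" "measure lborel (unit_cell :: (real ^ 'n::finite) set) = 1"
proof -
  have sub: "box 0 1 \<subseteq> (unit_cell :: (real ^ 'n) set)" "unit_cell \<subseteq> (cbox 0 1 :: (real ^ 'n) set)"
    by (auto simp: unit_cell_def mem_box_cart less_imp_le)
  show fm: "unit_cell \<in> fmeasurable (lborel :: (real ^ 'n) measure)"
    by (rule fmeasurableI2[OF _ sub(2)]) auto
  have b: "b \<bullet> (1::real^'n) = 1" if "b \<in> Basis" for b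
    using that by (auto simp: Basis_vec_def inner_axis')
  have "measure lborel (box 0 (1 :: real ^ 'n)) = 1" "measure lborel (cbox 0 (1 :: real ^ 'n)) = 1"
    by (auto simp: measure_lborel_box_eq measure_lborel_cbox_eq b inner_commute)
  then show "measure lborel (unit_cell :: (real ^ 'n::finite) set) = 1"
    using measure_mono_fmeasurable[OF sub(1) _ fm] measure_mono_fmeasurable[OF sub(2) _ fmeasurable_cbox]
    by (auto simp: unit_cell_measurable)
qed

lemma lattice_cells:
  fixes x :: "real ^ 'n::finite"
  shows "x - lattice_point k \<in> unit_cell \<longleftrightarrow> k = (\<chi> i. \<lfloor>x $ i\<rfloor>)"
proof
  assume "x - lattice_point k \<in> unit_cell"
  then show "k = (\<chi> i. \<lfloor>x $ i\<rfloor>)"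
    by (simp add: unit_cell_def vec_eq_iff) (metis diff_less_eq floor_unique add.commute)
next
  assume "k = (\<chi> i. \<lfloor>x $ i\<rfloor>)"
  then show "x - lattice_point k \<in> unit_cell"
    by (simp add: unit_cell_def) linarith
qed

lemma norm_unit_cell: "s \<in> unit_cell \<Longrightarrow> norm (s :: real ^ 'n::finite) \<le> real CARD('n)"
proof -
  assume "s \<in> unit_cell"
  then have "(\<Sum>i\<in>UNIV. \<bar>s $ i\<bar>) \<le> (\<Sum>i\<in>(UNIV::'n set). 1)"
    by (intro sum_mono) (simp add: unit_cell_def less_imp_le)
  then show ?thesis using norm_le_l1_cart[of s] by simp
qed

text \<open>
  The finite index set on the right works for all shifts of norm at most \<open>S\<close> at once, which permits
  differentiating the lattice sum term by term.
\<close>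
lemma infsum_lattice_eq_sum:
  fixes G :: "real ^ 'n::finite \<Rightarrow> real"
  assumes "\<And>y. norm y > R \<Longrightarrow> G y = 0" "norm s \<le> S"
  shows "(\<Sum>\<^sub>\<infinity>k. G (lattice_point k + s)) = (\<Sum>k | norm (lattice_point k) \<le> R + S. G (lattice_point k + s))"
proof -
  have z: "G (lattice_point k + s) = 0" if "\<not> norm (lattice_point k) \<le> R + S" for k
  proof (rule assms(1))
    have "norm (lattice_point k) \<le> norm (lattice_point k + s) + norm s"
      by (metis add_diff_cancel norm_triangle_ineq4)
    then show "norm (lattice_point k + s) > R" using that assms(2) by linarith
  qed
  have "(\<Sum>\<^sub>\<infinity>k. G (lattice_point k + s)) = (\<Sum>\<^sub>\<infinity>k | norm (lattice_point k) \<le> R + S. G (lattice_point k + s))"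
    by (rule infsum_cong_neutral) (use z in auto)
  then show ?thesis by (simp add: finite_lattice_points_bounded)
qed

lemma lattice_sum_periodic:
  "(\<Sum>\<^sub>\<infinity>k. G (lattice_point k + (s + axis i 1))) = (\<Sum>\<^sub>\<infinity>k. G (lattice_point k + s :: real ^ 'n::finite))"
proof -
  have bij: "bij (\<lambda>k :: int ^ 'n. k + axis i 1)"
    by (rule bij_plus_right)
  have "lattice_point (k + axis i 1) = lattice_point k + axis i 1" for k :: "int ^ 'n"
    by (simp add: vec_eq_iff axis_def)
  then show ?thesis
    using infsum_reindex_bij_betw[OF bij, of "\<lambda>k. G (lattice_point k + s)"]
    by (simp add: add_ac)
qed

text \<open>
  The translates of the half-open unit cell by lattice points tile the space.
\<close>
lemma integral_eq_integral_lattice_sum: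
  fixes F :: "real ^ 'n::finite \<Rightarrow> real"
  assumes cont: "continuous_on UNIV F" and supp: "\<And>y. norm y > R \<Longrightarrow> F y = 0"
  shows "integrable lborel (\<lambda>s. indicator unit_cell s * (\<Sum>\<^sub>\<infinity>k. F (lattice_point k + s)))"
    and "(\<integral>y. F y \<partial>lborel) = (\<integral>s. indicator unit_cell s * (\<Sum>\<^sub>\<infinity>k. F (lattice_point k + s)) \<partial>lborel)"
proof -
  define K :: "(int ^ 'n) set" where "K = {k. norm (lattice_point k) \<le> R + real CARD('n)}"
  have K: "finite K" unfolding K_def by (rule finite_lattice_points_bounded)
  have iF: "integrable lborel F"
    using cont supp by (rule integrable_continuous_bounded_support)
  have [measurable]: "F \<in> borel_measurable borel"
    using cont by (rule borel_measurable_continuous_onI)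
  have eq: "indicator unit_cell s * (\<Sum>\<^sub>\<infinity>k. F (lattice_point k + s))
      = (\<Sum>k\<in>K. indicator unit_cell s * F (lattice_point k + s))" for s
    using infsum_lattice_eq_sum[of R F, OF supp norm_unit_cell[of s]]
    by (auto simp: indicator_def K_def sum_distrib_left)
  have i1: "integrable lborel (\<lambda>s. indicator unit_cell s * F (lattice_point k + s))" for k
    using integrable_mult_indicator[OF _ lborel_integrable_translate[OF iF], of unit_cell "lattice_point k"]
    by simp
  show "integrable lborel (\<lambda>s. indicator unit_cell s * (\<Sum>\<^sub>\<infinity>k. F (lattice_point k + s)))"
    unfolding eq by (intro Bochner_Integration.integrable_sum i1)
  have split: "F x = (\<Sum>k\<in>K. indicator unit_cell (x - lattice_point k) * F x)" for x
  proof (cases "F x = 0")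
    case False
    define k0 where "k0 = (\<chi> i. \<lfloor>x $ i\<rfloor>)"
    have "norm x \<le> R" using False supp[of x] by force
    moreover have "x - lattice_point k0 \<in> unit_cell"
      unfolding lattice_cells k0_def ..
    then have "norm (x - lattice_point k0) \<le> real CARD('n)"
      by (rule norm_unit_cell)
    ultimately have "k0 \<in> K"
      unfolding K_def using norm_triangle_ineq4[of x "x - lattice_point k0"] by simp
    have "(\<Sum>k\<in>K. indicator unit_cell (x - lattice_point k) * F x) = (\<Sum>k\<in>K. if k = k0 then F x else 0)"
      by (intro sum.cong) (auto simp: indicator_def lattice_cells k0_def)
    then show ?thesis using \<open>k0 \<in> K\<close> K by simp
  qed simp
  have i2: "integrable lborel (\<lambda>x. indicator unit_cell (x - lattice_point k) * F x)" for k
  proof -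
    have "integrable lborel (\<lambda>x. indicator {x. x - lattice_point k \<in> unit_cell} x *\<^sub>R F x)"
      by (intro integrable_mult_indicator iF) measurable
    then show ?thesis by (simp add: indicator_def of_bool_def)
  qed
  have "(\<integral>y. F y \<partial>lborel) = (\<integral>y. (\<Sum>k\<in>K. indicator unit_cell (y - lattice_point k) * F y) \<partial>lborel)"
    using split by simp
  also have "\<dots> = (\<Sum>k\<in>K. \<integral>y. indicator unit_cell (y - lattice_point k) * F y \<partial>lborel)"
    by (rule Bochner_Integration.integral_sum) (rule i2)
  also have "\<dots> = (\<Sum>k\<in>K. \<integral>s. indicator unit_cell s * F (lattice_point k + s) \<partial>lborel)"
  proof (intro sum.cong refl)
    fix k
    show "(\<integral>y. indicator unit_cell (y - lattice_point k) * F y \<partial>lborel)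
        = (\<integral>s. indicator unit_cell s * F (lattice_point k + s) \<partial>lborel)"
      using lborel_integral_translate[of "\<lambda>y. indicator unit_cell (y - lattice_point k) * F y" "lattice_point k"]
      by simp
  qed
  also have "\<dots> = (\<integral>s. (\<Sum>k\<in>K. indicator unit_cell s * F (lattice_point k + s)) \<partial>lborel)"
    by (rule Bochner_Integration.integral_sum[symmetric]) (rule i1)
  finally show "(\<integral>y. F y \<partial>lborel) = (\<integral>s. indicator unit_cell s * (\<Sum>\<^sub>\<infinity>k. F (lattice_point k + s)) \<partial>lborel)"
    unfolding eq .
qed

text \<open>
  Both the integral and the lattice sum are read off from the periodic function \<open>P s\<close>, the sum of all
  \<open>F (k + s)\<close>: the integral of \<open>F\<close> is the mean of \<open>P\<close> over the unit cell and the lattice sum is \<open>P 0\<close>. Any point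
  of the cell is reached from \<open>0\<close> along coordinate axes in \<open>CARD('n)\<close> steps, and \<open>periodic_derivative_bound\<close>
  controls the change of \<open>P\<close> in each of them by the \<open>N\<close>-th pure derivatives of \<open>F\<close>.
\<close>
lemma lattice_quadrature_bound:
  obtains C :: real where "0 \<le> C"
    "\<And>(F :: real ^ 'n::finite \<Rightarrow> real) R N b B.
      \<lbrakk>continuous_on UNIV F; \<And>y. norm y > R \<Longrightarrow> F y = 0; 0 < N; 0 \<le> B;
       \<And>i. symbol_bound i N UNIV b F;
       \<And>y. b y / (1 + norm y) ^ N \<le> B * (\<Prod>i\<in>UNIV. inverse ((1 + \<bar>y $ i\<bar>)\<^sup>2))\<rbrakk> \<Longrightarrow>
      \<bar>(\<integral>y. F y \<partial>lborel) - (\<Sum>\<^sub>\<infinity>k. F (lattice_point k))\<bar> \<le> C * B"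
proof -
  obtain C :: real where C: "0 \<le> C"
    "\<And>K s. finite K \<Longrightarrow>
      (\<Sum>k\<in>K. \<Prod>i\<in>UNIV. inverse ((1 + \<bar>(lattice_point k + s :: real ^ 'n::finite) $ i\<bar>)\<^sup>2)) \<le> C"
    by (rule sum_prod_inverse_square_lattice) blast
  have main: "\<bar>(\<integral>y. F y \<partial>lborel) - (\<Sum>\<^sub>\<infinity>k. F (lattice_point k))\<bar> \<le> (real CARD('n) * C) * B"
    if cont: "continuous_on UNIV F" and supp: "\<And>y. norm y > R \<Longrightarrow> F y = 0" and N: "0 < N"
      and B: "0 \<le> B" and symb: "\<And>i. symbol_bound i N UNIV b F"
      and bB: "\<And>y. b y / (1 + norm y) ^ N \<le> B * (\<Prod>i\<in>UNIV. inverse ((1 + \<bar>y $ i\<bar>)\<^sup>2))"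
    for F :: "real ^ 'n \<Rightarrow> real" and R N b B
  proof -
    define P where "P s = (\<Sum>\<^sub>\<infinity>k. F (lattice_point k + s))" for s
    have step: "\<bar>P (s + t *\<^sub>R axis i 1) - P s\<bar> \<le> C * B" if s: "norm s \<le> real CARD('n)" and t: "t \<in> {0..1}" for s t i
    proof -
      define D where "D j = (partial_deriv i ^^ j) F" for j
      have D0: "D j y = 0" if "norm y > R" for j y
        unfolding D_def
      proof (rule partial_deriv_iter_vanish)
        show "open {y::real^'n. norm y > R}" by (intro open_Collect_less continuous_intros)
      qed (use that supp in auto)
      define K :: "(int ^ 'n) set" where "K = {k. norm (lattice_point k) \<le> R + (real CARD('n) + 1)}"
      have K: "finite K" unfolding K_def by (rule finite_lattice_points_bounded)
      define p where "p j t = (\<Sum>k\<in>K. D j ((lattice_point k + s) + t *\<^sub>R axis i 1))" for j t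
      have pP: "p j t = (\<Sum>\<^sub>\<infinity>k. D j (lattice_point k + (s + t *\<^sub>R axis i 1)))" if "t \<in> {0..1}" for j t
      proof -
        have "norm (s + t *\<^sub>R axis i 1) \<le> real CARD('n) + 1"
          using s that by (intro norm_triangle_le add_mono) (auto simp: norm_axis_1)
        from infsum_lattice_eq_sum[of R "D j", OF D0 this] show ?thesis
          by (simp add: p_def K_def add.assoc)
      qed
      have "\<bar>p 0 t - p 0 0\<bar> \<le> C * B"
      proof (rule periodic_derivative_bound[OF N _ _ _ t])
        show "(p j has_real_derivative p (Suc j) t) (at t)" if "j < N" for j t
          unfolding p_def
          using symbol_bound_derivs(2)[OF symb that, of _ i]
          by (auto intro!: DERIV_sum has_partial_along_line simp: D_def simp del: funpow.simps)
        show "p j 1 = p j 0" if "j < N" for j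
          using pP[of 1 j] pP[of 0 j] lattice_sum_periodic[of "D j" s i] by simp
        show "\<bar>p N t\<bar> \<le> C * B" if "t \<in> {0..1}" for t
        proof -
          have bD: "\<bar>D N y\<bar> \<le> B * (\<Prod>l\<in>UNIV. inverse ((1 + \<bar>y $ l\<bar>)\<^sup>2))" for y
            unfolding D_def by (rule order_trans[OF symbol_bound_derivs(1)[OF symb order_refl UNIV_I] bB])
          have "\<bar>p N t\<bar> \<le> (\<Sum>k\<in>K. B * (\<Prod>l\<in>UNIV. inverse ((1 + \<bar>(lattice_point k + (s + t *\<^sub>R axis i 1)) $ l\<bar>)\<^sup>2)))"
            unfolding p_def add.assoc
            by (intro order_trans[OF sum_abs] sum_mono bD)
          also have "\<dots> \<le> B * C"
            unfolding sum_distrib_left[symmetric] by (intro mult_left_mono C(2) K B)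
          finally show ?thesis by (simp add: mult.commute)
        qed
      qed
      then show ?thesis using pP[OF t, of 0] pP[of 0 0] by (simp add: P_def D_def)
    qed
    have cell: "\<bar>P s - P 0\<bar> \<le> real CARD('n) * (C * B)" if s: "s \<in> unit_cell" for s
    proof -
      \<comment> \<open>Walk from the origin to \<open>s\<close>, switching on one coordinate at a time.\<close>
      define r where "r I = (\<chi> i. if i \<in> I then s $ i else 0)" for I
      have rI: "norm (r I) \<le> real CARD('n)" for I
        using s by (intro norm_unit_cell) (auto simp: r_def unit_cell_def)
      have "\<bar>P (r I) - P 0\<bar> \<le> real (card I) * (C * B)" if "finite I" for I
        using that
      proof (induction I)
        case empty
        have "r {} = 0" by (simp add: r_def vec_eq_iff)
        then show ?case by simp
      next
        case (insert i I)
        have "r (insert i I) = r I + (s $ i) *\<^sub>R axis i 1"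
          using insert.hyps by (auto simp: r_def vec_eq_iff axis_def)
        moreover have "s $ i \<in> {0..1}" using s by (auto simp: unit_cell_def less_imp_le)
        ultimately have "\<bar>P (r (insert i I)) - P (r I)\<bar> \<le> C * B"
          using step[OF rI] by simp
        then show ?case using insert by (simp add: algebra_simps)
      qed
      from this[of UNIV] show ?thesis by (simp add: r_def)
    qed
    have i0: "integrable lborel (\<lambda>s::real^'n. indicator unit_cell s * c)" for c :: real
      using measure_unit_cell(1) by (auto simp: fmeasurable_def intro!: integrable_real_indicator)
    have c0: "(\<integral>s. indicator unit_cell s * c \<partial>(lborel :: (real^'n) measure)) = c" for c :: real
      by (simp add: measure_unit_cell(2))
    note iP = integral_eq_integral_lattice_sum[OF cont supp, folded P_def]
    have "\<bar>(\<integral>y. F y \<partial>lborel) - P 0\<bar> = \<bar>\<integral>s. indicator unit_cell s * P s - indicator unit_cell s * P 0 \<partial>lborel\<bar>"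
      by (simp only: Bochner_Integration.integral_diff[OF iP(1) i0] iP(2) c0)
    also have "\<dots> \<le> (\<integral>s. \<bar>indicator unit_cell s * P s - indicator unit_cell s * P 0\<bar> \<partial>lborel)"
      by (rule integral_abs_bound)
    also have "\<dots> \<le> (\<integral>s. indicator unit_cell s * (real CARD('n) * (C * B)) \<partial>(lborel :: (real^'n) measure))"
      using cell by (intro integral_mono integrable_abs Bochner_Integration.integrable_diff iP(1) i0)
        (auto simp: indicator_def)
    finally show ?thesis unfolding c0 by (simp add: P_def)
  qed
  have "0 \<le> real CARD('n) * C" using C(1) by simp
  from that[OF this main] show thesis .
qed

section \<open>Cutoff functions\<close>

definition derivative_family :: "nat \<Rightarrow> real \<Rightarrow> (nat \<Rightarrow> real \<Rightarrow> real) \<Rightarrow> bool" where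
  "derivative_family N B G \<longleftrightarrow>
     (\<forall>j<N. \<forall>x. (G j has_real_derivative G (Suc j) x) (at x)) \<and>
     (\<forall>j\<le>N. \<forall>x. \<bar>G j x\<bar> \<le> B)"

definition bounded_derivs :: "nat \<Rightarrow> (real \<Rightarrow> real) \<Rightarrow> bool" where
  "bounded_derivs N f \<longleftrightarrow> (\<exists>G B. G 0 = f \<and> derivative_family N B G)"

lemma derivative_familyD:
  assumes "derivative_family N B G"
  shows "j < N \<Longrightarrow> (G j has_real_derivative G (Suc j) x) (at x)" "j \<le> N \<Longrightarrow> \<bar>G j x\<bar> \<le> B"
  using assms unfolding derivative_family_def by auto

lemma bounded_derivs_const: "bounded_derivs N (\<lambda>_. c)"
  unfolding bounded_derivs_def derivative_family_def
  by (intro exI[of _ "\<lambda>j x. if j = 0 then c else 0"] exI[of _ "\<bar>c\<bar>"]) auto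

lemma bounded_derivs_add:
  assumes "bounded_derivs N f" "bounded_derivs N g"
  shows "bounded_derivs N (\<lambda>x. f x + g x)"
proof -
  obtain G B where G0: "G 0 = f" and "derivative_family N B G"
    using assms(1) unfolding bounded_derivs_def by blast
  note G = G0 derivative_familyD[OF this(2)]
  obtain H C where H0: "H 0 = g" and "derivative_family N C H"
    using assms(2) unfolding bounded_derivs_def by blast
  note H = H0 derivative_familyD[OF this(2)]
  show ?thesis unfolding bounded_derivs_def derivative_family_def
    by (intro exI[of _ "\<lambda>j x. G j x + H j x"] exI[of _ "B + C"])
       (use G H in \<open>auto intro!: DERIV_add order_trans[OF abs_triangle_ineq] add_mono\<close>)
qed

lemma bounded_derivs_affine:
  assumes "bounded_derivs N f"
  shows "bounded_derivs N (\<lambda>x. c * f (a * x + b))"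
proof -
  obtain G B where G0: "G 0 = f" and "derivative_family N B G"
    using assms(1) unfolding bounded_derivs_def by blast
  note G = G0 derivative_familyD[OF this(2)]
  show ?thesis unfolding bounded_derivs_def derivative_family_def
  proof (intro exI[of _ "\<lambda>j x. c * (a ^ j * G j (a * x + b))"] exI[of _ "\<bar>c\<bar> * ((1 + \<bar>a\<bar>) ^ N * B)"] conjI allI impI)
    fix j x assume j: "j < N"
    have "((\<lambda>x. a * x + b) has_real_derivative a) (at x)"
      by (auto intro!: derivative_eq_intros)
    from DERIV_chain2[OF G(2)[OF j] this]
    have "((\<lambda>x. G j (a * x + b)) has_real_derivative G (Suc j) (a * x + b) * a) (at x)" .
    from DERIV_cmult[OF this, of "c * a ^ j"]
    show "((\<lambda>x. c * (a ^ j * G j (a * x + b))) has_real_derivative c * (a ^ Suc j * G (Suc j) (a * x + b))) (at x)"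
      by (simp add: mult_ac)
  next
    fix j x assume j: "j \<le> N"
    have "\<bar>a ^ j\<bar> \<le> (1 + \<bar>a\<bar>) ^ j"
      unfolding power_abs by (intro power_mono) auto
    also have "\<dots> \<le> (1 + \<bar>a\<bar>) ^ N"
      using j by (intro power_increasing) auto
    finally have "\<bar>a ^ j\<bar> * \<bar>G j (a * x + b)\<bar> \<le> (1 + \<bar>a\<bar>) ^ N * B"
      using G(3)[OF j] by (intro mult_mono) auto
    then show "\<bar>c * (a ^ j * G j (a * x + b))\<bar> \<le> \<bar>c\<bar> * ((1 + \<bar>a\<bar>) ^ N * B)"
      by (simp add: abs_mult mult_left_mono)
  qed (use G in auto)
qed

lemma bounded_derivs_Suc:
  assumes "bounded_derivs N g" "\<And>x. (f has_real_derivative g x) (at x)" "\<And>x. \<bar>f x\<bar> \<le> B"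
  shows "bounded_derivs (Suc N) f"
proof -
  obtain G C where G0: "G 0 = g" and "derivative_family N C G"
    using assms(1) unfolding bounded_derivs_def by blast
  note G = G0 derivative_familyD[OF this(2)]
  show ?thesis unfolding bounded_derivs_def derivative_family_def
    by (intro exI[of _ "case_nat f G"] exI[of _ "max B C"])
       (use G assms in \<open>auto split: nat.splits simp: le_max_iff_disj\<close>)
qed

text \<open>
  Vanishing on the negative half-line allows integrating from \<open>-1\<close>; to the left of that point the
  integral over an empty interval is already the right value.
\<close>
lemma ex_antiderivative:
  fixes f :: "real \<Rightarrow> real"
  assumes "continuous_on UNIV f" "\<And>x. x \<le> 0 \<Longrightarrow> f x = 0"
  obtains F where "\<And>x. (F has_real_derivative f x) (at x)"
proof
  fix x :: real
  let ?F = "\<lambda>x. integral {-1..x} f"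
  show "(?F has_real_derivative f x) (at x)"
  proof (cases "x < 0")
    case True
    have z: "?F y = 0" if "y < 0" for y
      using that assms(2) by (intro integral_unique has_integral_is_0) auto
    have "((\<lambda>_. 0::real) has_real_derivative 0) (at x)" by simp
    then have "(?F has_real_derivative 0) (at x)"
      by (rule has_field_derivative_transform_within_open[of _ _ _ "{..<0}"]) (use True z in auto)
    then show ?thesis using assms(2) True by simp
  next
    case False
    have "(?F has_real_derivative f x) (at x within {-1..x+1})"
      by (rule integral_has_real_derivative[of "-1" "x+1"])
         (use False assms in \<open>auto intro: continuous_on_subset\<close>)
    moreover have "at x within {-1..x+1} = at x"
      using False by (intro at_within_interior) auto
    ultimately show ?thesis by simp
  qed
qed

text \<open>
  Averaging \<open>f\<close> over intervals of length one gives \<open>F x - F (x - 1)\<close> with \<open>F' = f\<close>. This raises the order of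
  differentiability by one, keeps the values 0 and 1, and lengthens the transition by one.
\<close>
lemma ex_smooth_step:
  "\<exists>f. bounded_derivs m f \<and> continuous_on UNIV f \<and>
     (\<forall>x\<le>0. f x = 0) \<and> (\<forall>x\<ge>real m + 1. f x = 1)"
proof (induction m)
  case 0
  let ?f = "\<lambda>x::real. max 0 (min 1 x)"
  have "bounded_derivs 0 ?f"
    unfolding bounded_derivs_def derivative_family_def by (intro exI[of _ "\<lambda>_. ?f"] exI[of _ 1]) auto
  moreover have "continuous_on UNIV ?f" by (intro continuous_intros)
  ultimately show ?case by (intro exI[of _ ?f]) auto
next
  case (Suc m)
  then obtain f where f: "bounded_derivs m f" "continuous_on UNIV f"
    "\<And>x. x \<le> 0 \<Longrightarrow> f x = 0" "\<And>x. x \<ge> real m + 1 \<Longrightarrow> f x = 1" by blast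
  obtain F where F: "\<And>x. (F has_real_derivative f x) (at x)"
    using ex_antiderivative[OF f(2,3)] by blast
  obtain B where B: "\<And>x. \<bar>f x\<bar> \<le> B"
    using f(1) unfolding bounded_derivs_def derivative_family_def by blast
  define g where "g x = F x - F (x - 1)" for x
  have F1: "((\<lambda>x. F (x - 1)) has_real_derivative f (x - 1)) (at x)" for x
    using F[of "x - 1"] DERIV_shift[of F "f (x - 1)" x "-1"] by simp
  have g': "(g has_real_derivative f x - f (x - 1)) (at x)" for x
    unfolding g_def by (intro DERIV_diff F F1)
  have mv: "\<exists>z. x - 1 < z \<and> z < x \<and> g x = f z" for x
    using MVT2[of "x - 1" x F f] F by (auto simp: g_def)
  have "bounded_derivs m (\<lambda>x. f x - f (x - 1))"
    using bounded_derivs_add[OF f(1) bounded_derivs_affine[OF f(1), of "-1" 1 "-1"]] by simp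
  then have "bounded_derivs (Suc m) g"
    by (rule bounded_derivs_Suc[OF _ g', where B = B]) (metis mv B)
  moreover have "continuous_on UNIV g"
    using g' DERIV_isCont continuous_at_imp_continuous_on by blast
  moreover have "g x = 0" if "x \<le> 0" for x
    using mv[of x] f(3) that by (metis less_le_trans less_imp_le)
  moreover have "g x = 1" if "x \<ge> real (Suc m) + 1" for x
  proof -
    obtain z where "x - 1 < z" "g x = f z" using mv[of x] by blast
    then show ?thesis using f(4)[of z] that by simp
  qed
  ultimately show ?case by blast
qed

lemma ex_bump:
  "\<exists>\<psi>. bounded_derivs N \<psi> \<and> continuous_on UNIV \<psi> \<and>
     (\<forall>x. \<bar>x\<bar> \<le> 1 \<longrightarrow> \<psi> x = 1) \<and> (\<forall>x. \<bar>x\<bar> \<ge> 2 \<longrightarrow> \<psi> x = 0)"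
proof -
  obtain f where f: "bounded_derivs N f" "continuous_on UNIV f"
    "\<And>x. x \<le> 0 \<Longrightarrow> f x = 0" "\<And>x. x \<ge> real N + 1 \<Longrightarrow> f x = 1" using ex_smooth_step[of N] by blast
  define M where "M = real N + 1"
  have M: "0 < M" by (simp add: M_def)
  \<comment> \<open>A sum instead of a product avoids the product rule: one of the two steps always equals 1.\<close>
  define \<psi> where "\<psi> x = f (M * (2 - x)) + f (M * (2 + x)) - 1" for x
  have one: "f (M * t) = 1" if "t \<ge> 1" for t
    using f(4)[of "M * t"] mult_left_mono[OF that, of M] M by (simp add: M_def)
  have zero: "f (M * t) = 0" if "t \<le> 0" for t
    using f(3)[of "M * t"] M that by (simp add: mult_nonneg_nonpos)
  have "bounded_derivs N (\<lambda>x. (1 * f ((- M) * x + 2 * M) + 1 * f (M * x + 2 * M)) + (- 1))"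
    by (intro bounded_derivs_add bounded_derivs_const bounded_derivs_affine f)
  then have "bounded_derivs N \<psi>"
    unfolding \<psi>_def by (simp add: algebra_simps)
  moreover have "continuous_on UNIV \<psi>"
    unfolding \<psi>_def
    by (intro continuous_intros continuous_on_compose2[OF f(2)]) auto
  moreover have "\<psi> x = 1" if "\<bar>x\<bar> \<le> 1" for x
    unfolding \<psi>_def using that by (simp add: one)
  moreover have "\<psi> x = 0" if "\<bar>x\<bar> \<ge> 2" for x
    using that by (cases "x \<ge> 0") (auto simp: \<psi>_def one zero)
  ultimately show ?thesis by blast
qed

text \<open>
  The \<open>j\<close>-th derivative of \<open>f (h y)\<close> carries a factor \<open>h ^ j\<close>, and on the support of \<open>f (h y)\<close> one has
  \<open>h (1 + |y|) \<le> 1 + r\<close>. So dilations of a function of bounded support are bounded as symbols of order zero,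
  uniformly in \<open>h\<close>.
\<close>
lemma symbol_bound_dilation:
  fixes f :: "real ^ 'n::finite \<Rightarrow> real"
  assumes deriv: "\<And>j y. j < N \<Longrightarrow> has_partial i ((partial_deriv i ^^ j) f) ((partial_deriv i ^^ Suc j) f y) y"
    and bound: "\<And>j y. j \<le> N \<Longrightarrow> \<bar>(partial_deriv i ^^ j) f y\<bar> \<le> B"
    and supp: "\<And>y. norm y > r \<Longrightarrow> f y = 0" and r: "0 \<le> r" and h: "0 < h" "h \<le> 1"
  shows "symbol_bound i N UNIV (\<lambda>_. B * (1 + r) ^ N) (\<lambda>y. f (h *\<^sub>R y))"
proof -
  let ?G = "\<lambda>j y. h ^ j * (partial_deriv i ^^ j) f (h *\<^sub>R y)"
  have B: "0 \<le> B" using bound[of 0 0] by simp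
  have "symbol_bound i N UNIV (\<lambda>_. B * (1 + r) ^ N) (?G 0)"
  proof (rule symbol_bound_family)
    fix j and y :: "real ^ 'n" assume j: "j \<le> N"
    show "\<bar>?G j y\<bar> \<le> B * (1 + r) ^ N / (1 + norm y) ^ j"
    proof (cases "norm (h *\<^sub>R y) > r")
      case True
      have "(partial_deriv i ^^ j) f (h *\<^sub>R y) = 0"
        by (rule partial_deriv_iter_vanish[of "{y. norm y > r}"])
           (use True supp in \<open>auto intro!: open_Collect_less continuous_intros\<close>)
      then show ?thesis using B r by simp
    next
      case False
      then have "h * (1 + norm y) \<le> 1 + r" using h by (simp add: distrib_left)
      then have "(h * (1 + norm y)) ^ j \<le> (1 + r) ^ j"
        using h by (intro power_mono) auto
      also have "\<dots> \<le> (1 + r) ^ N" using j r by (intro power_increasing) auto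
      finally have "h ^ j \<le> (1 + r) ^ N / (1 + norm y) ^ j"
        using norm_ge_zero[of y] by (subst pos_le_divide_eq) (auto simp: power_mult_distrib add_nonneg_pos intro!: zero_less_power add_pos_nonneg)
      then have "h ^ j * \<bar>(partial_deriv i ^^ j) f (h *\<^sub>R y)\<bar> \<le> (1 + r) ^ N / (1 + norm y) ^ j * B"
        using bound[OF j] h r by (intro mult_mono) auto
      then show ?thesis using h by (simp add: abs_mult mult.commute)
    qed
  next
    fix j and y :: "real ^ 'n" assume j: "j < N"
    have "has_partial i (\<lambda>y. (partial_deriv i ^^ j) f (h *\<^sub>R y + 0)) (h * (partial_deriv i ^^ Suc j) f (h *\<^sub>R y + 0)) y"
      by (intro has_partial_affine deriv j)
    from has_partial_cmult[OF this, of "h ^ j"]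
    show "has_partial i (?G j) (?G (Suc j) y) y"
      by (simp add: mult_ac)
  qed simp
  then show ?thesis by simp
qed

text \<open>
  For a product of one-dimensional bump functions, pure derivatives fall on a single factor.
\<close>
lemma ex_cutoff:
  obtains \<phi> :: "real ^ 'n::finite \<Rightarrow> real" and C :: real
  where "continuous_on UNIV \<phi>" "\<And>x. norm x \<le> 1 \<Longrightarrow> \<phi> x = 1"
    "\<And>x. norm x > 2 * real CARD('n) \<Longrightarrow> \<phi> x = 0"
    "\<And>i h. 0 < h \<Longrightarrow> h \<le> 1 \<Longrightarrow> symbol_bound i N UNIV (\<lambda>_. C) (\<lambda>y. \<phi> (h *\<^sub>R y))"
proof -
  obtain \<psi> where \<psi>: "bounded_derivs N \<psi>" "continuous_on UNIV \<psi>"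
    "\<And>x. \<bar>x\<bar> \<le> 1 \<Longrightarrow> \<psi> x = 1" "\<And>x. \<bar>x\<bar> \<ge> 2 \<Longrightarrow> \<psi> x = 0"
    using ex_bump[of N] by blast
  obtain G B where G0: "G 0 = \<psi>" and "derivative_family N B G"
    using \<psi>(1) unfolding bounded_derivs_def by blast
  note G = G0 derivative_familyD[OF this(2)]
  define \<phi> where "\<phi> x = (\<Prod>i\<in>UNIV. \<psi> (x $ i))" for x :: "real ^ 'n"
  have cont: "continuous_on UNIV \<phi>"
    unfolding \<phi>_def by (intro continuous_intros continuous_on_compose2[OF \<psi>(2)]) auto
  have one: "\<phi> x = 1" if "norm x \<le> 1" for x
    unfolding \<phi>_def using that component_le_norm_cart[of x]
    by (intro prod.neutral ballI \<psi>(3)) (meson order_trans)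
  have supp: "\<phi> x = 0" if "norm x > 2 * real CARD('n)" for x
  proof (rule ccontr)
    assume "\<phi> x \<noteq> 0"
    then have "\<bar>x $ i\<bar> \<le> 2" for i
      unfolding \<phi>_def using \<psi>(4)[of "x $ i"] by (metis (no_types, lifting) UNIV_I finite linorder_le_cases prod_zero_iff)
    then have "(\<Sum>i\<in>UNIV. \<bar>x $ i\<bar>) \<le> (\<Sum>i\<in>(UNIV::'n set). 2)" by (intro sum_mono)
    then show False using norm_le_l1_cart[of x] that by simp
  qed
  have symb: "symbol_bound i N UNIV (\<lambda>_. B * B ^ (CARD('n) - 1) * (1 + 2 * real CARD('n)) ^ N) (\<lambda>y. \<phi> (h *\<^sub>R y))"
    if h: "0 < h" "h \<le> 1" for i h
  proof (rule symbol_bound_dilation[OF _ _ supp _ h])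
    define H where "H j x = G j (x $ i) * (\<Prod>k\<in>UNIV-{i}. \<psi> (x $ k))" for j and x :: "real ^ 'n"
    have H0: "H 0 = \<phi>"
      unfolding H_def \<phi>_def G(1) by (auto simp: prod.remove[of UNIV i])
    have dH: "has_partial i (H j) (H (Suc j) y) y" if "j < N" for j y
      unfolding has_partial_def
    proof -
      have "((\<lambda>t. G j (t + y $ i)) has_real_derivative G (Suc j) (y $ i)) (at 0)"
        using G(2)[OF that, of "y $ i"] DERIV_shift[of "G j" "G (Suc j) (y $ i)" 0 "y $ i"] by simp
      from DERIV_cmult[OF this, of "\<Prod>k\<in>UNIV-{i}. \<psi> (y $ k)"]
      have "((\<lambda>t. G j (t + y $ i) * (\<Prod>k\<in>UNIV-{i}. \<psi> (y $ k))) has_real_derivative H (Suc j) y) (at 0)"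
        by (simp add: H_def mult.commute)
      moreover have "H j (y + t *\<^sub>R axis i 1) = G j (t + y $ i) * (\<Prod>k\<in>UNIV-{i}. \<psi> (y $ k))" for t
      proof -
        have "(\<Prod>k\<in>UNIV-{i}. \<psi> ((y + t *\<^sub>R axis i 1) $ k)) = (\<Prod>k\<in>UNIV-{i}. \<psi> (y $ k))"
          by (intro prod.cong) (auto simp: axis_def)
        then show ?thesis by (simp add: H_def add.commute)
      qed
      ultimately show "((\<lambda>t. H j (y + t *\<^sub>R axis i 1)) has_real_derivative H (Suc j) y) (at 0)"
        by simp
    qed
    have it: "(partial_deriv i ^^ j) \<phi> = H j" if "j \<le> N" for j
      using partial_deriv_iter_family[of N i H j, OF dH that] H0 by simp
    show "has_partial i ((partial_deriv i ^^ j) \<phi>) ((partial_deriv i ^^ Suc j) \<phi> y) y" if "j < N" for j y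
      using it[of j] it[of "Suc j"] dH[OF that] that by (simp del: funpow.simps)
    show "\<bar>(partial_deriv i ^^ j) \<phi> y\<bar> \<le> B * B ^ (CARD('n) - 1)" if "j \<le> N" for j y
    proof -
      have B: "0 \<le> B" using G(3)[of 0 0] by simp
      have "(\<Prod>k\<in>UNIV-{i}. \<bar>\<psi> (y $ k)\<bar>) \<le> (\<Prod>k\<in>UNIV-{i}. B)"
        using G(3)[of 0] G(1) by (intro prod_mono) auto
      then have "\<bar>H j y\<bar> \<le> B * B ^ (CARD('n) - 1)"
        unfolding H_def abs_mult abs_prod using G(3)[OF that] B
        by (intro mult_mono) (auto simp: card_Diff_singleton intro: prod_nonneg)
      then show ?thesis using it[OF that] by simp
    qed
  qed auto
  show thesis using that[OF cont one supp symb] .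
qed

section \<open>Local integrability of powers of the norm\<close>

lemma powr_mono_comparable:
  fixes x w a :: real
  assumes "0 < w" "w / 2 \<le> x" "x \<le> 2 * w"
  shows "x powr a \<le> 2 powr \<bar>a\<bar> * w powr a"
proof (cases "a \<ge> 0")
  case True
  then have "x powr a \<le> (2 * w) powr a" using assms by (intro powr_mono2) auto
  then show ?thesis using assms True by (simp add: powr_mult)
next
  case False
  then have "x powr a \<le> (w / 2) powr a" using assms by (intro powr_mono2') auto
  then show ?thesis using assms False by (simp add: powr_divide powr_minus_divide)
qed

text \<open>
  On the shell between the radii \<open>\<rho> (Suc j)\<close> and \<open>\<rho> j\<close>, where \<open>\<rho> j = r / 2 ^ j\<close>, the function is comparable to
  \<open>\<rho> j powr \<gamma>\<close>, and the volume of the ball is of order \<open>\<rho> j ^ DIM('a)\<close>. The condition on \<open>\<gamma>\<close> makes the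
  resulting geometric series converge.
\<close>
lemma integrable_norm_powr:
  assumes "\<gamma> > - real DIM('a)"
  shows "integrable lborel (\<lambda>x::'a::euclidean_space. indicator (cball 0 r) x * norm x powr \<gamma>)"
proof (cases "r > 0")
  case False
  have z: "indicator (cball 0 r) x * norm x powr \<gamma> = 0" for x :: 'a
    using False by (cases "x = 0") (auto simp: indicator_def, meson norm_le_zero_iff order_trans not_less)
  show ?thesis unfolding z by simp
next
  case True
  let ?n = "real DIM('a)"
  define \<rho> where "\<rho> j = r / 2 ^ j" for j :: nat
  have \<rho>: "0 < \<rho> j" for j using True by (simp add: \<rho>_def)
  define c where "c j = 2 powr \<bar>\<gamma>\<bar> * \<rho> j powr \<gamma>" for j
  have c: "0 \<le> c j" for j by (simp add: c_def)
  have pw: "indicator (cball 0 r) x * norm x powr \<gamma> \<le> (\<Sum>j. ennreal (c j) * indicator (cball 0 (\<rho> j)) x)" for x :: 'a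
  proof (cases "x \<noteq> 0 \<and> norm x \<le> r")
    case False
    then show ?thesis by (auto simp: indicator_def)
  next
    case x: True
    have "\<exists>j. \<rho> j < norm x"
    proof -
      obtain j where "(1 / 2) ^ j < norm x / r"
        using real_arch_pow_inv[of "norm x / r" "1 / 2"] True x by auto
      then show ?thesis using True by (auto simp: \<rho>_def power_divide field_simps intro!: exI[of _ j])
    qed
    then obtain j where j: "\<rho> j < norm x" "\<And>i. i < j \<Longrightarrow> norm x \<le> \<rho> i"
      using LeastI_ex[of "\<lambda>j. \<rho> j < norm x"] not_less_Least[of _ "\<lambda>j. \<rho> j < norm x"] not_less by metis
    have "j \<noteq> 0" using j(1) x by (cases j) (auto simp: \<rho>_def)
    then obtain i where i: "j = Suc i" by (cases j) auto
    have n: "norm x \<le> \<rho> i" "\<rho> i / 2 < norm x" using j i by (auto simp: \<rho>_def)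
    have "norm x powr \<gamma> \<le> c i"
      unfolding c_def by (rule powr_mono_comparable) (use \<rho>[of i] n in auto)
    then have "ennreal (indicator (cball 0 r) x * norm x powr \<gamma>) \<le> ennreal (c i) * indicator (cball 0 (\<rho> i)) x"
      using n x by (auto simp: indicator_def intro: ennreal_leI)
    also have "\<dots> \<le> (\<Sum>j. ennreal (c j) * indicator (cball 0 (\<rho> j)) x)"
    proof -
      have "f i \<le> suminf f" for f :: "nat \<Rightarrow> ennreal"
        using sum_le_suminf[of f "{i}"] by simp
      then show ?thesis .
    qed
    finally show ?thesis .
  qed
  define d where "d j = c j * (unit_ball_vol ?n * \<rho> j ^ DIM('a))" for j
  have sd: "summable d"
  proof -
    have eq: "d j = (2 powr \<bar>\<gamma>\<bar> * r powr (\<gamma> + ?n) * unit_ball_vol ?n) * (2 powr (- (\<gamma> + ?n))) ^ j" for j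
    proof -
      have "\<rho> j powr \<gamma> * \<rho> j ^ DIM('a) = \<rho> j powr (\<gamma> + ?n)"
        using \<rho>[of j] by (simp add: powr_add powr_realpow)
      also have "\<dots> = r powr (\<gamma> + ?n) * (2 powr (- (\<gamma> + ?n))) ^ j"
      proof -
        have "\<rho> j = r * 2 powr (- real j)"
          by (simp add: \<rho>_def powr_minus powr_realpow divide_inverse)
        then show ?thesis using True
          by (simp add: powr_mult powr_powr powr_realpow[symmetric] algebra_simps)
      qed
      finally show ?thesis by (simp add: d_def c_def mult_ac)
    qed
    show ?thesis unfolding eq using assms
      by (intro summable_mult summable_geometric) (simp add: powr_less_one)
  qed
  have d: "0 \<le> d j" for j using c \<rho>[of j] by (simp add: d_def)
  have "(\<integral>\<^sup>+x. ennreal (indicator (cball 0 r) (x::'a) * norm x powr \<gamma>) \<partial>lborel)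
      \<le> (\<integral>\<^sup>+x. (\<Sum>j. ennreal (c j) * indicator (cball 0 (\<rho> j)) (x::'a)) \<partial>lborel)"
    using pw by (intro nn_integral_mono) auto
  also have "\<dots> = (\<Sum>j. \<integral>\<^sup>+x. ennreal (c j) * indicator (cball 0 (\<rho> j)) (x::'a) \<partial>lborel)"
  proof (rule nn_integral_suminf)
    fix j
    have [measurable]: "cball (0::'a) (\<rho> j) \<in> sets borel" by simp
    show "(\<lambda>x. ennreal (c j) * indicator (cball (0::'a) (\<rho> j)) x) \<in> borel_measurable lborel"
      by measurable
  qed
  also have "\<dots> = (\<Sum>j. ennreal (d j))"
  proof (intro suminf_cong)
    fix j
    have "(\<integral>\<^sup>+x. ennreal (c j) * indicator (cball 0 (\<rho> j)) (x::'a) \<partial>lborel) = ennreal (c j) * emeasure lborel (cball (0::'a) (\<rho> j))"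
      by (rule nn_integral_cmult_indicator) auto
    also have "\<dots> = ennreal (d j)"
      using \<rho>[of j] c[of j] by (subst emeasure_cball) (auto simp: d_def ennreal_mult')
    finally show "(\<integral>\<^sup>+x. ennreal (c j) * indicator (cball 0 (\<rho> j)) (x::'a) \<partial>lborel) = ennreal (d j)" .
  qed
  also have "\<dots> = ennreal (suminf d)" by (rule suminf_ennreal2[OF d sd])
  also have "\<dots> < \<infinity>" by simp
  finally have "(\<integral>\<^sup>+x. ennreal (indicator (cball 0 r) (x::'a) * norm x powr \<gamma>) \<partial>lborel) < \<infinity>" .
  moreover have [measurable]: "cball (0::'a) r \<in> sets borel" by simp
  have "(\<lambda>x::'a. indicator (cball 0 r) x * norm x powr \<gamma>) \<in> borel_measurable lborel"
    by measurable
  ultimately show ?thesis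
    by (intro integrableI_bounded) (auto simp: abs_mult)
qed

section \<open>The lattice defect\<close>

text \<open>
  The punctured quadrature error for mesh size one.
\<close>
definition lattice_defect :: "(real ^ 'n::finite \<Rightarrow> real) \<Rightarrow> real" where
  "lattice_defect g = (\<integral>y. g y \<partial>lborel) - (\<Sum>\<^sub>\<infinity>k\<in>UNIV - {0}. g (lattice_point k))"

text \<open>
  On these functions the lattice defect is additive: the integral exists and the sum is finite.
\<close>
definition admissible :: "(real ^ 'n::finite \<Rightarrow> real) \<Rightarrow> bool" where
  "admissible g \<longleftrightarrow> integrable lborel g \<and> (\<exists>R. \<forall>y. norm y > R \<longrightarrow> g y = 0)"

lemma punctured_lattice_sum_eq:
  fixes g :: "real ^ 'n::finite \<Rightarrow> real"
  assumes "\<And>y. norm y > R \<Longrightarrow> g y = 0"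
  shows "(\<Sum>\<^sub>\<infinity>k\<in>UNIV - {0}. g (lattice_point k)) = (\<Sum>k\<in>{k. norm (lattice_point k) \<le> R} - {0}. g (lattice_point k))"
proof -
  have "(\<Sum>\<^sub>\<infinity>k\<in>UNIV - {0}. g (lattice_point k)) = (\<Sum>\<^sub>\<infinity>k\<in>{k. norm (lattice_point k) \<le> R} - {0}. g (lattice_point k))"
    by (rule infsum_cong_neutral) (use assms in force)+
  then show ?thesis by (simp add: finite_lattice_points_bounded)
qed

lemma lattice_defect_add:
  fixes f g :: "real ^ 'n::finite \<Rightarrow> real"
  assumes "admissible f" "admissible g"
  shows "admissible (\<lambda>y. f y + g y)" "lattice_defect (\<lambda>y. f y + g y) = lattice_defect f + lattice_defect g"
proof -
  obtain R S where R: "\<And>y. norm y > R \<Longrightarrow> f y = 0" "\<And>y. norm y > S \<Longrightarrow> g y = 0"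
    and i: "integrable lborel f" "integrable lborel g"
    using assms unfolding admissible_def by blast
  define T where "T = max R S"
  have T: "\<And>y. norm y > T \<Longrightarrow> f y = 0" "\<And>y. norm y > T \<Longrightarrow> g y = 0"
    using R by (auto simp: T_def)
  show "admissible (\<lambda>y. f y + g y)"
    unfolding admissible_def using i T by (auto intro!: exI[of _ T])
  show "lattice_defect (\<lambda>y. f y + g y) = lattice_defect f + lattice_defect g"
    unfolding lattice_defect_def
    using i T by (simp add: punctured_lattice_sum_eq[of T f] punctured_lattice_sum_eq[of T g]
      punctured_lattice_sum_eq[of T "\<lambda>y. f y + g y"] sum.distrib)
qed

lemma admissible_cmult: "admissible f \<Longrightarrow> admissible (\<lambda>y. c * f y)"
  unfolding admissible_def by auto

lemma lattice_defect_scale: "lattice_defect (\<lambda>y. c * f y) = c * lattice_defect f"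
  unfolding lattice_defect_def by (simp add: infsum_cmult_right' right_diff_distrib)

lemma lattice_defect_sum:
  fixes g :: "'a \<Rightarrow> real ^ 'n::finite \<Rightarrow> real"
  assumes "finite A" "\<And>a. a \<in> A \<Longrightarrow> admissible (g a)"
  shows "admissible (\<lambda>y. \<Sum>a\<in>A. c a * g a y) \<and>
    lattice_defect (\<lambda>y. \<Sum>a\<in>A. c a * g a y) = (\<Sum>a\<in>A. c a * lattice_defect (g a))"
  using assms
proof (induction A)
  case empty
  show ?case by (simp add: admissible_def lattice_defect_def)
next
  case (insert a A)
  then have "admissible (\<lambda>y. c a * g a y)" by (simp add: admissible_cmult)
  then show ?case using insert lattice_defect_add[of "\<lambda>y. c a * g a y" "\<lambda>y. \<Sum>a\<in>A. c a * g a y"]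
    by (simp add: lattice_defect_scale)
qed

lemma lattice_defect_diff:
  fixes f g :: "real ^ 'n::finite \<Rightarrow> real"
  assumes "admissible f" "admissible g"
  shows "lattice_defect (\<lambda>y. f y - g y) = lattice_defect f - lattice_defect g"
  using lattice_defect_add(2)[OF assms(1) admissible_cmult[OF assms(2), of "-1"]]
    lattice_defect_scale[of "-1" g] by simp

text \<open>
  Decay of order \<open>2 CARD('n)\<close> in the norm dominates the product weight in \<open>lattice_quadrature_bound\<close>.
\<close>
lemma inverse_norm_le_prod:
  "(1 + norm y) powr (- 2 * real CARD('n)) \<le> (\<Prod>i\<in>UNIV. inverse ((1 + \<bar>y $ i\<bar>)\<^sup>2))"
  for y :: "real ^ 'n::finite"
proof -
  have p: "0 < 1 + norm y" using norm_ge_zero[of y] by linarith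
  have "(1 + norm y) powr (- 2 * real CARD('n)) = (\<Prod>i\<in>(UNIV :: 'n set). inverse ((1 + norm y)\<^sup>2))"
  proof -
    have "(1 + norm y) powr (- 2 * real CARD('n)) = inverse ((1 + norm y) powr real (2 * CARD('n)))"
      by (simp flip: powr_minus)
    also have "\<dots> = inverse ((1 + norm y) ^ (2 * CARD('n)))"
      using p by (subst powr_realpow) auto
    finally show ?thesis by (simp add: power_mult power_inverse)
  qed
  also have "\<dots> \<le> (\<Prod>i\<in>UNIV. inverse ((1 + \<bar>y $ i\<bar>)\<^sup>2))"
  proof (intro prod_mono conjI)
    fix i
    have "(1 + \<bar>y $ i\<bar>)\<^sup>2 \<le> (1 + norm y)\<^sup>2"
      using component_le_norm_cart[of y i] by (intro power_mono) auto
    then show "inverse ((1 + norm y)\<^sup>2) \<le> inverse ((1 + \<bar>y $ i\<bar>)\<^sup>2)"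
      by (intro le_imp_inverse_le) (auto intro: add_pos_nonneg)
  qed auto
  finally show ?thesis .
qed

section \<open>Homogeneous functions\<close>

text \<open>
  A derivative at \<open>t x\<close> yields one at \<open>x\<close> by the chain rule. Hence differentiability near the origin spreads to the
  whole punctured space, and the derivative is homogeneous of degree one less.
\<close>
lemma homogeneous_partial_deriv:
  fixes g :: "real ^ 'n::finite \<Rightarrow> real"
  assumes hom: "\<And>t x. 0 < t \<Longrightarrow> x \<noteq> 0 \<Longrightarrow> g (t *\<^sub>R x) = t powr a * g x"
    and diff: "\<And>x. x \<in> ball 0 r - {0} \<Longrightarrow> has_partial i g (partial_deriv i g x) x" and r: "0 < r"
  shows "x \<noteq> 0 \<Longrightarrow> has_partial i g (partial_deriv i g x) x"
    and "0 < t \<Longrightarrow> x \<noteq> 0 \<Longrightarrow> partial_deriv i g (t *\<^sub>R x) = t powr (a - 1) * partial_deriv i g x"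
proof -
  have core: "has_partial i g (t powr (1 - a) * d) x" if "x \<noteq> 0" "0 < t" "has_partial i g d (t *\<^sub>R x)" for x t d
  proof -
    have "has_partial i (\<lambda>x. g (t *\<^sub>R x + 0)) (t * d) x"
      by (rule has_partial_affine) (use that in simp)
    from has_partial_cmult[OF this, of "t powr (- a)"]
    have "has_partial i (\<lambda>x. t powr (- a) * g (t *\<^sub>R x)) (t powr (1 - a) * d) x"
      using that by (simp add: powr_diff powr_minus field_simps)
    then show ?thesis
      using that hom
      by (subst has_partial_cong[of "- {0}" _ _ "\<lambda>x. t powr (- a) * g (t *\<^sub>R x)"]) (auto simp: powr_minus)
  qed
  have all: "has_partial i g (partial_deriv i g x) x" if "x \<noteq> 0" for x
  proof -
    define t where "t = r / (2 * norm x)"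
    have t: "0 < t" "t *\<^sub>R x \<in> ball 0 r - {0}" using that r by (auto simp: t_def)
    show ?thesis
      using core[OF that t(1) diff[OF t(2)]] partial_deriv_eqI by metis
  qed
  show "x \<noteq> 0 \<Longrightarrow> has_partial i g (partial_deriv i g x) x" by (rule all)
  assume x: "x \<noteq> 0" and t: "0 < t"
  then have "partial_deriv i g x = t powr (1 - a) * partial_deriv i g (t *\<^sub>R x)"
    by (intro partial_deriv_eqI core all) auto
  then show "partial_deriv i g (t *\<^sub>R x) = t powr (a - 1) * partial_deriv i g x"
    using t by (simp add: powr_diff field_simps)
qed

text \<open>
  By homogeneity, smoothness on one punctured ball spreads to the whole punctured space. The condition on
  the degree is local integrability.
\<close>
locale homogeneous_function =
  fixes s :: "real ^ 'n::finite \<Rightarrow> real" and \<gamma> r :: real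
  assumes r: "0 < r" and smooth: "smooth_on (ball 0 r - {0}) s"
    and hom: "0 < t \<Longrightarrow> s (t *\<^sub>R x) = t powr \<gamma> * s x"
    and degree: "\<gamma> > - real CARD('n)"
begin

lemma Ck_s: "Ck_on k (ball 0 r - {0}) s" and open_punctured_ball: "open (ball 0 r - {0} :: (real ^ 'n) set)"
  using smooth unfolding smooth_on_def by auto

lemma partial_deriv_s:
  "(\<forall>x. x \<noteq> 0 \<longrightarrow> has_partial i ((partial_deriv i ^^ j) s) ((partial_deriv i ^^ Suc j) s x) x) \<and>
   (\<forall>t x. 0 < t \<longrightarrow> x \<noteq> 0 \<longrightarrow> (partial_deriv i ^^ j) s (t *\<^sub>R x) = t powr (\<gamma> - real j) * (partial_deriv i ^^ j) s x)"
proof -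
  have hp: "has_partial i ((partial_deriv i ^^ j) s) (partial_deriv i ((partial_deriv i ^^ j) s) x) x"
    if "x \<in> ball 0 r - {0}" for j x
    by (rule has_partial_of_differentiable,
        rule Ck_on_differentiable[OF open_punctured_ball Ck_on_partial_deriv_iter[OF Ck_s[of "j + Suc 0"]] that])
  show ?thesis
  proof (induction j)
    case 0
    have hp0: "\<And>x. x \<in> ball 0 r - {0} \<Longrightarrow> has_partial i s (partial_deriv i s x) x"
      using hp[where j = 0] by simp
    show ?case using homogeneous_partial_deriv(1)[where g = s and a = \<gamma>, OF hom hp0 r] hom by auto
  next
    case (Suc j)
    have h: "\<And>t x. 0 < t \<Longrightarrow> x \<noteq> 0 \<Longrightarrow>
        (partial_deriv i ^^ Suc j) s (t *\<^sub>R x) = t powr (\<gamma> - real (Suc j)) * (partial_deriv i ^^ Suc j) s x"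
      using homogeneous_partial_deriv(2)[where g = "(partial_deriv i ^^ j) s" and a = "\<gamma> - real j", OF _ hp r] Suc
      by (simp add: algebra_simps)
    show ?case
      using h homogeneous_partial_deriv(1)[where g = "(partial_deriv i ^^ Suc j) s" and a = "\<gamma> - real (Suc j)", OF h hp r]
      by simp
  qed
qed

text \<open>
  By homogeneity it suffices to bound the derivatives on a sphere inside the ball of smoothness, where
  compactness applies.
\<close>
lemma partial_deriv_s_bound:
  obtains C where "0 \<le> C"
    "\<And>i j x. j \<le> N \<Longrightarrow> x \<noteq> 0 \<Longrightarrow> \<bar>(partial_deriv i ^^ j) s x\<bar> \<le> C * norm x powr (\<gamma> - real j)"
proof -
  have "\<exists>B. \<forall>x\<in>sphere 0 (r / 2). \<bar>(partial_deriv i ^^ j) s x\<bar> \<le> B" for i j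
  proof -
    have "Ck_on 0 (ball 0 r - {0}) ((partial_deriv i ^^ j) s)"
      by (rule Ck_on_partial_deriv_iter[OF Ck_s])
    then have "continuous_on (sphere 0 (r / 2)) ((partial_deriv i ^^ j) s)"
      using r by (auto elim!: continuous_on_subset)
    then have "compact ((partial_deriv i ^^ j) s ` sphere 0 (r / 2))"
      using compact_continuous_image compact_sphere by blast
    from compact_imp_bounded[OF this] show ?thesis
      unfolding bounded_iff by auto
  qed
  note ex = this
  define B where "B i j = (SOME B. \<forall>x\<in>sphere 0 (r / 2). \<bar>(partial_deriv i ^^ j) s x\<bar> \<le> B)" for i j
  have B: "\<bar>(partial_deriv i ^^ j) s x\<bar> \<le> B i j" if "x \<in> sphere 0 (r / 2)" for i j x
  proof -
    have "\<forall>x\<in>sphere 0 (r / 2). \<bar>(partial_deriv i ^^ j) s x\<bar> \<le> B i j"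
      unfolding B_def by (rule someI_ex) (rule ex)
    then show ?thesis using that by (rule bspec)
  qed
  define c where "c i j = \<bar>B i j\<bar> * (r / 2) powr (- (\<gamma> - real j))" for i j
  define C where "C = (\<Sum>i\<in>UNIV. \<Sum>j\<le>N. c i j)"
  have c0: "0 \<le> c i j" for i j by (simp add: c_def)
  have cC: "c i j \<le> C" if "j \<le> N" for i j
  proof -
    have "c i j \<le> (\<Sum>j\<le>N. c i j)"
      using that c0 by (intro member_le_sum) auto
    also have "\<dots> \<le> C" unfolding C_def
      using c0 by (intro member_le_sum) (auto intro: sum_nonneg)
    finally show ?thesis .
  qed
  have "\<bar>(partial_deriv i ^^ j) s x\<bar> \<le> C * norm x powr (\<gamma> - real j)" if j: "j \<le> N" and x: "x \<noteq> 0" for i j x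
  proof -
    define t where "t = norm x / (r / 2)"
    define y where "y = ((r / 2) / norm x) *\<^sub>R x"
    have t: "0 < t" and y: "y \<in> sphere 0 (r / 2)" "y \<noteq> 0" "x = t *\<^sub>R y"
      using r x by (auto simp: t_def y_def)
    have "(partial_deriv i ^^ j) s x = t powr (\<gamma> - real j) * (partial_deriv i ^^ j) s y"
      using partial_deriv_s[of i j] t y by auto
    then have "\<bar>(partial_deriv i ^^ j) s x\<bar> = t powr (\<gamma> - real j) * \<bar>(partial_deriv i ^^ j) s y\<bar>"
      by (simp add: abs_mult)
    also have "\<dots> \<le> t powr (\<gamma> - real j) * \<bar>B i j\<bar>"
      using B[OF y(1), where i = i and j = j] by (intro mult_left_mono) auto
    also have "\<dots> = c i j * norm x powr (\<gamma> - real j)"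
    proof -
      have "(norm x / q) powr a = q powr (- a) * norm x powr a" if "0 < q" for q a :: real
        using that by (simp add: powr_divide powr_minus_divide)
      from this[of "r / 2" "\<gamma> - real j"] show ?thesis
        using r unfolding t_def c_def by (simp only: mult_ac half_gt_zero)
    qed
    also have "\<dots> \<le> C * norm x powr (\<gamma> - real j)"
      using cC[OF j] by (intro mult_right_mono) auto
    finally show ?thesis .
  qed
  moreover have "0 \<le> C" unfolding C_def by (intro sum_nonneg c0)
  ultimately show thesis using that by blast
qed

lemma continuous_on_s: "continuous_on (- {0}) s"
proof -
  have "isCont s x" if "x \<noteq> 0" for x
  proof -
    define t where "t = r / (2 * norm x)"
    have t: "0 < t" "t *\<^sub>R x \<in> ball 0 r - {0}" using that r by (auto simp: t_def)
    have "isCont s (t *\<^sub>R x)"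
      by (rule differentiable_imp_continuous_within)
         (rule Ck_on_differentiable[OF open_punctured_ball Ck_s[of "Suc 0"] t(2)])
    then have "isCont (\<lambda>x. s (t *\<^sub>R x)) x"
      using isCont_o2[of x "\<lambda>x. t *\<^sub>R x" s] by simp
    then have "isCont (\<lambda>x. t powr (- \<gamma>) * s (t *\<^sub>R x)) x"
      by (rule isCont_mult[OF continuous_const])
    moreover have "(\<lambda>x. t powr (- \<gamma>) * s (t *\<^sub>R x)) = s"
      using t by (auto simp: hom powr_minus fun_eq_iff)
    ultimately show ?thesis by simp
  qed
  then show ?thesis by (auto intro: continuous_at_imp_continuous_on)
qed

lemma s_measurable [measurable]: "s \<in> borel_measurable borel"
proof -
  have "(\<lambda>x. indicator (- {0}) x *\<^sub>R s x + indicator {0} x * s 0) \<in> borel_measurable borel"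
    by (intro borel_measurable_add borel_measurable_continuous_on_indicator continuous_on_s) auto
  moreover have "(\<lambda>x. indicator (- {0}) x *\<^sub>R s x + indicator {0} x * s 0) = s"
    by (auto simp: fun_eq_iff indicator_def)
  ultimately show ?thesis by simp
qed

lemma integrable_s_mult:
  assumes [measurable]: "u \<in> borel_measurable borel" and M: "\<And>y. norm y \<le> R \<Longrightarrow> \<bar>u y\<bar> \<le> M"
    and supp: "\<And>y. norm y > R \<Longrightarrow> u y = 0"
  shows "integrable lborel (\<lambda>y. s (y - \<alpha>) * u y)"
proof -
  obtain C where C: "0 \<le> C" "\<And>i j x. j \<le> 0 \<Longrightarrow> x \<noteq> 0 \<Longrightarrow> \<bar>(partial_deriv i ^^ j) s x\<bar> \<le> C * norm x powr (\<gamma> - real j)"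
    using partial_deriv_s_bound[of 0] by blast
  let ?g = "\<lambda>x::real^'n. indicator (cball 0 (R + norm \<alpha>)) x * norm x powr \<gamma>"
  have "integrable lborel ?g"
    using degree by (intro integrable_norm_powr) simp
  from integrable_mult_right[OF lborel_integrable_translate[OF this, of "- \<alpha>"], of "C * M"]
  have "integrable lborel (\<lambda>y. C * M * ?g (- \<alpha> + y))" by simp
  then show ?thesis
  proof (rule Bochner_Integration.integrable_bound)
    show "AE y in lborel. norm (s (y - \<alpha>) * u y) \<le> norm (C * M * ?g (- \<alpha> + y))"
    proof (rule AE_mp[OF AE_lborel_singleton[of \<alpha>]], intro AE_I2 impI)
      fix y assume y: "y \<noteq> \<alpha>"
      show "norm (s (y - \<alpha>) * u y) \<le> norm (C * M * ?g (- \<alpha> + y))"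
      proof (cases "norm y \<le> R")
        case True
        have "\<bar>s (y - \<alpha>)\<bar> \<le> C * norm (y - \<alpha>) powr \<gamma>"
          using C(2)[of 0 "y - \<alpha>"] y by simp
        then have "\<bar>s (y - \<alpha>)\<bar> * \<bar>u y\<bar> \<le> (C * norm (y - \<alpha>) powr \<gamma>) * M"
          using M[OF True] C(1) by (intro mult_mono) auto
        moreover have "indicator (cball 0 (R + norm \<alpha>)) (y - \<alpha>) = (1::real)"
          using True norm_triangle_ineq4[of y \<alpha>] by (simp add: indicator_def)
        moreover have "0 \<le> M" using M[OF True] by linarith
        ultimately show ?thesis using C(1) by (simp add: abs_mult mult_ac)
      qed (simp add: supp)
    qed
  qed measurable
qed

text \<open>
  At distance more than \<open>2 |\<alpha>| + 1\<close> from the origin, \<open>|y - \<alpha>|\<close> and \<open>1 + |y|\<close> differ by a factor of at most two.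
\<close>
lemma symbol_bound_s_translate:
  obtains C where "0 \<le> C"
    "\<And>i. symbol_bound i N {y. norm y > 2 * norm \<alpha> + 1} (\<lambda>y. C * (1 + norm y) powr \<gamma>) (\<lambda>y. s (y - \<alpha>))"
proof -
  obtain C where C: "0 \<le> C" "\<And>i j x. j \<le> N \<Longrightarrow> x \<noteq> 0 \<Longrightarrow> \<bar>(partial_deriv i ^^ j) s x\<bar> \<le> C * norm x powr (\<gamma> - real j)"
    using partial_deriv_s_bound[of N] by blast
  let ?K = "C * 2 powr (\<bar>\<gamma>\<bar> + real N)"
  have "symbol_bound i N {y. norm y > 2 * norm \<alpha> + 1} (\<lambda>y. ?K * (1 + norm y) powr \<gamma>) (\<lambda>y. s (y - \<alpha>))" for i
  proof -
    let ?G = "\<lambda>j y. (partial_deriv i ^^ j) s (y - \<alpha>)"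
    have "symbol_bound i N {y. norm y > 2 * norm \<alpha> + 1} (\<lambda>y. ?K * (1 + norm y) powr \<gamma>) (?G 0)"
    proof (rule symbol_bound_family)
      show "open {y. 2 * norm \<alpha> + 1 < norm (y :: real^'n)}"
        by (intro open_Collect_less continuous_intros)
    next
      fix j and y :: "real ^ 'n" assume j: "j \<le> N" and "y \<in> {y. norm y > 2 * norm \<alpha> + 1}"
      then have y: "norm y > 2 * norm \<alpha> + 1" by simp
      then have ne: "y - \<alpha> \<noteq> 0" by auto (use norm_ge_zero[of \<alpha>] in linarith)
      have "norm (y - \<alpha>) \<ge> norm y - norm \<alpha>" "norm (y - \<alpha>) \<le> norm y + norm \<alpha>"
        by (simp_all add: norm_triangle_ineq2 norm_triangle_ineq4)
      then have "norm (y - \<alpha>) powr (\<gamma> - real j) \<le> 2 powr \<bar>\<gamma> - real j\<bar> * (1 + norm y) powr (\<gamma> - real j)"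
      proof (intro powr_mono_comparable)
        assume "norm y - norm \<alpha> \<le> norm (y - \<alpha>)" "norm (y - \<alpha>) \<le> norm y + norm \<alpha>"
        then show "(1 + norm y) / 2 \<le> norm (y - \<alpha>)" "norm (y - \<alpha>) \<le> 2 * (1 + norm y)"
          using y norm_ge_zero[of \<alpha>] by (simp_all add: field_simps)
        show "0 < 1 + norm y" using norm_ge_zero[of y] by linarith
      qed
      also have "\<dots> \<le> 2 powr (\<bar>\<gamma>\<bar> + real N) * (1 + norm y) powr (\<gamma> - real j)"
        using j by (intro mult_right_mono powr_mono) auto
      finally have "C * norm (y - \<alpha>) powr (\<gamma> - real j) \<le> C * (2 powr (\<bar>\<gamma>\<bar> + real N) * (1 + norm y) powr (\<gamma> - real j))"
        using C(1) by (intro mult_left_mono)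
      moreover have "(1 + norm y) powr (\<gamma> - real j) = (1 + norm y) powr \<gamma> / (1 + norm y) ^ j"
        using norm_ge_zero[of y] by (simp add: powr_diff powr_realpow add_pos_nonneg)
      ultimately show "\<bar>?G j y\<bar> \<le> ?K * (1 + norm y) powr \<gamma> / (1 + norm y) ^ j"
        using C(2)[OF j ne, of i] by (simp add: mult_ac)
    next
      fix j and y :: "real ^ 'n" assume "y \<in> {y. norm y > 2 * norm \<alpha> + 1}"
      then have ne: "y - \<alpha> \<noteq> 0" by auto (use norm_ge_zero[of \<alpha>] in linarith)
      have "has_partial i (\<lambda>y. (partial_deriv i ^^ j) s (1 *\<^sub>R y + (- \<alpha>))) (1 * (partial_deriv i ^^ Suc j) s (1 *\<^sub>R y + (- \<alpha>))) y"
        by (rule has_partial_affine) (use partial_deriv_s[of i j] ne in auto)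
      then show "has_partial i (?G j) (?G (Suc j) y) y" by simp
    qed
    then show ?thesis by simp
  qed
  then show thesis using that[of ?K] C(1) by simp
qed

text \<open>
  The number \<open>N\<close> of derivatives is chosen so large that \<open>\<gamma> + q - N \<le> - 2 CARD('n)\<close>. A cutoff \<open>\<eta>\<close> splits the
  integrand into a part \<open>g1\<close> supported in a fixed ball around the singularity, where a bound for \<open>|u|\<close> and
  local integrability of \<open>s\<close> suffice, and a smooth part \<open>F\<close> vanishing near the singularity. As \<open>F 0 = 0\<close>, the
  puncture is invisible to \<open>F\<close>, and \<open>lattice_quadrature_bound\<close> applies.
\<close>
lemma lattice_defect_bound:
  obtains N K where "0 \<le> K"
    "\<And>u A R. \<lbrakk>continuous_on UNIV u; \<And>y. norm y > R \<Longrightarrow> u y = 0; 0 \<le> A;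
       \<And>i. symbol_bound i N UNIV (\<lambda>y. A * (1 + norm y) ^ q) u\<rbrakk> \<Longrightarrow>
     \<bar>lattice_defect (\<lambda>y. s (y - \<alpha>) * u y)\<bar> \<le> K * A"
proof -
  \<comment> \<open>Enough decay for \<open>lattice_quadrature_bound\<close>; the last summand makes \<open>0 < N\<close> immediate.\<close>
  define N where "N = nat \<lceil>\<gamma> + real q + 2 * real CARD('n)\<rceil> + 1"
  have N: "0 < N" "\<gamma> + real q - real N \<le> - 2 * real CARD('n)" unfolding N_def by linarith+
  obtain \<phi> :: "real ^ 'n \<Rightarrow> real" and C where \<phi>: "continuous_on UNIV \<phi>" "\<And>x. norm x \<le> 1 \<Longrightarrow> \<phi> x = 1"
    "\<And>x. norm x > 2 * real CARD('n) \<Longrightarrow> \<phi> x = 0"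
    "\<And>i h. 0 < h \<Longrightarrow> h \<le> 1 \<Longrightarrow> symbol_bound i N UNIV (\<lambda>_. C) (\<lambda>y. \<phi> (h *\<^sub>R y))"
    using ex_cutoff[of N] by blast
  define R0 where "R0 = 2 * norm \<alpha> + 2"
  have R0: "2 \<le> R0" by (simp add: R0_def)
  define \<eta> where "\<eta> y = \<phi> ((1 / R0) *\<^sub>R y)" for y
  have \<eta>s: "symbol_bound i N UNIV (\<lambda>_. C) \<eta>" for i
    unfolding \<eta>_def by (rule \<phi>(4)) (use R0 in auto)
  have \<eta>c: "continuous_on UNIV \<eta>"
    unfolding \<eta>_def by (intro continuous_on_compose2[OF \<phi>(1)] continuous_intros) auto
  have \<eta>1: "\<eta> y = 1" if "norm y \<le> R0" for y
    unfolding \<eta>_def using R0 that by (intro \<phi>(2)) (simp add: field_simps)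
  define R1 where "R1 = 2 * real CARD('n) * R0"
  have R1: "0 \<le> R1" using R0 by (simp add: R1_def)
  have \<eta>0: "\<eta> y = 0" if "norm y > R1" for y
    unfolding \<eta>_def using R0 that by (intro \<phi>(3)) (simp add: field_simps R1_def)
  have C: "\<bar>\<eta> y\<bar> \<le> C" for y using symbol_bound_abs_le[OF \<eta>s] by simp
  then have C0: "0 \<le> C" using abs_ge_zero order_trans by blast
  obtain C1 where C1: "0 \<le> C1"
    "\<And>i. symbol_bound i N {y. norm y > 2 * norm \<alpha> + 1} (\<lambda>y. C1 * (1 + norm y) powr \<gamma>) (\<lambda>y. s (y - \<alpha>))"
    by (rule symbol_bound_s_translate) blast
  obtain C2 :: real where C2: "0 \<le> C2"
    "\<And>(F :: real ^ 'n \<Rightarrow> real) R N b B.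
      \<lbrakk>continuous_on UNIV F; \<And>y. norm y > R \<Longrightarrow> F y = 0; 0 < N; 0 \<le> B;
       \<And>i. symbol_bound i N UNIV b F;
       \<And>y. b y / (1 + norm y) ^ N \<le> B * (\<Prod>i\<in>UNIV. inverse ((1 + \<bar>y $ i\<bar>)\<^sup>2))\<rbrakk> \<Longrightarrow>
      \<bar>(\<integral>y. F y \<partial>lborel) - (\<Sum>\<^sub>\<infinity>k. F (lattice_point k))\<bar> \<le> C2 * B"
    by (rule lattice_quadrature_bound) blast
  define Kn where "Kn = (\<integral>y. \<bar>s (y - \<alpha>) * indicator (cball 0 R1) y\<bar> \<partial>lborel) +
    (\<Sum>k\<in>{k. norm (lattice_point k) \<le> R1} - {0}. \<bar>s (lattice_point k - \<alpha>)\<bar>)"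
  define Kf where "Kf = 2 ^ N * (C1 * (2 ^ N * (1 + C)))"
  define K where "K = C * (1 + R1) ^ q * Kn + C2 * Kf"
  have Kn: "0 \<le> Kn" unfolding Kn_def by (intro add_nonneg_nonneg integral_nonneg_AE sum_nonneg) auto
  have Kf: "0 \<le> Kf" unfolding Kf_def using C1(1) C0 by simp
  have K: "0 \<le> K" unfolding K_def using Kn Kf C2(1) C0 R1 by simp
  have main: "\<bar>lattice_defect (\<lambda>y. s (y - \<alpha>) * u y)\<bar> \<le> K * A"
    if uc: "continuous_on UNIV u" and ur: "\<And>y. norm y > R \<Longrightarrow> u y = 0" and A: "0 \<le> A"
      and us: "\<And>i. symbol_bound i N UNIV (\<lambda>y. A * (1 + norm y) ^ q) u" for u A R
  proof -
    have um [measurable]: "u \<in> borel_measurable borel" "\<eta> \<in> borel_measurable borel"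
      using uc \<eta>c by (auto intro: borel_measurable_continuous_onI)
    have ub: "\<bar>u y\<bar> \<le> A * (1 + norm y) ^ q" for y
      using symbol_bound_abs_le[OF us] by simp
    define g1 where "g1 y = s (y - \<alpha>) * (\<eta> y * u y)" for y
    define F where "F y = s (y - \<alpha>) * ((1 - \<eta> y) * u y)" for y
    have split: "s (y - \<alpha>) * u y = g1 y + F y" for y
      by (simp add: g1_def F_def algebra_simps)
    have e1: "\<bar>\<eta> y * u y\<bar> \<le> C * (1 + R1) ^ q * A" if "norm y \<le> R1" for y
    proof -
      have "\<bar>u y\<bar> \<le> A * (1 + R1) ^ q"
        using order_trans[OF ub mult_left_mono[OF power_mono A]] that by auto
      then have "\<bar>\<eta> y\<bar> * \<bar>u y\<bar> \<le> C * (A * (1 + R1) ^ q)"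
        using C C0 by (intro mult_mono) auto
      then show ?thesis by (simp add: abs_mult mult_ac)
    qed
    have i1: "integrable lborel g1"
      unfolding g1_def by (rule integrable_s_mult[where R = R1, OF _ e1]) (auto simp: \<eta>0)
    have a1: "admissible g1"
      unfolding admissible_def using i1 by (auto intro!: exI[of _ R1] simp: g1_def \<eta>0)
    \<comment> \<open>The part near the singularity.\<close>
    have "\<bar>lattice_defect g1\<bar> \<le> C * (1 + R1) ^ q * A * Kn"
    proof -
      have g1b: "\<bar>g1 y\<bar> \<le> C * (1 + R1) ^ q * A * \<bar>s (y - \<alpha>) * indicator (cball 0 R1) y\<bar>" for y
      proof (cases "norm y \<le> R1")
        case True
        have "\<bar>s (y - \<alpha>)\<bar> * \<bar>\<eta> y * u y\<bar> \<le> \<bar>s (y - \<alpha>)\<bar> * (C * (1 + R1) ^ q * A)"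
          by (intro mult_left_mono e1 True) auto
        then show ?thesis using True by (simp add: g1_def abs_mult mult_ac)
      qed (simp add: g1_def \<eta>0)
      have i2: "integrable lborel (\<lambda>y. s (y - \<alpha>) * indicator (cball 0 R1) y)"
        by (rule integrable_s_mult[where R = R1 and M = 1]) (auto simp: indicator_def)
      have "\<bar>\<integral>y. g1 y \<partial>lborel\<bar> \<le> (\<integral>y. \<bar>g1 y\<bar> \<partial>lborel)" by (rule integral_abs_bound)
      also have "\<dots> \<le> (\<integral>y. C * (1 + R1) ^ q * A * \<bar>s (y - \<alpha>) * indicator (cball 0 R1) y\<bar> \<partial>lborel)"
        by (intro integral_mono integrable_abs i1 integrable_mult_right i2 g1b)
      finally have 1: "\<bar>\<integral>y. g1 y \<partial>lborel\<bar> \<le> C * (1 + R1) ^ q * A * (\<integral>y. \<bar>s (y - \<alpha>) * indicator (cball 0 R1) y\<bar> \<partial>lborel)"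
        by simp
      have "(\<Sum>\<^sub>\<infinity>k\<in>UNIV - {0}. g1 (lattice_point k)) = (\<Sum>k\<in>{k. norm (lattice_point k) \<le> R1} - {0}. g1 (lattice_point k))"
        by (rule punctured_lattice_sum_eq) (simp add: g1_def \<eta>0)
      moreover have "\<bar>\<dots>\<bar> \<le> (\<Sum>k\<in>{k. norm (lattice_point k) \<le> R1} - {0}. C * (1 + R1) ^ q * A * \<bar>s (lattice_point k - \<alpha>)\<bar>)"
      proof (intro order_trans[OF sum_abs] sum_mono)
        fix k :: "int ^ 'n" assume "k \<in> {k. norm (lattice_point k) \<le> R1} - {0}"
        then show "\<bar>g1 (lattice_point k)\<bar> \<le> C * (1 + R1) ^ q * A * \<bar>s (lattice_point k - \<alpha>)\<bar>"
          using g1b[of "lattice_point k"] by (simp add: abs_mult)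
      qed
      ultimately have "\<bar>\<Sum>\<^sub>\<infinity>k\<in>UNIV - {0}. g1 (lattice_point k)\<bar> \<le> C * (1 + R1) ^ q * A *
          (\<Sum>k\<in>{k. norm (lattice_point k) \<le> R1} - {0}. \<bar>s (lattice_point k - \<alpha>)\<bar>)"
        by (simp add: sum_distrib_left)
      then show ?thesis using 1 unfolding lattice_defect_def Kn_def distrib_left by linarith
    qed
    moreover
    \<comment> \<open>The smooth part: \<open>F\<close> is zero for \<open>norm y < R0\<close>, and \<open>y = \<alpha>\<close> lies in that ball.\<close>
    have Fc: "continuous_on UNIV F"
    proof -
      have "continuous_on ({y::real^'n. norm y > 2 * norm \<alpha> + 1} \<union> {y. norm y < R0}) F"
      proof (rule continuous_on_open_Un)
        show "open {y::real^'n. norm y > 2 * norm \<alpha> + 1}" "open {y::real^'n. norm y < R0}"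
          by (intro open_Collect_less continuous_intros)+
        show "continuous_on {y. norm y > 2 * norm \<alpha> + 1} F"
          unfolding F_def
        proof (intro continuous_intros continuous_on_compose2[OF continuous_on_s]
            continuous_on_subset[OF uc] continuous_on_subset[OF \<eta>c])
          show "(\<lambda>y. y - \<alpha>) ` {y. norm y > 2 * norm \<alpha> + 1} \<subseteq> - {0}"
            by auto (use norm_ge_zero[of \<alpha>] in linarith)
        qed auto
        show "continuous_on {y. norm y < R0} F"
          by (rule continuous_on_eq[of _ "\<lambda>_. 0"]) (auto simp: F_def \<eta>1)
      qed
      moreover have "{y::real^'n. norm y > 2 * norm \<alpha> + 1} \<union> {y. norm y < R0} = UNIV"
        by (auto simp: R0_def)
      ultimately show ?thesis by simp
    qed
    have F0: "F y = 0" if "norm y > R" for y using ur[OF that] by (simp add: F_def)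
    have a2: "admissible F"
      unfolding admissible_def using integrable_continuous_bounded_support[OF Fc F0] F0 by blast
    have Fs: "symbol_bound i N UNIV (\<lambda>y. Kf * A * ((1 + norm y) powr \<gamma> * (1 + norm y) ^ q)) F" for i
    proof -
      let ?U = "{y::real^'n. norm y > 2 * norm \<alpha> + 1}" and ?V = "{y::real^'n. norm y < R0}"
      have o: "open ?U" "open ?V" by (intro open_Collect_less continuous_intros)+
      have "symbol_bound i N ?U (\<lambda>y. 2 ^ N * ((C1 * (1 + norm y) powr \<gamma>) * (2 ^ N * ((1 + C) * (A * (1 + norm y) ^ q))))) F"
        unfolding F_def
      proof (intro symbol_bound_mult o C1(2))
        show "symbol_bound i N ?U (\<lambda>y. 1 + C) (\<lambda>y. 1 - \<eta> y)"
          using symbol_bound_diff[OF o(1) symbol_bound_const[OF o(1), of i N 1] symbol_bound_mono[OF \<eta>s]] by simp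
        show "symbol_bound i N ?U (\<lambda>y. A * (1 + norm y) ^ q) u"
          by (rule symbol_bound_mono[OF us]) auto
      qed
      then have "symbol_bound i N ?U (\<lambda>y. Kf * A * ((1 + norm y) powr \<gamma> * (1 + norm y) ^ q)) F"
        by (rule symbol_bound_mono) (auto simp: Kf_def mult_ac)
      moreover have "symbol_bound i N ?V (\<lambda>y. Kf * A * ((1 + norm y) powr \<gamma> * (1 + norm y) ^ q)) F"
        using symbol_bound_0[OF o(2), of "\<lambda>y. Kf * A * ((1 + norm y) powr \<gamma> * (1 + norm y) ^ q)" i N] Kf A
        by (subst symbol_bound_cong[OF o(2), of _ "\<lambda>_. 0"]) (auto simp: F_def \<eta>1)
      ultimately have "symbol_bound i N (?U \<union> ?V) (\<lambda>y. Kf * A * ((1 + norm y) powr \<gamma> * (1 + norm y) ^ q)) F"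
        by (rule symbol_bound_Un)
      moreover have "?U \<union> ?V = UNIV" by (auto simp: R0_def)
      ultimately show ?thesis by simp
    qed
    have "\<bar>lattice_defect F\<bar> \<le> C2 * (Kf * A)"
    proof -
      have "(\<Sum>\<^sub>\<infinity>k\<in>UNIV - {0}. F (lattice_point k)) = (\<Sum>\<^sub>\<infinity>k. F (lattice_point k))"
      proof (rule infsum_cong_neutral)
        fix k :: "int ^ 'n" assume "k \<in> UNIV - (UNIV - {0})"
        then have "lattice_point k = 0" by (simp add: vec_eq_iff)
        then show "F (lattice_point k) = 0" using R0 by (simp add: F_def \<eta>1)
      qed auto
      moreover have "\<bar>(\<integral>y. F y \<partial>lborel) - (\<Sum>\<^sub>\<infinity>k. F (lattice_point k))\<bar> \<le> C2 * (Kf * A)"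
      proof (rule C2(2)[OF Fc F0 N(1) _ Fs])
        show "0 \<le> Kf * A" using Kf A by simp
        fix y :: "real ^ 'n"
        have p: "0 < 1 + norm y" using norm_ge_zero[of y] by linarith
        have "(1 + norm y) powr \<gamma> * (1 + norm y) ^ q / (1 + norm y) ^ N = (1 + norm y) powr (\<gamma> + real q - real N)"
          using p by (simp add: powr_add powr_diff powr_realpow)
        also have "\<dots> \<le> (1 + norm y) powr (- 2 * real CARD('n))"
          using N(2) by (intro powr_mono) auto
        also have "\<dots> \<le> (\<Prod>i\<in>UNIV. inverse ((1 + \<bar>y $ i\<bar>)\<^sup>2))" by (rule inverse_norm_le_prod)
        finally show "Kf * A * ((1 + norm y) powr \<gamma> * (1 + norm y) ^ q) / (1 + norm y) ^ N \<le> Kf * A * (\<Prod>i\<in>UNIV. inverse ((1 + \<bar>y $ i\<bar>)\<^sup>2))"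
          using mult_left_mono[of _ _ "Kf * A"] Kf A by (metis mult_nonneg_nonneg times_divide_eq_right)
      qed
      ultimately show ?thesis unfolding lattice_defect_def by simp
    qed
    moreover have "lattice_defect (\<lambda>y. s (y - \<alpha>) * u y) = lattice_defect g1 + lattice_defect F"
      unfolding split by (rule lattice_defect_add(2)[OF a1 a2])
    ultimately show ?thesis unfolding K_def by (simp add: algebra_simps)
  qed
  from that[OF K main] show thesis .
qed

end

section \<open>Smooth functions and their mixed derivatives\<close>

lemma Ck_on_cong:
  assumes "open U"
  shows "(\<And>y. y \<in> U \<Longrightarrow> f y = g y) \<Longrightarrow> Ck_on k U f \<longleftrightarrow> Ck_on k U g"
proof (induction k arbitrary: f g)
  case 0 then show ?case by (auto cong: continuous_on_cong)
next
  case (Suc k)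
  have "\<And>i y. y \<in> U \<Longrightarrow> partial_deriv i f y = partial_deriv i g y"
    by (rule partial_deriv_cong[OF assms]) (auto simp: Suc.prems)
  then have "Ck_on k U (partial_deriv i f) \<longleftrightarrow> Ck_on k U (partial_deriv i g)" for i
    by (rule Suc.IH)
  moreover have "f differentiable_on U \<longleftrightarrow> g differentiable_on U"
    unfolding differentiable_on_def differentiable_def
    using has_derivative_transform[of _ U f g] has_derivative_transform[of _ U g f] Suc.prems by metis
  ultimately show ?case by simp
qed

lemma Ck_on_Un:
  assumes "open U" "open V"
  shows "Ck_on k U f \<Longrightarrow> Ck_on k V f \<Longrightarrow> Ck_on k (U \<union> V) f"
  by (induction k arbitrary: f)
     (use assms in \<open>auto simp: differentiable_on_eq_differentiable_at open_Un intro: continuous_on_open_Un\<close>)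

lemma Ck_on_0: "Ck_on k U (\<lambda>_ :: real ^ 'n::finite. 0)"
proof (induction k)
  case (Suc k)
  have "partial_deriv i (\<lambda>_ :: real ^ 'n. 0) = (\<lambda>_. 0)" for i :: 'n
    by (rule ext, rule partial_deriv_eqI) (rule has_partial_const)
  then show ?case using Suc by (simp add: differentiable_on_def)
qed simp

text \<open>
  The extension by zero is smooth because \<open>U\<close> and the complement of the support cover the space.
\<close>
lemma test_function_Ck:
  assumes "v \<in> test_functions U"
  shows "Ck_on k UNIV v"
proof -
  let ?S = "closure {x. v x \<noteq> 0}"
  have U: "open U" "Ck_on k U v" "?S \<subseteq> U"
    using assms by (auto simp: test_functions_def smooth_on_def)
  have "Ck_on k (- ?S) v"
    using closure_subset[of "{x. v x \<noteq> 0}"]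
    by (subst Ck_on_cong[where g = "\<lambda>_. 0"]) (auto intro: Ck_on_0)
  then have "Ck_on k (U \<union> - ?S) v"
    using U by (intro Ck_on_Un) auto
  moreover have "U \<union> - ?S = UNIV" using U(3) by auto
  ultimately show ?thesis by simp
qed

lemma Ck_on_foldr: "Ck_on (length is + k) U f \<Longrightarrow> Ck_on k U (foldr partial_deriv is f)"
proof (induction "is" arbitrary: k)
  case (Cons i "is")
  from Cons.prems have "Ck_on (length is + Suc k) U f" by (simp del: Ck_on.simps)
  from Cons.IH[OF this] show ?case by simp
qed simp

text \<open>
  Two applications of the mean value theorem, first in direction \<open>i\<close> and then in direction \<open>j\<close>.
\<close>
lemma second_difference:
  fixes f :: "real ^ 'n::finite \<Rightarrow> real"
  assumes "\<And>y. has_partial i f (partial_deriv i f y) y"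
    and "\<And>y. has_partial j (partial_deriv i f) (partial_deriv j (partial_deriv i f) y) y" and "0 < t"
  shows "\<exists>\<xi> \<eta>. 0 < \<xi> \<and> \<xi> < t \<and> 0 < \<eta> \<and> \<eta> < t \<and>
    (f (x + t *\<^sub>R axis i 1 + t *\<^sub>R axis j 1) - f (x + t *\<^sub>R axis i 1)) - (f (x + t *\<^sub>R axis j 1) - f x) =
      t * (t * partial_deriv j (partial_deriv i f) (x + \<xi> *\<^sub>R axis i 1 + \<eta> *\<^sub>R axis j 1))"
proof -
  let ?g = "\<lambda>u. f ((x + t *\<^sub>R axis j 1) + u *\<^sub>R axis i 1) - f (x + u *\<^sub>R axis i 1)"
  let ?g' = "\<lambda>u. partial_deriv i f ((x + t *\<^sub>R axis j 1) + u *\<^sub>R axis i 1) - partial_deriv i f (x + u *\<^sub>R axis i 1)"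
  have "\<exists>\<xi>. 0 < \<xi> \<and> \<xi> < t \<and> ?g t - ?g 0 = (t - 0) * ?g' \<xi>"
    by (rule MVT2[OF \<open>0 < t\<close>]) (intro DERIV_diff has_partial_along_line assms(1))
  then obtain \<xi> where \<xi>: "0 < \<xi>" "\<xi> < t" "?g t - ?g 0 = t * ?g' \<xi>" by auto
  let ?k = "\<lambda>u. partial_deriv i f ((x + \<xi> *\<^sub>R axis i 1) + u *\<^sub>R axis j 1)"
  have "\<exists>\<eta>. 0 < \<eta> \<and> \<eta> < t \<and> ?k t - ?k 0 = (t - 0) * partial_deriv j (partial_deriv i f) ((x + \<xi> *\<^sub>R axis i 1) + \<eta> *\<^sub>R axis j 1)"
    by (rule MVT2[OF \<open>0 < t\<close>]) (intro has_partial_along_line assms(2))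
  then obtain \<eta> where \<eta>: "0 < \<eta>" "\<eta> < t" "?k t - ?k 0 = t * partial_deriv j (partial_deriv i f) ((x + \<xi> *\<^sub>R axis i 1) + \<eta> *\<^sub>R axis j 1)"
    by auto
  have e: "(x + t *\<^sub>R axis j 1) + u *\<^sub>R axis i 1 = x + u *\<^sub>R axis i 1 + t *\<^sub>R axis j 1" for u :: real
    by (simp add: algebra_simps)
  show ?thesis
    by (intro exI[of _ \<xi>] exI[of _ \<eta>] conjI \<xi> \<eta>) (use \<xi>(3) \<eta>(3) in \<open>simp add: e\<close>)
qed

text \<open>
  The second difference is symmetric in \<open>i\<close> and \<open>j\<close>; divided by \<open>t\<^sup>2\<close> it is a value of either mixed derivative
  at a point close to \<open>x\<close>, and both are continuous.
\<close>
lemma partial_deriv_commute: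
  fixes f :: "real ^ 'n::finite \<Rightarrow> real"
  assumes f: "\<And>k. Ck_on k UNIV f"
  shows "partial_deriv i (partial_deriv j f) = partial_deriv j (partial_deriv i f)"
proof (rule ext, rule ccontr)
  fix x
  have C: "Ck_on k UNIV (partial_deriv i f)" "Ck_on k UNIV (partial_deriv j (partial_deriv i f))" for k i j
    using f[of "Suc (Suc k)"] f[of "Suc k"] by auto
  have hp: "has_partial i f (partial_deriv i f y) y"
    "has_partial j (partial_deriv i f) (partial_deriv j (partial_deriv i f) y) y" for i j y
    using Ck_on_differentiable[OF open_UNIV f[of "Suc 0"]] Ck_on_differentiable[OF open_UNIV C(1)[where k = "Suc 0"]]
    by (auto intro: has_partial_of_differentiable)
  define a where "a = partial_deriv i (partial_deriv j f)"
  define b where "b = partial_deriv j (partial_deriv i f)"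
  assume "partial_deriv i (partial_deriv j f) x \<noteq> partial_deriv j (partial_deriv i f) x"
  then have ne: "a x \<noteq> b x" by (simp add: a_def b_def)
  define e where "e = dist (a x) (b x) / 2"
  have e: "0 < e" using ne by (simp add: e_def)
  have "continuous_on UNIV a" "continuous_on UNIV b"
    using C(2)[where k = 0] by (simp_all add: a_def b_def)
  then have "isCont a x" "isCont b x" by (auto simp: continuous_on_eq_continuous_at)
  then obtain d1 d2 where d: "0 < d1" "\<And>y. dist y x < d1 \<Longrightarrow> dist (a y) (a x) < e"
    "0 < d2" "\<And>y. dist y x < d2 \<Longrightarrow> dist (b y) (b x) < e"
    using e unfolding continuous_at_eps_delta by metis
  define t where "t = min d1 d2 / 2"
  have t: "0 < t" using d by (simp add: t_def)
  have near: "dist (x + \<xi> *\<^sub>R axis k 1 + \<eta> *\<^sub>R axis l 1) x < min d1 d2"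
    if "0 < \<xi>" "\<xi> < t" "0 < \<eta>" "\<eta> < t" for \<xi> \<eta> k l
  proof -
    have "norm (\<xi> *\<^sub>R axis k 1 + \<eta> *\<^sub>R axis l 1 :: real ^ 'n) \<le> \<xi> + \<eta>"
      using that norm_triangle_ineq[of "\<xi> *\<^sub>R axis k 1" "\<eta> *\<^sub>R axis l 1 :: real ^ 'n"] by (simp add: norm_axis_1)
    also have "\<dots> < min d1 d2" using that by (simp add: t_def)
    finally show ?thesis by (simp add: dist_norm add.assoc)
  qed
  obtain \<xi> \<eta> where 1: "0 < \<xi>" "\<xi> < t" "0 < \<eta>" "\<eta> < t"
    "(f (x + t *\<^sub>R axis i 1 + t *\<^sub>R axis j 1) - f (x + t *\<^sub>R axis i 1)) - (f (x + t *\<^sub>R axis j 1) - f x) =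
      t * (t * b (x + \<xi> *\<^sub>R axis i 1 + \<eta> *\<^sub>R axis j 1))"
    using second_difference[OF hp t, of x i j] unfolding b_def by blast
  obtain \<xi>' \<eta>' where 2: "0 < \<xi>'" "\<xi>' < t" "0 < \<eta>'" "\<eta>' < t"
    "(f (x + t *\<^sub>R axis j 1 + t *\<^sub>R axis i 1) - f (x + t *\<^sub>R axis j 1)) - (f (x + t *\<^sub>R axis i 1) - f x) =
      t * (t * a (x + \<xi>' *\<^sub>R axis j 1 + \<eta>' *\<^sub>R axis i 1))"
    using second_difference[OF hp t, of x j i] unfolding a_def by blast
  have e: "x + t *\<^sub>R axis j 1 + t *\<^sub>R axis i 1 = x + t *\<^sub>R axis i 1 + t *\<^sub>R axis j 1"
    by (simp add: algebra_simps)
  have "t * (t * a (x + \<xi>' *\<^sub>R axis j 1 + \<eta>' *\<^sub>R axis i 1)) = t * (t * b (x + \<xi> *\<^sub>R axis i 1 + \<eta> *\<^sub>R axis j 1))"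
    using 1(5) 2(5) unfolding e by linarith
  then have "a (x + \<xi>' *\<^sub>R axis j 1 + \<eta>' *\<^sub>R axis i 1) = b (x + \<xi> *\<^sub>R axis i 1 + \<eta> *\<^sub>R axis j 1)"
    using t by simp
  moreover have "dist (a (x + \<xi>' *\<^sub>R axis j 1 + \<eta>' *\<^sub>R axis i 1)) (a x) < e"
    using near[OF 2(1-4)] by (intro d(2)) simp
  moreover have "dist (b (x + \<xi> *\<^sub>R axis i 1 + \<eta> *\<^sub>R axis j 1)) (b x) < e"
    using near[OF 1(1-4)] by (intro d(4)) simp
  ultimately have "dist (a x) (b x) < e + e"
    by (metis dist_commute dist_triangle_less_add)
  then show False by (simp add: e_def)
qed

lemma foldr_partial_deriv_perm:
  fixes f :: "real ^ 'n::finite \<Rightarrow> real"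
  assumes "\<And>k. Ck_on k UNIV f" "\<And>i. count_list xs i = count_list ys i"
  shows "foldr partial_deriv xs f = foldr partial_deriv ys f"
proof -
  have "mset (rev xs) = mset (rev ys)"
    using assms(2) by (simp add: multiset_eq_iff count_mset)
  then have "fold partial_deriv (rev xs) f = fold partial_deriv (rev ys) f"
  proof (rule fold_permuted_eq[where P = "\<lambda>f. \<forall>k. Ck_on k UNIV f"])
    show "\<forall>k. Ck_on k UNIV f" using assms(1) by blast
    show "\<forall>k. Ck_on k UNIV (partial_deriv x z)" if "\<forall>k. Ck_on k UNIV z" for x and z :: "real ^ 'n \<Rightarrow> real"
      using that[rule_format, of "Suc _"] by auto
  qed (use partial_deriv_commute in blast)
  then show ?thesis by (simp add: foldr_conv_fold)
qed

lemma multi_deriv_eq_foldr: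
  fixes f :: "real ^ 'n::finite \<Rightarrow> real"
  assumes "\<And>k. Ck_on k UNIV f" "\<And>i. count_list is i = \<nu> i"
  shows "multi_deriv \<nu> f = foldr partial_deriv is f"
proof -
  have "\<forall>i. count_list is i = \<nu> i" using assms(2) by blast
  then have "\<forall>i. count_list (SOME is. \<forall>i. count_list is i = \<nu> i) i = \<nu> i" by (rule someI)
  then show ?thesis
    unfolding multi_deriv_def using assms by (intro foldr_partial_deriv_perm) auto
qed

section \<open>Taylor expansion\<close>

definition monomial :: "('n::finite \<Rightarrow> nat) \<Rightarrow> real ^ 'n \<Rightarrow> real" where
  "monomial \<nu> x = (\<Prod>i\<in>UNIV. (x $ i) ^ \<nu> i / fact (\<nu> i))"

lemma monomial_differentiable: "monomial \<nu> differentiable (at x)"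
proof -
  have "(\<lambda>x. x $ i) differentiable (at x)" for i
    by (rule bounded_linear_imp_differentiable) (rule bounded_linear_vec_nth)
  then have "(\<lambda>x. \<Prod>i\<in>I. (x $ i) ^ \<nu> i / fact (\<nu> i)) differentiable (at x)" for I
  proof (induction I rule: infinite_finite_induct)
    case (insert i I)
    have "(\<lambda>x. (x $ i) ^ \<nu> i / fact (\<nu> i)) differentiable (at x)"
      using insert.prems[of i] by (intro differentiable_divide differentiable_power) auto
    then show ?case using insert by (simp add: differentiable_mult)
  qed auto
  then show ?thesis unfolding monomial_def[abs_def] .
qed

lemma monomial_has_partial:
  "has_partial i (monomial \<nu>) (if \<nu> i = 0 then 0 else monomial (\<nu>(i := \<nu> i - 1)) y) y"
proof -
  let ?P = "\<Prod>k\<in>UNIV - {i}. (y $ k) ^ \<nu> k / fact (\<nu> k)"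
  have m: "monomial \<nu> (y + t *\<^sub>R axis i 1) = (y $ i + t) ^ \<nu> i / fact (\<nu> i) * ?P" for t
  proof -
    have "(\<Prod>k\<in>UNIV - {i}. ((y + t *\<^sub>R axis i 1) $ k) ^ \<nu> k / fact (\<nu> k)) = ?P"
      by (intro prod.cong) (auto simp: axis_def)
    then show ?thesis
      unfolding monomial_def by (subst prod.remove[of UNIV i]) auto
  qed
  show ?thesis
  proof (cases "\<nu> i")
    case 0
    then show ?thesis unfolding has_partial_def m by simp
  next
    case (Suc n)
    have m': "monomial (\<nu>(i := n)) y = (y $ i) ^ n / fact n * ?P"
      unfolding monomial_def by (subst prod.remove[of UNIV i]) (auto intro!: prod.cong)
    have "((\<lambda>t. y $ i + t) has_real_derivative 1) (at 0)"
      by (auto intro!: derivative_eq_intros)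
    from DERIV_power_Suc[OF this, of n]
    have "((\<lambda>t. (y $ i + t) ^ Suc n) has_real_derivative real (Suc n) * (y $ i) ^ n) (at 0)"
      by (simp add: add.commute)
    from DERIV_cmult[OF this, of "?P / fact (Suc n)"]
    have "((\<lambda>t. (y $ i + t) ^ Suc n / fact (Suc n) * ?P) has_real_derivative ?P / fact (Suc n) * (real (Suc n) * (y $ i) ^ n)) (at 0)"
      by (simp add: mult_ac)
    also have "?P / fact (Suc n) * (real (Suc n) * (y $ i) ^ n) = (y $ i) ^ n / fact n * ?P"
      by (simp add: divide_simps del: of_nat_Suc)
    finally show ?thesis unfolding has_partial_def m using Suc m' by simp
  qed
qed

lemma foldr_partial_deriv_monomial:
  "foldr partial_deriv is (monomial \<nu>) =
     (if \<forall>i. count_list is i \<le> \<nu> i then monomial (\<lambda>i. \<nu> i - count_list is i) else (\<lambda>_. 0))"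
proof (induction "is")
  case Nil then show ?case by simp
next
  case (Cons i "is")
  let ?\<mu> = "\<lambda>k. \<nu> k - count_list is k"
  have z: "partial_deriv i (\<lambda>_. 0) = (\<lambda>_. 0)"
    by (rule ext, rule partial_deriv_eqI) (rule has_partial_const)
  have m: "partial_deriv i (monomial ?\<mu>) = (if ?\<mu> i = 0 then (\<lambda>_. 0) else monomial (?\<mu>(i := ?\<mu> i - 1)))"
    using partial_deriv_eqI[OF monomial_has_partial[of i ?\<mu>]] by auto
  have u: "?\<mu>(i := ?\<mu> i - 1) = (\<lambda>k. \<nu> k - count_list (i # is) k)" by auto
  show ?case
  proof (cases "\<forall>k. count_list is k \<le> \<nu> k")
    case True
    then have "(\<forall>k. count_list (i # is) k \<le> \<nu> k) \<longleftrightarrow> ?\<mu> i \<noteq> 0"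
      by (auto simp: Suc_le_eq)
    then show ?thesis using Cons True m u by auto
  next
    case False
    then have "\<not> (\<forall>k. count_list (i # is) k \<le> \<nu> k)"
      by (metis Suc_leD count_list.simps(2) add.commute plus_1_eq_Suc)
    moreover have "foldr partial_deriv (i # is) (monomial \<nu>) = (\<lambda>_. 0)"
      using Cons False z by (simp only: foldr.simps comp_def if_False)
    ultimately show ?thesis by (simp only: if_False)
  qed
qed

lemma monomial_0: "monomial \<nu> 0 = (if \<nu> = (\<lambda>_. 0) then 1 else 0)"
  unfolding monomial_def by (auto simp: fun_eq_iff power_0_left)

lemma foldr_partial_deriv_monomial_0:
  "foldr partial_deriv is (monomial \<nu>) 0 = (if \<nu> = count_list is then 1 else 0)"
  unfolding foldr_partial_deriv_monomial
  by (auto simp: monomial_0 fun_eq_iff intro: antisym)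

lemma foldr_partial_deriv_monomial_high:
  "mi_order \<nu> < length is \<Longrightarrow> foldr partial_deriv is (monomial \<nu>) = (\<lambda>_. 0)"
proof -
  assume "mi_order \<nu> < length is"
  moreover have "length is = (\<Sum>i\<in>UNIV. count_list is i)"
    using sum_count_set[of "is" UNIV] by simp
  ultimately have "\<not> (\<forall>i. count_list is i \<le> \<nu> i)"
    unfolding mi_order_def by (metis not_less sum_mono)
  then show ?thesis by (simp only: foldr_partial_deriv_monomial if_False)
qed

lemma foldr_partial_deriv_monomial_differentiable:
  "foldr partial_deriv is (monomial \<nu>) differentiable (at x)"
  unfolding foldr_partial_deriv_monomial using monomial_differentiable by auto

lemma finite_mi_order_le: "finite {\<nu> :: 'n::finite \<Rightarrow> nat. mi_order \<nu> \<le> p}"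
proof (rule finite_subset)
  show "{\<nu> :: 'n \<Rightarrow> nat. mi_order \<nu> \<le> p} \<subseteq> PiE UNIV (\<lambda>_. {..p})"
  proof
    fix \<nu> :: "'n \<Rightarrow> nat" assume "\<nu> \<in> {\<nu>. mi_order \<nu> \<le> p}"
    then have "\<nu> i \<le> p" for i
      using member_le_sum[of i UNIV \<nu>] unfolding mi_order_def by (auto intro: order_trans)
    then show "\<nu> \<in> PiE UNIV (\<lambda>_. {..p})" by auto
  qed
  show "finite (PiE (UNIV :: 'n set) (\<lambda>_. {..p}))" by (intro finite_PiE) auto
qed

text \<open>
  The derivative along the list \<open>is\<close> of the remainder of the Taylor expansion of order \<open>p\<close> at \<open>z\<close>. Carrying \<open>is\<close> as a
  parameter makes one more derivative the same as one more list element.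
\<close>
definition taylor_remainder ::
  "nat \<Rightarrow> (real ^ 'n::finite \<Rightarrow> real) \<Rightarrow> real ^ 'n \<Rightarrow> 'n list \<Rightarrow> real ^ 'n \<Rightarrow> real" where
  "taylor_remainder p v z is x = foldr partial_deriv is v x -
     (\<Sum>\<nu> | mi_order \<nu> \<le> p. multi_deriv \<nu> v z * foldr partial_deriv is (monomial \<nu>) (x - z))"

lemma monomial_translate_has_partial:
  "has_partial i (\<lambda>x. foldr partial_deriv is (monomial \<nu>) (x - z))
    (foldr partial_deriv (i # is) (monomial \<nu>) (x - z)) x"
proof -
  have "has_partial i (foldr partial_deriv is (monomial \<nu>))
      (foldr partial_deriv (i # is) (monomial \<nu>) (1 *\<^sub>R x + (- z))) (1 *\<^sub>R x + (- z))"
    using has_partial_of_differentiable[OF foldr_partial_deriv_monomial_differentiable] by simp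
  from has_partial_affine[OF this] show ?thesis by simp
qed

lemma taylor_remainder_partial:
  fixes v :: "real ^ 'n::finite \<Rightarrow> real"
  assumes v: "\<And>k. Ck_on k UNIV v"
  shows "taylor_remainder p v z is differentiable (at x)"
    and "has_partial i (taylor_remainder p v z is) (taylor_remainder p v z (i # is) x) x"
proof -
  have d1: "foldr partial_deriv is v differentiable (at x)" for x
    by (rule Ck_on_differentiable[OF open_UNIV Ck_on_foldr[of _ "Suc 0"]]) (use v in auto)
  have d2: "(\<lambda>x. foldr partial_deriv is (monomial \<nu>) (x - z)) differentiable (at x)" for \<nu>
  proof -
    have "(\<lambda>x. x - z) differentiable (at x)" by simp
    then show ?thesis
      using differentiable_compose[of "foldr partial_deriv is (monomial \<nu>)" "\<lambda>x. x - z" x UNIV]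
        foldr_partial_deriv_monomial_differentiable by blast
  qed
  show "taylor_remainder p v z is differentiable (at x)"
    unfolding taylor_remainder_def[abs_def]
    by (intro differentiable_diff d1 differentiable_sum finite_mi_order_le ballI differentiable_mult differentiable_const d2)

  have p1: "has_partial i (foldr partial_deriv is v) (foldr partial_deriv (i # is) v x) x"
    using has_partial_of_differentiable[OF d1] by simp
  show "has_partial i (taylor_remainder p v z is) (taylor_remainder p v z (i # is) x) x"
    unfolding taylor_remainder_def[abs_def]
    by (intro has_partial_diff has_partial_sum has_partial_cmult p1 monomial_translate_has_partial)
qed

lemma taylor_remainder_center:
  fixes v :: "real ^ 'n::finite \<Rightarrow> real"
  assumes v: "\<And>k. Ck_on k UNIV v" and len: "length is \<le> p"
  shows "taylor_remainder p v z is z = 0"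
proof -
  have mem: "mi_order (count_list is) \<le> p"
    using len sum_count_set[of "is" UNIV] by (simp add: mi_order_def)
  have "(\<Sum>\<nu> | mi_order \<nu> \<le> p. multi_deriv \<nu> v z * foldr partial_deriv is (monomial \<nu>) (z - z))
      = (\<Sum>\<nu> | mi_order \<nu> \<le> p. if \<nu> = count_list is then multi_deriv (count_list is) v z else 0)"
    by (intro sum.cong) (auto simp: foldr_partial_deriv_monomial_0)
  also have "\<dots> = multi_deriv (count_list is) v z"
    using mem by (simp add: finite_mi_order_le)
  also have "\<dots> = foldr partial_deriv is v z"
    by (subst multi_deriv_eq_foldr[OF v]) auto
  finally show ?thesis by (simp add: taylor_remainder_def)
qed

lemma taylor_remainder_high:
  "p < length is \<Longrightarrow> taylor_remainder p v z is = foldr partial_deriv is v"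
  by (rule ext) (simp add: taylor_remainder_def foldr_partial_deriv_monomial_high)

lemma mean_value_partials:
  fixes f :: "real ^ 'n::finite \<Rightarrow> real"
  assumes diff: "\<And>y. f differentiable (at y)" and "\<And>i y. has_partial i f (g i y) y"
    and bound: "\<And>i y. norm (y - z) \<le> norm (x - z) \<Longrightarrow> \<bar>g i y\<bar> \<le> B"
  shows "\<bar>f x - f z\<bar> \<le> real CARD('n) * B * norm (x - z)"
proof -
  let ?S = "cball z (norm (x - z))"
  have g: "partial_deriv i f y = g i y" for i y
    using assms(2) by (rule partial_deriv_eqI)
  have "norm (f x - f z) \<le> (real CARD('n) * B) * norm (x - z)"
  proof (rule differentiable_bound[where S = ?S and f' = "\<lambda>y d. \<Sum>i\<in>UNIV. d $ i * g i y"])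
    show "(f has_derivative (\<lambda>d. \<Sum>i\<in>UNIV. d $ i * g i y)) (at y within ?S)" for y
      using has_derivative_partials[OF diff[of y]] by (simp add: g has_derivative_at_withinI)
    show "onorm (\<lambda>d. \<Sum>i\<in>UNIV. d $ i * g i y) \<le> real CARD('n) * B" if "y \<in> ?S" for y
    proof (rule onorm_le)
      fix d :: "real ^ 'n"
      have b: "\<bar>g i y\<bar> \<le> B" for i using that by (intro bound) (simp add: dist_norm norm_minus_commute)
      have "norm (\<Sum>i\<in>UNIV. d $ i * g i y) \<le> (\<Sum>i\<in>(UNIV::'n set). norm d * B)"
      proof (rule order_trans[OF norm_sum], rule sum_mono)
        fix i
        have "\<bar>d $ i\<bar> * \<bar>g i y\<bar> \<le> norm d * B"
          by (rule mult_mono) (use component_le_norm_cart[of d i] b[of i] in auto)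
        then show "norm (d $ i * g i y) \<le> norm d * B" by (simp add: abs_mult)
      qed
      then show "norm (\<Sum>i\<in>UNIV. d $ i * g i y) \<le> real CARD('n) * B * norm d" by (simp add: mult_ac)
    qed
  qed (auto simp: dist_norm norm_minus_commute)
  then show ?thesis by simp
qed

text \<open>
  All derivatives of the remainder up to order \<open>p\<close> vanish at \<open>z\<close>, and those of order \<open>p + 1\<close> are derivatives of \<open>v\<close>
  itself, hence bounded. Descending induction on the order with the mean value inequality gains one
  factor \<open>|x - z|\<close> per step. For lists longer than \<open>p + 1\<close> the exponent is zero by truncated subtraction, and
  the bound remains correct.
\<close>
lemma taylor_remainder_bound:
  fixes v :: "real ^ 'n::finite \<Rightarrow> real"
  assumes v: "\<And>k. Ck_on k UNIV v" and supp: "\<And>x. norm x > L \<Longrightarrow> v x = 0"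
  obtains B where "0 \<le> B" "\<And>is x. length is \<le> N \<Longrightarrow> \<bar>foldr partial_deriv is v x\<bar> \<le> B"
    "\<And>z is x. length is \<le> N \<Longrightarrow> \<bar>taylor_remainder p v z is x\<bar> \<le> B * norm (x - z) ^ (p + 1 - length is)"
proof -
  define M where "M = max N (p + 1)"
  have "\<exists>B. \<forall>x. \<bar>foldr partial_deriv is v x\<bar> \<le> B" for "is"
  proof -
    have "Ck_on 0 UNIV (foldr partial_deriv is v)" by (rule Ck_on_foldr) (use v in simp)
    then have "compact (foldr partial_deriv is v ` cball 0 L)"
      by (intro compact_continuous_image) (auto intro: continuous_on_subset)
    from compact_imp_bounded[OF this]
    obtain B where "\<forall>x\<in>cball 0 L. \<bar>foldr partial_deriv is v x\<bar> \<le> B"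
      unfolding bounded_iff by auto
    then have B: "\<bar>foldr partial_deriv is v x\<bar> \<le> B" if "norm x \<le> L" for x
      using that by simp
    have "foldr partial_deriv is v x = 0" if "norm x > L" for x
      using that
    proof (induction "is" arbitrary: x)
      case (Cons i "is")
      have "partial_deriv i (foldr partial_deriv is v) x = partial_deriv i (\<lambda>_. 0) x"
        by (rule partial_deriv_cong[of "{x. norm x > L}"])
           (use Cons in \<open>auto intro!: open_Collect_less continuous_intros\<close>)
      also have "\<dots> = 0" by (rule partial_deriv_eqI) (rule has_partial_const)
      finally show ?case by simp
    qed (use supp in auto)
    then have "\<bar>foldr partial_deriv is v x\<bar> \<le> max B 0" for x
      using B[of x] by (cases "norm x \<le> L") (auto simp: le_max_iff_disj not_le)
    then show ?thesis by blast
  qed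
  then obtain b where b: "\<And>is x. \<bar>foldr partial_deriv is v x\<bar> \<le> b is" by metis
  define B0 where "B0 = (\<Sum>is | set is \<subseteq> (UNIV::'n set) \<and> length is \<le> M. b is)"
  have b0: "0 \<le> b is" for "is" using b[of "is" 0] by linarith
  have B0: "\<bar>foldr partial_deriv is v x\<bar> \<le> B0" if "length is \<le> M" for "is" x
  proof -
    have "b is \<le> B0" unfolding B0_def
      using that b0 finite_lists_length_le[of "UNIV::'n set" M] by (intro member_le_sum) auto
    then show ?thesis using b[of "is" x] by linarith
  qed
  have B0n: "0 \<le> B0" unfolding B0_def by (intro sum_nonneg b0)
  have tb: "\<bar>taylor_remainder p v z is x\<bar> \<le> real CARD('n) ^ d * B0 * norm (x - z) ^ d"
    if "length is = p + 1 - d" "d \<le> p + 1" for d z "is" x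
    using that
  proof (induction d arbitrary: "is" x)
    case 0
    then show ?case using B0[of "is" x] by (simp add: taylor_remainder_high M_def)
  next
    case (Suc d)
    have "\<bar>taylor_remainder p v z is x - taylor_remainder p v z is z\<bar> \<le>
      real CARD('n) * (real CARD('n) ^ d * B0 * norm (x - z) ^ d) * norm (x - z)"
    proof (rule mean_value_partials)
      fix i y assume y: "norm (y - z) \<le> norm (x - z)"
      have "\<bar>taylor_remainder p v z (i # is) y\<bar> \<le> real CARD('n) ^ d * B0 * norm (y - z) ^ d"
        using Suc.prems by (intro Suc.IH) auto
      also have "\<dots> \<le> real CARD('n) ^ d * B0 * norm (x - z) ^ d"
        using y B0n by (intro mult_left_mono power_mono) auto
      finally show "\<bar>taylor_remainder p v z (i # is) y\<bar> \<le> real CARD('n) ^ d * B0 * norm (x - z) ^ d" .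
    qed (use taylor_remainder_partial[OF v] in auto)
    moreover have "taylor_remainder p v z is z = 0"
      using Suc.prems by (intro taylor_remainder_center[OF v]) auto
    ultimately show ?case by (simp add: mult_ac)
  qed
  define B where "B = real CARD('n) ^ (p + 1) * B0"
  have n1: "1 \<le> real CARD('n)" by (simp add: Suc_le_eq)
  have le: "real CARD('n) ^ d * B0 \<le> B" if "d \<le> p + 1" for d
    unfolding B_def using n1 that B0n by (intro mult_right_mono power_increasing) auto
  have "\<bar>taylor_remainder p v z is x\<bar> \<le> B * norm (x - z) ^ (p + 1 - length is)" if "length is \<le> N" for z "is" x
  proof (cases "length is \<le> p + 1")
    case True
    then have "\<bar>taylor_remainder p v z is x\<bar> \<le> real CARD('n) ^ (p + 1 - length is) * B0 * norm (x - z) ^ (p + 1 - length is)"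
      by (intro tb) auto
    also have "\<dots> \<le> B * norm (x - z) ^ (p + 1 - length is)"
      by (intro mult_right_mono le) auto
    finally show ?thesis .
  next
    case False
    then show ?thesis using B0[of "is" x] that le[of 0] by (simp add: taylor_remainder_high M_def)
  qed
  moreover have "\<bar>foldr partial_deriv is v x\<bar> \<le> B" if "length is \<le> N" for "is" x
  proof -
    have "length is \<le> M" using that by (simp add: M_def)
    from B0[OF this, of x] show ?thesis using le[of 0] by simp
  qed
  moreover have "0 \<le> B" using le[of 0] B0n by simp
  ultimately show thesis using that by blast
qed

section \<open>The asymptotic expansion of the lattice defect\<close>

lemma abs_monomial_le: "\<bar>monomial \<nu> x\<bar> \<le> norm x ^ mi_order \<nu>"
proof -
  have "\<bar>monomial \<nu> x\<bar> = (\<Prod>i\<in>UNIV. \<bar>x $ i\<bar> ^ \<nu> i / fact (\<nu> i))"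
    unfolding monomial_def by (simp add: abs_prod power_abs)
  also have "\<dots> \<le> (\<Prod>i\<in>UNIV. norm x ^ \<nu> i)"
  proof (intro prod_mono conjI)
    fix i
    have "\<bar>x $ i\<bar> ^ \<nu> i / fact (\<nu> i) \<le> \<bar>x $ i\<bar> ^ \<nu> i / 1"
      by (intro divide_left_mono) (auto simp: fact_ge_1)
    also have "\<dots> \<le> norm x ^ \<nu> i"
      using component_le_norm_cart[of x i] by (simp add: power_mono)
    finally show "\<bar>x $ i\<bar> ^ \<nu> i / fact (\<nu> i) \<le> norm x ^ \<nu> i" .
  qed simp
  also have "\<dots> = norm x ^ mi_order \<nu>" by (simp add: mi_order_def power_sum)
  finally show ?thesis .
qed

lemma monomial_scale: "monomial \<nu> (h *\<^sub>R x) = h ^ mi_order \<nu> * monomial \<nu> x"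
  unfolding monomial_def mi_order_def
  by (simp add: power_mult_distrib power_sum prod.distrib flip: times_divide_eq_right)

lemma norm_translate_le: "norm (y - z) \<le> (1 + norm z) * (1 + norm (y :: 'a::real_normed_vector))"
proof -
  have "norm (y - z) \<le> norm y + norm z" by (rule norm_triangle_ineq4)
  also have "\<dots> \<le> (1 + norm z) * (1 + norm y)" by (simp add: algebra_simps)
  finally show ?thesis .
qed

lemma symbol_bound_monomial_translate:
  "symbol_bound i N UNIV (\<lambda>y. (1 + norm z) ^ mi_order \<nu> * (1 + norm y) ^ mi_order \<nu>) (\<lambda>y. monomial \<nu> (y - z))"
proof -
  let ?G = "\<lambda>j y. foldr partial_deriv (replicate j i) (monomial \<nu>) (y - z)"
  have "symbol_bound i N UNIV (\<lambda>y. (1 + norm z) ^ mi_order \<nu> * (1 + norm y) ^ mi_order \<nu>) (?G 0)"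
  proof (rule symbol_bound_family)
    fix j y
    show "has_partial i (?G j) (?G (Suc j) y) y"
      using monomial_translate_has_partial[of i "replicate j i" \<nu> z y] by (simp del: foldr_replicate)
    let ?c = "count_list (replicate j i)"
    show "\<bar>?G j y\<bar> \<le> (1 + norm z) ^ mi_order \<nu> * (1 + norm y) ^ mi_order \<nu> / (1 + norm y) ^ j"
    proof (cases "\<forall>k. ?c k \<le> \<nu> k")
      case True
      have "(\<Sum>k\<in>UNIV. ?c k) = j"
        using sum_count_set[of "replicate j i" UNIV] by simp
      moreover have "(\<Sum>k\<in>UNIV. ?c k) \<le> mi_order \<nu>"
        unfolding mi_order_def using True by (intro sum_mono) auto
      ultimately have j: "j \<le> mi_order \<nu>" and o: "mi_order (\<lambda>k. \<nu> k - ?c k) = mi_order \<nu> - j"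
        unfolding mi_order_def using True by (auto simp: sum_subtractf_nat)
      have "foldr partial_deriv (replicate j i) (monomial \<nu>) = monomial (\<lambda>k. \<nu> k - ?c k)"
        unfolding foldr_partial_deriv_monomial by (rule if_P[OF True])
      then have "\<bar>?G j y\<bar> \<le> norm (y - z) ^ (mi_order \<nu> - j)"
        using abs_monomial_le[of "\<lambda>k. \<nu> k - ?c k" "y - z"] o by (simp del: foldr_replicate)
      also have "\<dots> \<le> ((1 + norm z) * (1 + norm y)) ^ (mi_order \<nu> - j)"
        by (intro power_mono norm_translate_le) auto
      also have "\<dots> \<le> (1 + norm z) ^ mi_order \<nu> * (1 + norm y) ^ (mi_order \<nu> - j)"
        unfolding power_mult_distrib by (intro mult_right_mono power_increasing) auto
      also have "\<dots> = (1 + norm z) ^ mi_order \<nu> * (1 + norm y) ^ mi_order \<nu> / (1 + norm y) ^ j"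
        using j norm_ge_zero[of y] by (subst power_diff) (auto simp: add_nonneg_eq_0_iff)
      finally show ?thesis .
    next
      case False
      then have "foldr partial_deriv (replicate j i) (monomial \<nu>) = (\<lambda>_. 0)"
        unfolding foldr_partial_deriv_monomial by (rule if_not_P)
      then show ?thesis by (simp del: foldr_replicate)
    qed
  qed simp
  then show ?thesis by simp
qed

text \<open>
  A rate of convergence along pairs of parameters is a Cauchy condition and passes to the limit.
\<close>
lemma ex_limit_at_0:
  fixes H :: "real \<Rightarrow> real"
  assumes "0 < e" and C: "\<And>\<delta> \<delta>'. 0 < \<delta>' \<Longrightarrow> \<delta>' \<le> \<delta> \<Longrightarrow> \<delta> \<le> 1 \<Longrightarrow> \<bar>H \<delta> - H \<delta>'\<bar> \<le> C * \<delta> ^ e"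
  shows "\<exists>\<mu>. \<forall>\<delta>. 0 < \<delta> \<longrightarrow> \<delta> \<le> 1 \<longrightarrow> \<bar>H \<delta> - \<mu>\<bar> \<le> C * \<delta> ^ e"
proof -
  define X where "X n = H (1 / real (Suc n))" for n
  have C0: "0 \<le> C" using C[of 1 1] by simp
  have XC: "\<bar>X m - X n\<bar> \<le> C / real (Suc m)" if "m \<le> n" for m n
  proof -
    have "\<bar>X m - X n\<bar> \<le> C * (1 / real (Suc m)) ^ e"
      unfolding X_def using that by (intro C) (auto simp: frac_le)
    also have "\<dots> \<le> C * (1 / real (Suc m)) ^ 1"
      using \<open>0 < e\<close> C0 by (intro mult_left_mono power_decreasing) auto
    finally show ?thesis by simp
  qed
  have "Cauchy X"
  proof (rule CauchyI)
    fix \<epsilon> :: real assume \<epsilon>: "0 < \<epsilon>"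
    obtain M :: nat where M: "2 * C / \<epsilon> < real M" using reals_Archimedean2 by blast
    have "\<bar>X m - X M\<bar> \<le> C / real (Suc M)" if "M \<le> m" for m
      using XC[OF that] by (simp add: abs_minus_commute)
    moreover have "2 * (C / real (Suc M)) < \<epsilon>"
      using M \<epsilon> by (simp add: field_simps)
    ultimately have "norm (X m - X n) < \<epsilon>" if "M \<le> m" "M \<le> n" for m n
      using that by (smt (verit, best) real_norm_def)
    then show "\<exists>M. \<forall>m\<ge>M. \<forall>n\<ge>M. norm (X m - X n) < \<epsilon>" by blast
  qed
  then obtain \<mu> where \<mu>: "X \<longlonglongrightarrow> \<mu>" using Cauchy_convergent_iff convergent_def by blast
  have "\<bar>H \<delta> - \<mu>\<bar> \<le> C * \<delta> ^ e" if \<delta>: "0 < \<delta>" "\<delta> \<le> 1" for \<delta>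
  proof (rule LIMSEQ_le_const2)
    show "(\<lambda>n. \<bar>H \<delta> - X n\<bar>) \<longlonglongrightarrow> \<bar>H \<delta> - \<mu>\<bar>" by (intro tendsto_intros \<mu>)
    obtain M where M: "1 / real (Suc M) < \<delta>" using nat_approx_posE[OF \<delta>(1)] by blast
    have "\<bar>H \<delta> - X n\<bar> \<le> C * \<delta> ^ e" if "n \<ge> M" for n
    proof -
      have "1 / real (Suc n) \<le> 1 / real (Suc M)" using that by (intro divide_left_mono) auto
      then show ?thesis unfolding X_def using M \<delta> by (intro C) auto
    qed
    then show "\<exists>N. \<forall>n\<ge>N. \<bar>H \<delta> - X n\<bar> \<le> C * \<delta> ^ e" by blast
  qed
  then show ?thesis by blast
qed

text \<open>
  Where \<open>\<delta> (1 + |y|) \<ge> 1\<close>, powers of this quantity trade growth in \<open>y\<close> for smallness in \<open>\<delta>\<close>.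
\<close>
lemma power_gain_far:
  fixes y :: "'a::real_normed_vector"
  assumes "0 < \<delta>" "1 / \<delta> \<le> norm y" "k \<le> q"
  shows "(1 + norm y) ^ k \<le> \<delta> ^ (q - k) * (1 + norm y) ^ q"
proof -
  have "1 \<le> \<delta> * (1 + norm y)" using assms by (simp add: field_simps)
  then have "1 * (1 + norm y) ^ k \<le> (\<delta> * (1 + norm y)) ^ (q - k) * (1 + norm y) ^ k"
    by (intro mult_right_mono one_le_power) auto
  also have "\<dots> = \<delta> ^ (q - k) * (1 + norm y) ^ q"
    using assms(3) by (simp add: power_mult_distrib flip: power_add)
  finally show ?thesis by simp
qed

lemma symbol_bound_smooth_dilation:
  fixes v :: "real ^ 'n::finite \<Rightarrow> real"
  assumes v: "\<And>k. Ck_on k UNIV v" and supp: "\<And>x. norm x > L \<Longrightarrow> v x = 0"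
    and B: "\<And>is x. length is \<le> N \<Longrightarrow> \<bar>foldr partial_deriv is v x\<bar> \<le> B" and h: "0 < h" "h \<le> 1"
  shows "symbol_bound i N UNIV (\<lambda>_. B * (1 + max L 0) ^ N) (\<lambda>y. v (h *\<^sub>R y))"
proof (rule symbol_bound_dilation[OF _ _ _ _ h])
  fix j and y :: "real ^ 'n"
  have "(partial_deriv i ^^ j) v differentiable (at y)"
    by (rule Ck_on_differentiable[OF open_UNIV Ck_on_partial_deriv_iter[of _ "Suc 0"]]) (use v in auto)
  then show "has_partial i ((partial_deriv i ^^ j) v) ((partial_deriv i ^^ Suc j) v y) y"
    using has_partial_of_differentiable by fastforce
  show "\<bar>(partial_deriv i ^^ j) v y\<bar> \<le> B" if "j \<le> N"
    using B[of "replicate j i" y] that by simp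
qed (use supp in auto)

text \<open>
  Up to order \<open>p + 1\<close>, derivatives of the remainder at \<open>h y\<close> are bounded by powers of \<open>|h y - h \<beta>|\<close>, which combine with
  the factor \<open>h ^ j\<close> from the dilation to \<open>h ^ (p + 1)\<close>. Beyond that order there are excess powers of \<open>h\<close>, and
  on the region \<open>h |y| < c\<close> each of them is worth one power of \<open>1 / (1 + |y|)\<close>.
\<close>
lemma symbol_bound_taylor_remainder_dilation:
  fixes v :: "real ^ 'n::finite \<Rightarrow> real"
  assumes v: "\<And>k. Ck_on k UNIV v" and h: "0 < h" "h \<le> 1" and B: "0 \<le> B" and c: "0 \<le> c"
    and bound: "\<And>z is x. length is \<le> N \<Longrightarrow> \<bar>taylor_remainder p v z is x\<bar> \<le> B * norm (x - z) ^ (p + 1 - length is)"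
  shows "symbol_bound i N {y. norm y < c / h}
    (\<lambda>y. B * (1 + norm \<beta>) ^ (p + 1) * (1 + c) ^ N * (h ^ (p + 1) * (1 + norm y) ^ (p + 1)))
    (\<lambda>y. taylor_remainder p v (h *\<^sub>R \<beta>) [] (h *\<^sub>R y))"
proof -
  let ?G = "\<lambda>j y. h ^ j * taylor_remainder p v (h *\<^sub>R \<beta>) (replicate j i) (h *\<^sub>R y)"
  let ?b = "\<lambda>y::real^'n. B * (1 + norm \<beta>) ^ (p + 1) * (1 + c) ^ N * (h ^ (p + 1) * (1 + norm y) ^ (p + 1))"
  have "symbol_bound i N {y. norm y < c / h} ?b (?G 0)"
  proof (rule symbol_bound_family)
    show "open {y::real^'n. norm y < c / h}" by (intro open_Collect_less continuous_intros)
  next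
    fix j and y :: "real ^ 'n"
    have "has_partial i (\<lambda>y. taylor_remainder p v (h *\<^sub>R \<beta>) (replicate j i) (h *\<^sub>R y + 0))
       (h * taylor_remainder p v (h *\<^sub>R \<beta>) (replicate (Suc j) i) (h *\<^sub>R y + 0)) y"
      using taylor_remainder_partial(2)[OF v, of i p "h *\<^sub>R \<beta>" "replicate j i"]
      by (intro has_partial_affine) simp
    from has_partial_cmult[OF this, of "h ^ j"]
    show "has_partial i (?G j) (?G (Suc j) y) y" by (simp add: mult_ac)
  next
    fix j and y :: "real ^ 'n" assume j: "j \<le> N" and "y \<in> {y. norm y < c / h}"
    then have y: "h * norm y \<le> c" using h by (simp add: field_simps less_imp_le)
    have w: "1 \<le> 1 + norm y" by simp
    have "\<bar>?G j y\<bar> \<le> h ^ j * (B * norm (h *\<^sub>R y - h *\<^sub>R \<beta>) ^ (p + 1 - j))"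
      using bound[of "replicate j i" "h *\<^sub>R \<beta>" "h *\<^sub>R y"] j h by (simp add: abs_mult)
    also have "\<dots> = B * (h ^ j * h ^ (p + 1 - j)) * norm (y - \<beta>) ^ (p + 1 - j)"
      using h by (simp add: power_mult_distrib mult_ac flip: scaleR_diff_right)
    also have "\<dots> \<le> ?b y / (1 + norm y) ^ j"
    proof (cases "j \<le> p + 1")
      case True
      have "norm (y - \<beta>) ^ (p + 1 - j) \<le> ((1 + norm \<beta>) * (1 + norm y)) ^ (p + 1 - j)"
        by (intro power_mono norm_translate_le) auto
      also have "\<dots> \<le> (1 + norm \<beta>) ^ (p + 1) * (1 + norm y) ^ (p + 1 - j)"
        unfolding power_mult_distrib by (intro mult_right_mono power_increasing) auto
      also have "\<dots> \<le> (1 + norm \<beta>) ^ (p + 1) * (1 + c) ^ N * (1 + norm y) ^ (p + 1 - j)"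
        using c mult_left_mono[OF one_le_power[of "1 + c" N], of "(1 + norm \<beta>) ^ (p + 1)"]
        by (intro mult_right_mono) auto
      finally have "B * h ^ (p + 1) * norm (y - \<beta>) ^ (p + 1 - j) \<le>
          B * h ^ (p + 1) * ((1 + norm \<beta>) ^ (p + 1) * (1 + c) ^ N * (1 + norm y) ^ (p + 1 - j))"
        using B h by (intro mult_left_mono) auto
      moreover have "(1 + norm y) ^ (p + 1 - j) = (1 + norm y) ^ (p + 1) / (1 + norm y) ^ j"
      proof (rule power_diff)
        show "1 + norm y \<noteq> 0" using w by linarith
      qed (rule True)
      moreover have "h ^ j * h ^ (p + 1 - j) = h ^ (p + 1)"
        using True by (simp flip: power_add)
      ultimately show ?thesis by (simp add: mult_ac)
    next
      case False
      have "h * (1 + norm y) \<le> 1 + c" using y h by (simp add: distrib_left)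
      then have "(h * (1 + norm y)) ^ (j - (p + 1)) \<le> (1 + c) ^ (j - (p + 1))"
        using h by (intro power_mono) auto
      also have "\<dots> \<le> (1 + c) ^ N" using c j by (intro power_increasing) auto
      also have "\<dots> \<le> (1 + norm \<beta>) ^ (p + 1) * (1 + c) ^ N"
        using c mult_right_mono[OF one_le_power[of "1 + norm \<beta>" "p + 1"], of "(1 + c) ^ N"] by simp
      finally have 1: "(h * (1 + norm y)) ^ (j - (p + 1)) \<le> (1 + norm \<beta>) ^ (p + 1) * (1 + c) ^ N" .
      have "h ^ j * (1 + norm y) ^ j = h ^ (p + 1) * (1 + norm y) ^ (p + 1) * (h * (1 + norm y)) ^ (j - (p + 1))"
      proof -
        have "(h * (1 + norm y)) ^ j = (h * (1 + norm y)) ^ ((p + 1) + (j - (p + 1)))"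
          using False by simp
        then show ?thesis by (simp only: power_add power_mult_distrib mult_ac)
      qed
      also have "\<dots> \<le> h ^ (p + 1) * (1 + norm y) ^ (p + 1) * ((1 + norm \<beta>) ^ (p + 1) * (1 + c) ^ N)"
        using h by (intro mult_left_mono[OF 1]) auto
      finally have "h ^ j \<le> h ^ (p + 1) * (1 + norm y) ^ (p + 1) * ((1 + norm \<beta>) ^ (p + 1) * (1 + c) ^ N) / (1 + norm y) ^ j"
        by (subst pos_le_divide_eq[OF zero_less_power]) (auto intro: add_pos_nonneg)
      then have "B * h ^ j \<le> B * (h ^ (p + 1) * (1 + norm y) ^ (p + 1) * ((1 + norm \<beta>) ^ (p + 1) * (1 + c) ^ N) / (1 + norm y) ^ j)"
        using B by (rule mult_left_mono)
      then show ?thesis using False by (simp add: mult_ac)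
    qed
    finally show "\<bar>?G j y\<bar> \<le> ?b y / (1 + norm y) ^ j" .
  qed
  then show ?thesis by simp
qed

context homogeneous_function
begin

lemma admissible_s_mult:
  assumes u: "continuous_on UNIV u" and supp: "\<And>y. norm y > R \<Longrightarrow> u y = 0"
  shows "admissible (\<lambda>y. s (y - \<alpha>) * u y)"
proof -
  have "compact (u ` cball 0 R)"
    by (intro compact_continuous_image) (auto intro: continuous_on_subset[OF u])
  from compact_imp_bounded[OF this] obtain M where M: "\<forall>y\<in>cball 0 R. \<bar>u y\<bar> \<le> M"
    unfolding bounded_iff by auto
  have "integrable lborel (\<lambda>y. s (y - \<alpha>) * u y)"
    by (rule integrable_s_mult[where R = R and M = M])
       (use u M supp in \<open>auto intro: borel_measurable_continuous_onI\<close>)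
  then show ?thesis unfolding admissible_def using supp by (auto intro!: exI[of _ R])
qed

text \<open>
  The constants are the regularised moments: \<open>\<mu> \<nu>\<close> is the limit for \<open>\<delta>\<close> tending to 0 of \<open>H \<nu> \<delta>\<close>, the defect of the
  monomial centred at \<open>\<beta>\<close>, multiplied by \<open>s (y - \<alpha>)\<close> and truncated at scale \<open>1 / \<delta>\<close>. They do not involve \<open>v\<close>. Replacing
  \<open>v\<close> by its Taylor polynomial at \<open>h \<beta>\<close>, truncated at the same scale \<open>1 / h\<close>, costs \<open>O(h ^ (p + 1))\<close> by
  \<open>lattice_defect_bound\<close>, and so does replacing \<open>H \<nu> h\<close> by its limit.
\<close>
lemma lattice_defect_expansion:
  obtains \<mu> where
    "\<And>v L. \<lbrakk>\<And>k. Ck_on k UNIV v; \<And>x. norm x > L \<Longrightarrow> v x = 0\<rbrakk> \<Longrightarrow>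
      \<exists>D. \<forall>h. 0 < h \<longrightarrow> h \<le> 1 \<longrightarrow>
        \<bar>lattice_defect (\<lambda>y. s (y - \<alpha>) * v (h *\<^sub>R y)) -
          (\<Sum>\<nu> | mi_order \<nu> \<le> p. h ^ mi_order \<nu> * multi_deriv \<nu> v (h *\<^sub>R \<beta>) * \<mu> \<nu>)\<bar> \<le> D * h ^ (p + 1)"
proof -
  obtain N K where K: "0 \<le> K" and NK: "\<And>u A R. continuous_on UNIV u \<Longrightarrow> (\<And>y. norm y > R \<Longrightarrow> u y = 0) \<Longrightarrow> 0 \<le> A \<Longrightarrow>
     (\<And>i. symbol_bound i N UNIV (\<lambda>y. A * (1 + norm y) ^ (p + 1)) u) \<Longrightarrow>
     \<bar>lattice_defect (\<lambda>y. s (y - \<alpha>) * u y)\<bar> \<le> K * A"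
    by (rule lattice_defect_bound[of "p + 1" \<alpha>]) blast
  obtain \<phi> :: "real ^ 'n \<Rightarrow> real" and C where \<phi>: "continuous_on UNIV \<phi>" "\<And>x. norm x \<le> 1 \<Longrightarrow> \<phi> x = 1"
    "\<And>x. norm x > 2 * real CARD('n) \<Longrightarrow> \<phi> x = 0"
    "\<And>i h. 0 < h \<Longrightarrow> h \<le> 1 \<Longrightarrow> symbol_bound i N UNIV (\<lambda>_. C) (\<lambda>y. \<phi> (h *\<^sub>R y))"
    using ex_cutoff[of N] by blast
  have C: "0 \<le> C" using symbol_bound_abs_le[OF \<phi>(4)[of 1], of 0] by simp
  have \<phi>c: "continuous_on UNIV (\<lambda>y. \<phi> (h *\<^sub>R y))" for h
    by (intro continuous_on_compose2[OF \<phi>(1)] continuous_intros) auto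
  have \<phi>1: "\<phi> (h *\<^sub>R y) = 1" if "0 < h" "norm y < 1 / h" for h y
    using that by (intro \<phi>(2)) (simp add: field_simps)
  have \<phi>0: "\<phi> (h *\<^sub>R y) = 0" if "0 < h" "norm y > 2 * real CARD('n) / h" for h y
    using that by (intro \<phi>(3)) (simp add: field_simps)
  have mc: "continuous_on UNIV (\<lambda>y. monomial \<nu> (y - \<beta>))" for \<nu>
  proof -
    have "continuous_on UNIV (monomial \<nu>)"
      by (intro continuous_at_imp_continuous_on ballI differentiable_imp_continuous_within monomial_differentiable)
    then show ?thesis by (rule continuous_on_compose2) (auto intro: continuous_intros)
  qed
  define u where "u \<nu> \<delta> y = monomial \<nu> (y - \<beta>) * \<phi> (\<delta> *\<^sub>R y)" for \<nu> \<delta> y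
  define H where "H \<nu> \<delta> = lattice_defect (\<lambda>y. s (y - \<alpha>) * u \<nu> \<delta> y)" for \<nu> \<delta>
  define K1 where "K1 \<nu> = 2 ^ N * ((1 + norm \<beta>) ^ mi_order \<nu> * (C + C))" for \<nu> :: "'n \<Rightarrow> nat"
  have K1: "0 \<le> K1 \<nu>" for \<nu> unfolding K1_def using C by simp
  have uc: "continuous_on UNIV (u \<nu> \<delta>)" for \<nu> \<delta>
    unfolding u_def by (intro continuous_on_mult mc \<phi>c)
  have u0: "u \<nu> \<delta> y = 0" if "0 < \<delta>" "norm y > 2 * real CARD('n) / \<delta>" for \<nu> \<delta> y
    unfolding u_def using \<phi>0[OF that] by simp
  have ua: "admissible (\<lambda>y. s (y - \<alpha>) * u \<nu> \<delta> y)" if "0 < \<delta>" for \<nu> \<delta>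
    using uc u0[OF that] by (rule admissible_s_mult)
  have Hdiff: "\<bar>H \<nu> \<delta> - H \<nu> \<delta>'\<bar> \<le> K * K1 \<nu> * \<delta> ^ (p + 1 - mi_order \<nu>)"
    if \<nu>: "mi_order \<nu> \<le> p" and \<delta>: "0 < \<delta>'" "\<delta>' \<le> \<delta>" "\<delta> \<le> 1" for \<nu> \<delta> \<delta>'
  proof -
    have \<delta>0: "0 < \<delta>" using \<delta> by simp
    have "H \<nu> \<delta> - H \<nu> \<delta>' = lattice_defect (\<lambda>y. s (y - \<alpha>) * (u \<nu> \<delta> y - u \<nu> \<delta>' y))"
      unfolding H_def right_diff_distrib
      by (rule lattice_defect_diff[symmetric]) (use ua \<delta> \<delta>0 in auto)
    also have "\<bar>\<dots>\<bar> \<le> K * (K1 \<nu> * \<delta> ^ (p + 1 - mi_order \<nu>))"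
    proof (rule NK)
      show "continuous_on UNIV (\<lambda>y. u \<nu> \<delta> y - u \<nu> \<delta>' y)"
        by (intro continuous_on_diff uc)
      show "u \<nu> \<delta> y - u \<nu> \<delta>' y = 0" if "norm y > 2 * real CARD('n) / \<delta>'" for y
      proof -
        have "2 * real CARD('n) / \<delta> \<le> 2 * real CARD('n) / \<delta>'"
          using \<delta> by (intro divide_left_mono) auto
        then show ?thesis using that u0[OF \<delta>(1) that] u0[OF \<delta>0, of y] by simp
      qed
      show "0 \<le> K1 \<nu> * \<delta> ^ (p + 1 - mi_order \<nu>)" using K1 \<delta>0 by simp
      fix i
      have \<delta>1: "\<delta>' \<le> 1" using \<delta> by simp
      have "symbol_bound i N UNIV
          (\<lambda>y. 2 ^ N * (((1 + norm \<beta>) ^ mi_order \<nu> * (1 + norm y) ^ mi_order \<nu>) * (C + C)))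
          (\<lambda>y. monomial \<nu> (y - \<beta>) * (\<phi> (\<delta> *\<^sub>R y) - \<phi> (\<delta>' *\<^sub>R y)))"
        by (intro symbol_bound_mult symbol_bound_diff symbol_bound_monomial_translate \<phi>(4) open_UNIV)
           (use \<delta> \<delta>0 \<delta>1 in auto)
      then show "symbol_bound i N UNIV (\<lambda>y. K1 \<nu> * \<delta> ^ (p + 1 - mi_order \<nu>) * (1 + norm y) ^ (p + 1))
          (\<lambda>y. u \<nu> \<delta> y - u \<nu> \<delta>' y)"
        unfolding u_def right_diff_distrib[symmetric]
      proof (rule symbol_bound_vanishing)
        show "open {y::real^'n. norm y < 1 / \<delta>}" by (intro open_Collect_less continuous_intros)
        show "monomial \<nu> (y - \<beta>) * (\<phi> (\<delta> *\<^sub>R y) - \<phi> (\<delta>' *\<^sub>R y)) = 0" if "y \<in> {y. norm y < 1 / \<delta>}" for y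
        proof -
          have "1 / \<delta> \<le> 1 / \<delta>'" using \<delta> by (intro divide_left_mono) auto
          then show ?thesis using that \<phi>1[OF \<delta>0, of y] \<phi>1[OF \<delta>(1), of y] by simp
        qed
        show "2 ^ N * (((1 + norm \<beta>) ^ mi_order \<nu> * (1 + norm y) ^ mi_order \<nu>) * (C + C))
            \<le> K1 \<nu> * \<delta> ^ (p + 1 - mi_order \<nu>) * (1 + norm y) ^ (p + 1)" if "y \<notin> {y. norm y < 1 / \<delta>}" for y
        proof -
          have "(1 + norm y) ^ mi_order \<nu> \<le> \<delta> ^ (p + 1 - mi_order \<nu>) * (1 + norm y) ^ (p + 1)"
            by (rule power_gain_far) (use \<delta>0 that \<nu> in auto)
          from mult_left_mono[OF this K1[of \<nu>]] show ?thesis by (simp add: K1_def mult_ac)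
        qed
        show "0 \<le> K1 \<nu> * \<delta> ^ (p + 1 - mi_order \<nu>) * (1 + norm y) ^ (p + 1)" for y :: "real ^ 'n"
          using K1 \<delta>0 by simp
      qed
    qed
    finally show ?thesis by (simp add: mult_ac)
  qed
  have "\<exists>m. mi_order \<nu> \<le> p \<longrightarrow> (\<forall>\<delta>. 0 < \<delta> \<longrightarrow> \<delta> \<le> 1 \<longrightarrow> \<bar>H \<nu> \<delta> - m\<bar> \<le> K * K1 \<nu> * \<delta> ^ (p + 1 - mi_order \<nu>))" for \<nu>
    using ex_limit_at_0[of "p + 1 - mi_order \<nu>" "H \<nu>" "K * K1 \<nu>"] Hdiff[of \<nu>]
    by (cases "mi_order \<nu> \<le> p") auto
  then obtain \<mu> where \<mu>: "\<And>\<nu> \<delta>. mi_order \<nu> \<le> p \<Longrightarrow> 0 < \<delta> \<Longrightarrow> \<delta> \<le> 1 \<Longrightarrow> \<bar>H \<nu> \<delta> - \<mu> \<nu>\<bar> \<le> K * K1 \<nu> * \<delta> ^ (p + 1 - mi_order \<nu>)"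
    by metis
  have main: "\<exists>D. \<forall>h. 0 < h \<longrightarrow> h \<le> 1 \<longrightarrow>
      \<bar>lattice_defect (\<lambda>y. s (y - \<alpha>) * v (h *\<^sub>R y)) -
        (\<Sum>\<nu> | mi_order \<nu> \<le> p. h ^ mi_order \<nu> * multi_deriv \<nu> v (h *\<^sub>R \<beta>) * \<mu> \<nu>)\<bar> \<le> D * h ^ (p + 1)"
    if v: "\<And>k. Ck_on k UNIV v" and supp: "\<And>x. norm x > L \<Longrightarrow> v x = 0" for v L
  proof -
    obtain B where B: "0 \<le> B" "\<And>is x. length is \<le> max N p \<Longrightarrow> \<bar>foldr partial_deriv is v x\<bar> \<le> B"
      "\<And>z is x. length is \<le> max N p \<Longrightarrow> \<bar>taylor_remainder p v z is x\<bar> \<le> B * norm (x - z) ^ (p + 1 - length is)"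
      using taylor_remainder_bound[OF v supp, where N = "max N p" and p = p] by metis
    have vc: "continuous_on UNIV v" using v[of 0] by simp
    have vhc: "continuous_on UNIV (\<lambda>y. v (h *\<^sub>R y))" for h
      by (intro continuous_on_compose2[OF vc] continuous_intros) auto
    have mdB: "\<bar>multi_deriv \<nu> v x\<bar> \<le> B" if "mi_order \<nu> \<le> p" for \<nu> x
    proof -
      obtain xs where xs: "mset xs = Abs_multiset \<nu>" using ex_mset by blast
      have c: "count_list xs i = \<nu> i" for i
        unfolding count_mset[symmetric] xs by (subst Abs_multiset_inverse) auto
      have "length xs = mi_order \<nu>"
        using sum_count_set[of xs UNIV] by (simp add: mi_order_def c)
      then show ?thesis using B(2)[of xs x] that multi_deriv_eq_foldr[OF v, of xs \<nu>] c by simp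
    qed
    \<comment> \<open>The region \<open>norm y < c / h\<close> is an open neighbourhood of the support of \<open>\<phi> (h y)\<close>.\<close>
    define c where "c = 2 * real CARD('n) + 1"
    define B1 where "B1 = B * (1 + norm \<beta>) ^ (p + 1) * (1 + c) ^ N"
    define B2 where "B2 = B * (1 + max L 0) ^ N"
    define A0 where "A0 = 2 ^ N * (C * B1) + 2 ^ N * ((1 + C) * B2)"
    have c0: "0 \<le> c" by (simp add: c_def)
    have B12: "0 \<le> B1" "0 \<le> B2" using B(1) c0 by (simp_all add: B1_def B2_def)
    have A0: "0 \<le> A0" using B12 C by (simp add: A0_def)
    define D where "D = K * A0 + (\<Sum>\<nu> | mi_order \<nu> \<le> p. B * (K * K1 \<nu>))"
    have "\<bar>lattice_defect (\<lambda>y. s (y - \<alpha>) * v (h *\<^sub>R y)) -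
        (\<Sum>\<nu> | mi_order \<nu> \<le> p. h ^ mi_order \<nu> * multi_deriv \<nu> v (h *\<^sub>R \<beta>) * \<mu> \<nu>)\<bar> \<le> D * h ^ (p + 1)"
      if h: "0 < h" "h \<le> 1" for h
    proof -
      define a where "a \<nu> = h ^ mi_order \<nu> * multi_deriv \<nu> v (h *\<^sub>R \<beta>)" for \<nu>
      define w where "w y = v (h *\<^sub>R y) - (\<Sum>\<nu> | mi_order \<nu> \<le> p. a \<nu> * u \<nu> h y)" for y
      have sumeq: "(\<Sum>\<nu> | mi_order \<nu> \<le> p. a \<nu> * u \<nu> h y) =
          \<phi> (h *\<^sub>R y) * (\<Sum>\<nu> | mi_order \<nu> \<le> p. multi_deriv \<nu> v (h *\<^sub>R \<beta>) * monomial \<nu> (h *\<^sub>R y - h *\<^sub>R \<beta>))" for y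
        unfolding sum_distrib_left a_def u_def
        by (intro sum.cong refl) (simp add: monomial_scale mult_ac flip: scaleR_diff_right)
      \<comment> \<open>The first term is a truncated Taylor remainder, the second vanishes for \<open>norm y < 1 / h\<close>.\<close>
      have weq: "w y = \<phi> (h *\<^sub>R y) * taylor_remainder p v (h *\<^sub>R \<beta>) [] (h *\<^sub>R y) + (1 - \<phi> (h *\<^sub>R y)) * v (h *\<^sub>R y)" for y
        unfolding w_def sumeq taylor_remainder_def by (simp add: algebra_simps)
      have wc: "continuous_on UNIV w"
        unfolding w_def by (intro continuous_on_diff continuous_on_sum continuous_on_mult continuous_on_const vhc uc)
      define R where "R = max (2 * real CARD('n) / h) (L / h)"
      have v0: "v (h *\<^sub>R y) = 0" if "norm y > R" for y
        using that h by (intro supp) (simp add: R_def field_simps)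
      have w0: "w y = 0" if "norm y > R" for y
        unfolding w_def using v0[OF that] u0[OF h(1), of y] that by (simp add: R_def)
      have va: "admissible (\<lambda>y. s (y - \<alpha>) * v (h *\<^sub>R y))"
        using vhc v0 by (rule admissible_s_mult)
      note sa = lattice_defect_sum[OF finite_mi_order_le, of p "\<lambda>\<nu> y. s (y - \<alpha>) * u \<nu> h y" a, OF ua[OF h(1)]]
      have "lattice_defect (\<lambda>y. s (y - \<alpha>) * w y) =
          lattice_defect (\<lambda>y. s (y - \<alpha>) * v (h *\<^sub>R y)) - (\<Sum>\<nu> | mi_order \<nu> \<le> p. a \<nu> * H \<nu> h)"
      proof -
        have "s (y - \<alpha>) * w y = s (y - \<alpha>) * v (h *\<^sub>R y) - (\<Sum>\<nu> | mi_order \<nu> \<le> p. a \<nu> * (s (y - \<alpha>) * u \<nu> h y))" for y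
          unfolding w_def right_diff_distrib sum_distrib_left by (simp add: mult_ac)
        then show ?thesis
          using lattice_defect_diff[OF va conjunct1[OF sa]] conjunct2[OF sa] by (simp add: H_def)
      qed
      moreover have "\<bar>lattice_defect (\<lambda>y. s (y - \<alpha>) * w y)\<bar> \<le> K * (A0 * h ^ (p + 1))"
      proof (rule NK[OF wc w0])
        show "0 \<le> A0 * h ^ (p + 1)" using A0 h by simp
        fix i
        let ?q = "\<lambda>y::real^'n. h ^ (p + 1) * (1 + norm y) ^ (p + 1)"
        have q0: "0 \<le> ?q y" for y using h by simp
        have s1: "symbol_bound i N UNIV (\<lambda>y. 2 ^ N * (C * B1) * ?q y)
            (\<lambda>y. \<phi> (h *\<^sub>R y) * taylor_remainder p v (h *\<^sub>R \<beta>) [] (h *\<^sub>R y))"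
        proof -
          let ?U = "{y::real^'n. norm y < c / h}" and ?V = "{y::real^'n. norm y > 2 * real CARD('n) / h}"
          have o: "open ?U" "open ?V" by (intro open_Collect_less continuous_intros)+
          have "symbol_bound i N ?U (\<lambda>y. 2 ^ N * (C * (B1 * ?q y)))
            (\<lambda>y. \<phi> (h *\<^sub>R y) * taylor_remainder p v (h *\<^sub>R \<beta>) [] (h *\<^sub>R y))"
          proof (rule symbol_bound_mult[OF o(1)])
            show "symbol_bound i N ?U (\<lambda>_. C) (\<lambda>y. \<phi> (h *\<^sub>R y))"
              by (rule symbol_bound_mono[OF \<phi>(4)[OF h]]) auto
            show "symbol_bound i N ?U (\<lambda>y. B1 * ?q y) (\<lambda>y. taylor_remainder p v (h *\<^sub>R \<beta>) [] (h *\<^sub>R y))"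
              unfolding B1_def
              by (rule symbol_bound_taylor_remainder_dilation[OF v h B(1) c0]) (use B(3) in auto)
          qed
          then have "symbol_bound i N ?U (\<lambda>y. 2 ^ N * (C * B1) * ?q y)
            (\<lambda>y. \<phi> (h *\<^sub>R y) * taylor_remainder p v (h *\<^sub>R \<beta>) [] (h *\<^sub>R y))"
            by (simp only: mult.assoc)
          moreover have "symbol_bound i N ?V (\<lambda>y. 2 ^ N * (C * B1) * ?q y)
            (\<lambda>y. \<phi> (h *\<^sub>R y) * taylor_remainder p v (h *\<^sub>R \<beta>) [] (h *\<^sub>R y))"
            using symbol_bound_0[OF o(2), of "\<lambda>y. 2 ^ N * (C * B1) * ?q y" i N] C B12 q0
            by (subst symbol_bound_cong[OF o(2), of _ "\<lambda>_. 0"]) (auto simp: \<phi>0[OF h(1)])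
          ultimately have "symbol_bound i N (?U \<union> ?V) (\<lambda>y. 2 ^ N * (C * B1) * ?q y)
            (\<lambda>y. \<phi> (h *\<^sub>R y) * taylor_remainder p v (h *\<^sub>R \<beta>) [] (h *\<^sub>R y))"
            by (rule symbol_bound_Un)
          moreover have "?U \<union> ?V = UNIV"
          proof -
            have "2 * real CARD('n) / h < c / h" using h by (intro divide_strict_right_mono) (auto simp: c_def)
            then show ?thesis by auto
          qed
          ultimately show ?thesis by simp
        qed
        have s2: "symbol_bound i N UNIV (\<lambda>y. 2 ^ N * ((1 + C) * B2) * ?q y) (\<lambda>y. (1 - \<phi> (h *\<^sub>R y)) * v (h *\<^sub>R y))"
        proof (rule symbol_bound_vanishing)
          show "symbol_bound i N UNIV (\<lambda>y. 2 ^ N * ((1 + C) * B2)) (\<lambda>y. (1 - \<phi> (h *\<^sub>R y)) * v (h *\<^sub>R y))"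
          proof (rule symbol_bound_mult[OF open_UNIV])
            show "symbol_bound i N UNIV (\<lambda>y. 1 + C) (\<lambda>y. 1 - \<phi> (h *\<^sub>R y))"
              using symbol_bound_diff[OF open_UNIV symbol_bound_const[OF open_UNIV, of i N 1] \<phi>(4)[OF h]] by simp
            show "symbol_bound i N UNIV (\<lambda>y. B2) (\<lambda>y. v (h *\<^sub>R y))"
              unfolding B2_def by (rule symbol_bound_smooth_dilation[OF v supp _ h]) (use B(2) in auto)
          qed
          show "open {y::real^'n. norm y < 1 / h}" by (intro open_Collect_less continuous_intros)
          show "(1 - \<phi> (h *\<^sub>R y)) * v (h *\<^sub>R y) = 0" if "y \<in> {y. norm y < 1 / h}" for y
            using that \<phi>1[OF h(1), of y] by simp
          show "2 ^ N * ((1 + C) * B2) \<le> 2 ^ N * ((1 + C) * B2) * ?q y" if "y \<notin> {y. norm y < 1 / h}" for y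
          proof -
            have "1 \<le> ?q y" using power_gain_far[OF h(1), of y 0 "p + 1"] that by simp
            from mult_left_mono[OF this, of "2 ^ N * ((1 + C) * B2)"] show ?thesis using C B12 by simp
          qed
          show "0 \<le> 2 ^ N * ((1 + C) * B2) * ?q y" for y using q0 C B12 by simp
        qed
        have "symbol_bound i N UNIV (\<lambda>y. 2 ^ N * (C * B1) * ?q y + 2 ^ N * ((1 + C) * B2) * ?q y) w"
          unfolding weq[abs_def] by (rule symbol_bound_add[OF open_UNIV s1 s2])
        then show "symbol_bound i N UNIV (\<lambda>y. A0 * h ^ (p + 1) * (1 + norm y) ^ (p + 1)) w"
          by (rule symbol_bound_mono) (auto simp: A0_def algebra_simps)
      qed
      moreover have "\<bar>(\<Sum>\<nu> | mi_order \<nu> \<le> p. a \<nu> * H \<nu> h) - (\<Sum>\<nu> | mi_order \<nu> \<le> p. a \<nu> * \<mu> \<nu>)\<bar>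
          \<le> (\<Sum>\<nu> | mi_order \<nu> \<le> p. B * (K * K1 \<nu>)) * h ^ (p + 1)"
      proof -
        have "\<bar>a \<nu> * H \<nu> h - a \<nu> * \<mu> \<nu>\<bar> \<le> B * (K * K1 \<nu>) * h ^ (p + 1)" if \<nu>: "mi_order \<nu> \<le> p" for \<nu>
        proof -
          have "\<bar>a \<nu> * H \<nu> h - a \<nu> * \<mu> \<nu>\<bar> = h ^ mi_order \<nu> * (\<bar>multi_deriv \<nu> v (h *\<^sub>R \<beta>)\<bar> * \<bar>H \<nu> h - \<mu> \<nu>\<bar>)"
            using h by (simp add: a_def abs_mult flip: right_diff_distrib)
          also have "\<dots> \<le> h ^ mi_order \<nu> * (B * (K * K1 \<nu> * h ^ (p + 1 - mi_order \<nu>)))"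
            using \<mu>[OF \<nu> h] mdB[OF \<nu>] h B(1) by (intro mult_left_mono mult_mono) auto
          also have "\<dots> = B * (K * K1 \<nu>) * (h ^ mi_order \<nu> * h ^ (p + 1 - mi_order \<nu>))"
            by (simp add: mult_ac)
          also have "h ^ mi_order \<nu> * h ^ (p + 1 - mi_order \<nu>) = h ^ (p + 1)"
            using \<nu> by (simp flip: power_add)
          finally show ?thesis .
        qed
        then show ?thesis
          unfolding sum_subtractf[symmetric] sum_distrib_right
          by (intro order_trans[OF sum_abs] sum_mono) auto
      qed
      ultimately show ?thesis unfolding D_def a_def[symmetric] distrib_right by (simp add: mult.assoc)
    qed
    then show ?thesis by blast
  qed
  from that[OF main] show thesis .
qed

end

section \<open>The quadrature error\<close>

lemma quadrature_error_scale:
  fixes f :: "real ^ 'n::finite \<Rightarrow> real"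
  assumes h: "0 < h" and f: "f \<in> borel_measurable borel"
  shows "quadrature_error h f = h ^ CARD('n) * lattice_defect (\<lambda>y. f (h *\<^sub>R y))"
proof -
  have [measurable]: "f \<in> borel_measurable borel" by (rule f)
  have "(\<integral>x. f x \<partial>lborel) = (\<integral>x. f x \<partial>density (distr lborel borel (\<lambda>x. 0 + h *\<^sub>R x)) (\<lambda>_. ennreal (\<bar>h\<bar> ^ DIM(real ^ 'n))))"
    by (subst lborel_affine[of h 0]) (use h in \<open>auto simp: ennreal_power\<close>)
  also have "\<dots> = h ^ CARD('n) * (\<integral>y. f (h *\<^sub>R y) \<partial>lborel)"
    using h by (simp add: integral_density integral_distr)
  finally have int: "(\<integral>x. f x \<partial>lborel) = h ^ CARD('n) * (\<integral>y. f (h *\<^sub>R y) \<partial>lborel)" .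
  let ?g = "\<lambda>k :: int ^ 'n. h *\<^sub>R lattice_point k"
  have inj: "inj ?g"
    using h inj_lattice_point by (auto simp: inj_def)
  have "?g = (\<lambda>k. \<chi> i. h * of_int (k $ i))"
    by (auto simp: vec_eq_iff)
  then have grid: "(grid h :: (real ^ 'n) set) = range ?g" unfolding grid_def by (simp only:)
  have "(lattice_point 0 :: real ^ 'n) = 0" by (simp add: vec_eq_iff)
  then have "grid h - {0} = ?g ` (UNIV - {0})"
    unfolding grid using image_set_diff[OF inj, of UNIV "{0}"] by simp
  then have "(\<Sum>\<^sub>\<infinity>y\<in>grid h - {0}. f y) = (\<Sum>\<^sub>\<infinity>k\<in>UNIV - {0}. f (h *\<^sub>R lattice_point k))"
    using infsum_reindex[of ?g "UNIV - {0}" f] inj by (simp add: inj_on_subset comp_def)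
  then show ?thesis
    unfolding quadrature_error_def punctured_trapezoidal_def lattice_defect_def
    by (simp add: int right_diff_distrib)
qed

lemma test_functionD:
  assumes "v \<in> test_functions (ball 0 L)"
  shows "norm x \<ge> L \<Longrightarrow> v x = 0"
proof (rule ccontr)
  assume "norm x \<ge> L" "v x \<noteq> 0"
  moreover have "x \<in> closure {x. v x \<noteq> 0}"
    using \<open>v x \<noteq> 0\<close> closure_subset[of "{x. v x \<noteq> 0}"] by auto
  ultimately show False using assms by (auto simp: test_functions_def)
qed

context homogeneous_function
begin

text \<open>
  The function \<open>s0 (x - h \<alpha>)\<close> may differ from \<open>s (x - h \<alpha>)\<close> at the single point \<open>h \<alpha>\<close> of the support of \<open>v\<close>. This point is null
  for the integral, and since \<open>|\<alpha>|\<close> is at most one half in the maximum norm it is not one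
  of the nonzero summation points.
\<close>
lemma quadrature_error_product:
  fixes s0 v :: "real ^ 'n \<Rightarrow> real"
  assumes h: "0 < h" and \<alpha>: "infnorm \<alpha> \<le> 1 / 2" and v: "v \<in> borel_measurable borel"
    and eq: "\<And>x. v x \<noteq> 0 \<Longrightarrow> x \<noteq> h *\<^sub>R \<alpha> \<Longrightarrow> s0 (x - h *\<^sub>R \<alpha>) = s (x - h *\<^sub>R \<alpha>)"
  shows "quadrature_error h (\<lambda>x. s0 (x - h *\<^sub>R \<alpha>) * v x) =
    h powr (\<gamma> + real CARD('n)) * lattice_defect (\<lambda>y. s (y - \<alpha>) * v (h *\<^sub>R y))"
proof -
  note [measurable] = v
  let ?f = "\<lambda>x. s0 (x - h *\<^sub>R \<alpha>) * v x" and ?g = "\<lambda>x. s (x - h *\<^sub>R \<alpha>) * v x"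
  define c where "c = (s0 0 - s 0) * v (h *\<^sub>R \<alpha>)"
  have fg: "?f x = ?g x" if "x \<noteq> h *\<^sub>R \<alpha>" for x
    using eq[of x] that by (cases "v x = 0") auto
  have f: "?f = (\<lambda>x. ?g x + indicator {h *\<^sub>R \<alpha>} x * c)"
  proof
    fix x show "?f x = ?g x + indicator {h *\<^sub>R \<alpha>} x * c"
      using fg[of x] by (cases "x = h *\<^sub>R \<alpha>") (auto simp: c_def algebra_simps)
  qed
  have gm [measurable]: "?g \<in> borel_measurable borel" by measurable
  have fm [measurable]: "?f \<in> borel_measurable borel" unfolding f by measurable
  have "(\<integral>x. ?f x \<partial>lborel) = (\<integral>x. ?g x \<partial>lborel)"
    using AE_lborel_singleton[of "h *\<^sub>R \<alpha>"] fg by (intro integral_cong_AE) (auto elim!: eventually_mono)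
  moreover have "(\<Sum>\<^sub>\<infinity>y\<in>grid h - {0}. ?f y) = (\<Sum>\<^sub>\<infinity>y\<in>grid h - {0}. ?g y)"
  proof (rule infsum_cong, rule fg)
    fix y :: "real ^ 'n" assume y: "y \<in> grid h - {0}"
    then obtain k :: "int ^ 'n" where k: "y = (\<chi> i. h * of_int (k $ i))" by (auto simp: grid_def)
    show "y \<noteq> h *\<^sub>R \<alpha>"
    proof
      assume "y = h *\<^sub>R \<alpha>"
      then have "\<alpha> $ i = of_int (k $ i)" for i
        using h by (simp add: k vec_eq_iff)
      moreover have "\<bar>\<alpha> $ i\<bar> \<le> 1 / 2" for i
        using component_le_infnorm_cart[of \<alpha> i] \<alpha> by linarith
      ultimately have "\<bar>real_of_int (k $ i)\<bar> \<le> 1 / 2" for i by metis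
      then have "k $ i = 0" for i
        by (smt (verit, ccfv_SIG) of_int_le_1_iff of_int_1_le_iff of_int_less_1_iff divide_less_eq_1 abs_less_iff int_one_le_iff_zero_less of_int_minus)
      then have "y = 0" by (simp add: k vec_eq_iff)
      then show False using y by simp
    qed
  qed
  ultimately have "quadrature_error h ?f = quadrature_error h ?g"
    unfolding quadrature_error_def punctured_trapezoidal_def by simp
  also have "\<dots> = h ^ CARD('n) * lattice_defect (\<lambda>y. s (h *\<^sub>R y - h *\<^sub>R \<alpha>) * v (h *\<^sub>R y))"
    by (rule quadrature_error_scale[OF h gm])
  also have "(\<lambda>y. s (h *\<^sub>R y - h *\<^sub>R \<alpha>) * v (h *\<^sub>R y)) = (\<lambda>y. h powr \<gamma> * (s (y - \<alpha>) * v (h *\<^sub>R y)))"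
    using hom[OF h] by (simp add: scaleR_diff_right[symmetric] mult.assoc)
  also have "lattice_defect \<dots> = h powr \<gamma> * lattice_defect (\<lambda>y. s (y - \<alpha>) * v (h *\<^sub>R y))"
    by (rule lattice_defect_scale)
  finally show ?thesis using h by (simp add: powr_add powr_realpow mult_ac)
qed

lemma quadrature_error_expansion:
  assumes \<alpha>: "infnorm \<alpha> \<le> 1 / 2"
  obtains \<mu> where
    "\<And>L L' h0 s0 v. \<lbrakk>0 < h0; h0 \<le> 1; L + 3 / 2 * h0 * sqrt (real CARD('n)) < L';
        \<forall>x\<in>ball 0 L' - {0}. s0 x = s x; v \<in> test_functions (ball 0 L)\<rbrakk> \<Longrightarrow>
      \<exists>R. R \<in> O[at_right 0](\<lambda>h. h powr (\<gamma> + real CARD('n) + real p + 1)) \<and>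
        (\<forall>h\<in>{0<..<h0}. quadrature_error h (\<lambda>x. s0 (x - h *\<^sub>R \<alpha>) * v x) =
          h powr (\<gamma> + real CARD('n)) *
            (\<Sum>\<nu> | mi_order \<nu> \<le> p. h ^ mi_order \<nu> * multi_deriv \<nu> v (h *\<^sub>R \<beta>) * \<mu> \<nu>) + R h)"
proof -
  obtain \<mu> where \<mu>: "\<And>v L. \<lbrakk>\<And>k. Ck_on k UNIV v; \<And>x. norm x > L \<Longrightarrow> v x = 0\<rbrakk> \<Longrightarrow>
      \<exists>D. \<forall>h. 0 < h \<longrightarrow> h \<le> 1 \<longrightarrow>
        \<bar>lattice_defect (\<lambda>y. s (y - \<alpha>) * v (h *\<^sub>R y)) -
          (\<Sum>\<nu> | mi_order \<nu> \<le> p. h ^ mi_order \<nu> * multi_deriv \<nu> v (h *\<^sub>R \<beta>) * \<mu> \<nu>)\<bar> \<le> D * h ^ (p + 1)"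
    by (rule lattice_defect_expansion[where \<alpha> = \<alpha> and p = p and \<beta> = \<beta>]) blast
  have expansion: "\<exists>R. R \<in> O[at_right 0](\<lambda>h. h powr (\<gamma> + real CARD('n) + real p + 1)) \<and>
      (\<forall>h\<in>{0<..<h0}. quadrature_error h (\<lambda>x. s0 (x - h *\<^sub>R \<alpha>) * v x) =
            h powr (\<gamma> + real CARD('n)) *
              (\<Sum>\<nu> | mi_order \<nu> \<le> p. h ^ mi_order \<nu> * multi_deriv \<nu> v (h *\<^sub>R \<beta>) * \<mu> \<nu>) + R h)"
    if h0: "0 < h0" "h0 \<le> 1" and L': "L + 3 / 2 * h0 * sqrt (real CARD('n)) < L'"
      and s0: "\<forall>x\<in>ball 0 L' - {0}. s0 x = s x"
      and v: "v \<in> test_functions (ball 0 L)" for L L' h0 s0 v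
  proof -
    have vC: "Ck_on k UNIV v" for k using v by (rule test_function_Ck)
    have v0: "v x = 0" if "norm x \<ge> L" for x using test_functionD[OF v] that .
    have vm: "v \<in> borel_measurable borel"
      using vC[of 0] by (auto intro: borel_measurable_continuous_onI)
    have "v x = 0" if "norm x > L" for x using v0[of x] that by simp
    from exE[OF \<mu>[OF vC this]] obtain D where D: "\<forall>h. 0 < h \<longrightarrow> h \<le> 1 \<longrightarrow>
      \<bar>lattice_defect (\<lambda>y. s (y - \<alpha>) * v (h *\<^sub>R y)) -
        (\<Sum>\<nu> | mi_order \<nu> \<le> p. h ^ mi_order \<nu> * multi_deriv \<nu> v (h *\<^sub>R \<beta>) * \<mu> \<nu>)\<bar> \<le> D * h ^ (p + 1)" .
    define E where "E h = lattice_defect (\<lambda>y. s (y - \<alpha>) * v (h *\<^sub>R y))" for h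
    define S where "S h = (\<Sum>\<nu> | mi_order \<nu> \<le> p. h ^ mi_order \<nu> * multi_deriv \<nu> v (h *\<^sub>R \<beta>) * \<mu> \<nu>)" for h
    define R where "R h = h powr (\<gamma> + real CARD('n)) * (E h - S h)" for h
    have norm\<alpha>: "norm \<alpha> \<le> sqrt (real CARD('n)) / 2"
    proof -
      have "norm \<alpha> \<le> sqrt (real CARD('n)) * infnorm \<alpha>"
        using norm_le_infnorm[of \<alpha>] by simp
      also have "\<dots> \<le> sqrt (real CARD('n)) * (1 / 2)"
        using \<alpha> by (intro mult_left_mono) auto
      finally show ?thesis by simp
    qed
    have qe: "quadrature_error h (\<lambda>x. s0 (x - h *\<^sub>R \<alpha>) * v x) = h powr (\<gamma> + real CARD('n)) * E h"
      if h: "h \<in> {0<..<h0}" for h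
      unfolding E_def
    proof (rule quadrature_error_product[OF _ \<alpha> vm])
      show "0 < h" using h by simp
      fix x assume x: "v x \<noteq> 0" "x \<noteq> h *\<^sub>R \<alpha>"
      have nx: "norm x \<le> L" using v0[of x] x(1) by force
      have "norm (x - h *\<^sub>R \<alpha>) \<le> norm x + h * norm \<alpha>"
        using norm_triangle_ineq4[of x "h *\<^sub>R \<alpha>"] h by simp
      also have "\<dots> \<le> L + h0 * (sqrt (real CARD('n)) / 2)"
        using nx h norm\<alpha> by (intro add_mono mult_mono) auto
      also have "\<dots> \<le> L + 3 / 2 * h0 * sqrt (real CARD('n))"
        using h0 by (simp add: field_simps)
      also have "\<dots> < L'" by (rule L')
      finally have "x - h *\<^sub>R \<alpha> \<in> ball 0 L' - {0}" using x(2) by simp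
      then show "s0 (x - h *\<^sub>R \<alpha>) = s (x - h *\<^sub>R \<alpha>)" using s0 by simp
    qed
    have "R \<in> O[at_right 0](\<lambda>h. h powr (\<gamma> + real CARD('n) + real p + 1))"
    proof (rule bigoI[where c = D])
      have "eventually (\<lambda>h::real. h \<in> {0<..<1}) (at_right 0)"
        by (rule eventually_at_right_real) simp
      then show "\<forall>\<^sub>F h in at_right 0. norm (R h) \<le> D * norm (h powr (\<gamma> + real CARD('n) + real p + 1))"
      proof eventually_elim
        case (elim h)
        then have "\<bar>R h\<bar> \<le> h powr (\<gamma> + real CARD('n)) * (D * h ^ (p + 1))"
          using D[rule_format, of h] unfolding R_def E_def[symmetric] S_def[symmetric] abs_mult
          by (intro mult_mono) auto
        also have "\<dots> = D * h powr (\<gamma> + real CARD('n) + real (p + 1))"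
          using elim by (simp add: powr_add powr_realpow)
        finally show ?case by (simp add: add_ac)
      qed
    qed
    moreover have "\<forall>h\<in>{0<..<h0}. quadrature_error h (\<lambda>x. s0 (x - h *\<^sub>R \<alpha>) * v x) =
            h powr (\<gamma> + real CARD('n)) * S h + R h"
      using qe by (simp add: R_def algebra_simps)
    ultimately show ?thesis unfolding S_def by blast
  qed
  from that[OF expansion] show thesis .
qed

end

theorem theorem3p1:
  fixes p :: nat and \<gamma> :: real and \<alpha> :: "real ^ 'n::finite" and l0 :: "real ^ 'n \<Rightarrow> real"
  assumes "\<gamma> > - real CARD('n)"
    and "infnorm \<alpha> \<le> 1 / 2"
    and "smooth_on_sphere l0"
  shows "\<exists>\<mu> M :: ('n \<Rightarrow> nat) \<Rightarrow> real.
    \<forall>(L::real) (L'::real) (h0::real) (s0 :: real ^ 'n \<Rightarrow> real).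
      0 < L + 3 / 2 * h0 * sqrt (real CARD('n)) \<and>
      L + 3 / 2 * h0 * sqrt (real CARD('n)) < L' \<and>
      0 < h0 \<and> h0 \<le> 1 \<and>
      smooth_on (ball 0 L' - {0}) s0 \<and>
      (\<forall>x\<in>ball 0 L' - {0}. s0 x = norm x powr \<gamma> * l0 (x /\<^sub>R norm x)) \<longrightarrow>
      (\<forall>v\<in>test_functions (ball 0 L).
        \<exists>R1 R2 :: real \<Rightarrow> real.
          R1 \<in> O[at_right 0](\<lambda>h. h powr (\<gamma> + real CARD('n) + real p + 1)) \<and>
          R2 \<in> O[at_right 0](\<lambda>h. h powr (\<gamma> + real CARD('n) + real p + 1)) \<and>
          (\<forall>h\<in>{0<..<h0}.
            quadrature_error h (\<lambda>x. s0 (x - h *\<^sub>R \<alpha>) * v x) =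
              h powr (\<gamma> + real CARD('n)) *
                (\<Sum>\<nu> | mi_order \<nu> \<le> p. h ^ mi_order \<nu> * multi_deriv \<nu> v 0 * \<mu> \<nu>) + R1 h \<and>
            quadrature_error h (\<lambda>x. s0 (x - h *\<^sub>R \<alpha>) * v x) =
              h powr (\<gamma> + real CARD('n)) *
                (\<Sum>\<nu> | mi_order \<nu> \<le> p. h ^ mi_order \<nu> * multi_deriv \<nu> v (h *\<^sub>R \<alpha>) * M \<nu>) + R2 h))"
proof -
  define s where "s x = norm x powr \<gamma> * l0 (x /\<^sub>R norm x)" for x
  have hom: "s (t *\<^sub>R x) = t powr \<gamma> * s x" if "0 < t" for t x
  proof -
    have "inverse t * inverse (norm x) * t = inverse (norm x)"
      using that by simp
    moreover have "(t *\<^sub>R x) /\<^sub>R norm (t *\<^sub>R x) = (inverse t * inverse (norm x) * t) *\<^sub>R x"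
      using that by simp
    ultimately have "(t *\<^sub>R x) /\<^sub>R norm (t *\<^sub>R x) = x /\<^sub>R norm x" by (simp only:)
    moreover have "norm (t *\<^sub>R x) powr \<gamma> = t powr \<gamma> * norm x powr \<gamma>"
      using that by (simp add: powr_mult)
    ultimately show ?thesis unfolding s_def by (simp only: mult.assoc)
  qed
  \<comment> \<open>An admissible \<open>s0\<close> coincides with \<open>s\<close> on a punctured ball; so if \<open>s\<close> is smooth on no such ball, the claim is vacuous.\<close>
  show ?thesis
  proof (cases "\<exists>r>0. smooth_on (ball 0 r - {0}) s")
    case False
    have no: "\<not> smooth_on (ball 0 L' - {0}) s0"
      if "0 < L'" "\<forall>x\<in>ball 0 L' - {0}. s0 x = norm x powr \<gamma> * l0 (x /\<^sub>R norm x)" for L' s0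
    proof
      assume sm: "smooth_on (ball 0 L' - {0}) s0"
      have "Ck_on k (ball 0 L' - {0}) s0 \<longleftrightarrow> Ck_on k (ball 0 L' - {0}) s" for k
        using that(2) by (intro Ck_on_cong) (auto simp: s_def)
      then have "smooth_on (ball 0 L' - {0}) s" using sm by (simp add: smooth_on_def)
      then show False using False that(1) by blast
    qed
    show ?thesis
    proof (intro exI[of _ "\<lambda>_. 0"] allI impI, elim conjE, goal_cases)
      case (1 L L' h0 s0)
      then have "0 < L'" by linarith
      from no[OF this 1(6)] 1(5) show ?case by (rule notE)
    qed
  next
    case True
    then obtain r where r: "0 < r" "smooth_on (ball 0 r - {0}) s" by blast
    interpret homogeneous_function s \<gamma> r
      by unfold_locales (use r hom assms(1) in auto)
    obtain \<mu> where \<mu>: "\<And>L L' h0 s0 v. \<lbrakk>0 < h0; h0 \<le> 1; L + 3 / 2 * h0 * sqrt (real CARD('n)) < L';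
        \<forall>x\<in>ball 0 L' - {0}. s0 x = s x; v \<in> test_functions (ball 0 L)\<rbrakk> \<Longrightarrow>
      \<exists>R. R \<in> O[at_right 0](\<lambda>h. h powr (\<gamma> + real CARD('n) + real p + 1)) \<and>
        (\<forall>h\<in>{0<..<h0}. quadrature_error h (\<lambda>x. s0 (x - h *\<^sub>R \<alpha>) * v x) =
          h powr (\<gamma> + real CARD('n)) *
            (\<Sum>\<nu> | mi_order \<nu> \<le> p. h ^ mi_order \<nu> * multi_deriv \<nu> v (h *\<^sub>R 0) * \<mu> \<nu>) + R h)"
      by (rule quadrature_error_expansion[OF assms(2), where p = p and \<beta> = 0]) blast
    obtain M where M: "\<And>L L' h0 s0 v. \<lbrakk>0 < h0; h0 \<le> 1; L + 3 / 2 * h0 * sqrt (real CARD('n)) < L';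
        \<forall>x\<in>ball 0 L' - {0}. s0 x = s x; v \<in> test_functions (ball 0 L)\<rbrakk> \<Longrightarrow>
      \<exists>R. R \<in> O[at_right 0](\<lambda>h. h powr (\<gamma> + real CARD('n) + real p + 1)) \<and>
        (\<forall>h\<in>{0<..<h0}. quadrature_error h (\<lambda>x. s0 (x - h *\<^sub>R \<alpha>) * v x) =
          h powr (\<gamma> + real CARD('n)) *
            (\<Sum>\<nu> | mi_order \<nu> \<le> p. h ^ mi_order \<nu> * multi_deriv \<nu> v (h *\<^sub>R \<alpha>) * M \<nu>) + R h)"
      by (rule quadrature_error_expansion[OF assms(2), where p = p and \<beta> = \<alpha>]) blast
    show ?thesis
    proof (rule exI[of _ \<mu>], rule exI[of _ M], intro allI impI ballI, elim conjE)
      fix L L' h0 :: real and s0 v :: "real ^ 'n \<Rightarrow> real"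
      assume *: "v \<in> test_functions (ball 0 L)" "L + 3 / 2 * h0 * sqrt (real CARD('n)) < L'"
        "0 < h0" "h0 \<le> 1" "\<forall>x\<in>ball 0 L' - {0}. s0 x = norm x powr \<gamma> * l0 (x /\<^sub>R norm x)"
      have s0: "\<forall>x\<in>ball 0 L' - {0}. s0 x = s x" using *(5) by (simp add: s_def)
      from \<mu>[OF *(3,4,2) s0 *(1)] M[OF *(3,4,2) s0 *(1)]
      show "\<exists>R1 R2 :: real \<Rightarrow> real.
          R1 \<in> O[at_right 0](\<lambda>h. h powr (\<gamma> + real CARD('n) + real p + 1)) \<and>
          R2 \<in> O[at_right 0](\<lambda>h. h powr (\<gamma> + real CARD('n) + real p + 1)) \<and>
          (\<forall>h\<in>{0<..<h0}.
            quadrature_error h (\<lambda>x. s0 (x - h *\<^sub>R \<alpha>) * v x) =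
              h powr (\<gamma> + real CARD('n)) *
                (\<Sum>\<nu> | mi_order \<nu> \<le> p. h ^ mi_order \<nu> * multi_deriv \<nu> v 0 * \<mu> \<nu>) + R1 h \<and>
            quadrature_error h (\<lambda>x. s0 (x - h *\<^sub>R \<alpha>) * v x) =
              h powr (\<gamma> + real CARD('n)) *
                (\<Sum>\<nu> | mi_order \<nu> \<le> p. h ^ mi_order \<nu> * multi_deriv \<nu> v (h *\<^sub>R \<alpha>) * M \<nu>) + R2 h)"
        unfolding scaleR_zero_right by blast
    qed
  qed
qed

end
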